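(* Let $w_1,\dots,w_6$ be negative integers such that the linking matrix $W$ of the H-graph $\Gamma$ with weights $w_1,\dots,w_6$ is negative definite and $\det W=1$. Let $k\ge 2$ be an integer. Then the Witten--Reshetikhin--Turaev invariant $\tau_k(M_3(\Gamma))$ is the radial limit of the homological block $\widehat Z_\Gamma(q)$: $$\tau_k(M_3(\Gamma))=\frac{1}{2\left(\zeta_{2k}-\zeta_{2k}^{-1}\right)}\lim_{q\to\zeta_k,\ |q|<1}\widehat Z_\Gamma(q),$$ where the limit is taken radially, i.e. $q=\boldsymbol e(\tau)$ with $\tau=\frac1k+\mathrm i t$ and $t\to+0$.
   Context: Notation: $\boldsymbol e(z):=e^{2\pi \mathrm i z}$; $\zeta_k:=\boldsymbol e(1/k)$ and $\zeta_k^r:=\boldsymbol e(r/k)$ for $r\in\mathbb Q$; for $\tau$ in the upper half plane $q=\boldsymbol e(\tau)$ and $q^r:=\boldsymbol e(r\tau)$ for $r\in\mathbb Q$. The H-graph $\Gamma$ is the tree with vertices $1,\dots,6$, edges $\{1,2\},\{1,3\},\{1,4\},\{2,5\},\{2,6\}$, and integer weight $w_v$ at vertex $v$. Its linking matrix $W$ is the symmetric $6\times 6$ matrix with $W_{vv}=w_v$, $W_{vv'}=1$ if $\{v,v'\}$ is an edge and $W_{vv'}=0$ otherwise. $M_3(\Gamma)$ is the closed oriented $3$-manifold obtained from $S^3$ by surgery along the framed link with one unknotted component of framing $w_v$ for each vertex $v$, two components being linked (as a Hopf link) exactly when the corresponding vertices are adjacent. $\tau_k$ denotes the $\mathrm{SU}(2)$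 Witten--Reshetikhin--Turaev invariant normalised by $\tau_k(S^3)=1$. For $M_3(\Gamma)$ it is given explicitly by $$\tau_k(M_3(\Gamma))=\frac{-\mathrm i\,\zeta_k^{-9/2}}{16k^3(\zeta_{2k}-\zeta_{2k}^{-1})}\sum_{l\in(\mathbb Z\smallsetminus k\mathbb Z)^6/2k\mathbb Z^6}\ \prod_{v=1}^6\zeta_k^{w_v(l_v^2-1)/4}\left(\frac1{\zeta_k^{l_v/2}-\zeta_k^{-l_v/2}}\right)^{\deg(v)-2}\prod_{\{v,v'\}\ \mathrm{edge}}\frac{\zeta_k^{l_vl_{v'}/2}-\zeta_k^{-l_vl_{v'}/2}}2 ,$$ where $\deg(v)$ is the degree of $v$ in $\Gamma$ ($\deg(1)=\deg(2)=3$, the others have degree $1$). The homological block is, for $|q|<1$, $$\widehat Z_\Gamma(q):=q^{(-18-w_1-\cdots-w_6)/4}\ \mathrm{v.p.}\!\int_{|z_v|=1,\,1\le v\le 6}\frac{\prod_{v=3}^6(z_v-z_v^{-1})}{(z_1-z_1^{-1})(z_2-z_2^{-1})}\,\Theta(q;z_1,\dots,z_6)\prod_{v=1}^6\frac{\mathrm dz_v}{2\pi \mathrm i z_v},$$ $$\Theta(q;z_1,\dots,z_6):=\sum_{\boldsymbol l\in 2\mathbb Z^6+\delta}q^{-\boldsymbol l^{\top}W^{-1}\boldsymbol l/4}\prod_{v=1}^6z_v^{l_v},\qquad \delta:=(1,1,1,1,1,1)^\top .$$ Here $\mathrm{v.p.}$ is the Cauchy principal value: in each of the variables $z_1,z_2$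 (where the integrand has poles on $|z|=1$) it is the average of the integrals over $|z|=1+\epsilon$ and $|z|=1-\epsilon$ for small $\epsilon>0$. *)

theory Defs
  imports "HOL-Complex_Analysis.Complex_Analysis"
begin

text \<open>Only the vector reading of \<open>$\<close> is used here.\<close>

unbundle no fps_syntax

definition ee :: "complex \<Rightarrow> complex"
  where "ee z = exp (2 * of_real pi * \<i> * z)"

text \<open>\<open>zeta k r\<close> is the power \<open>e(r/k)\<close> of \<open>e(1/k)\<close>; the exponent \<open>r\<close> need not be an integer.\<close>

definition zeta :: "nat \<Rightarrow> real \<Rightarrow> complex"
  where "zeta k r = ee (of_real (r / real k))"


section \<open>The H-graph\<close>

text \<open>The vertices 1, ..., 6 are the elements of the numeral type \<open>6\<close>, whose arithmetic is
  modulo 6. The numerals 1, ..., 6 denote its six distinct elements, but \<open>6 = 0\<close> there, so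
  intervals such as \<open>{3..6}\<close> must be avoided in favour of explicit enumerations.\<close>

definition H_edges :: "6 set set"
  where "H_edges = {{1, 2}, {1, 3}, {1, 4}, {2, 5}, {2, 6}}"

definition H_degree :: "6 \<Rightarrow> nat"
  where "H_degree v = card {e \<in> H_edges. v \<in> e}"

definition linking_matrix :: "int ^ 6 \<Rightarrow> real ^ 6 ^ 6"
  where "linking_matrix w =
    (\<chi> v v'. if v = v' then of_int (w $ v) else if {v, v'} \<in> H_edges then 1 else 0)"

definition negative_definite :: "real ^ 'n ^ 'n \<Rightarrow> bool"
  where "negative_definite A \<longleftrightarrow> (\<forall>x. x \<noteq> 0 \<longrightarrow> x \<bullet> (A *v x) < 0)"


section \<open>The Witten--Reshetikhin--Turaev invariant\<close>

definition wrt_summand :: "nat \<Rightarrow> int ^ 6 \<Rightarrow> int ^ 6 \<Rightarrow> complex"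
  where "wrt_summand k w l =
    (\<Prod>v\<in>UNIV. zeta k (of_int (w $ v * ((l $ v)\<^sup>2 - 1)) / 4)
       * (1 / (zeta k (of_int (l $ v) / 2) - zeta k (- of_int (l $ v) / 2)))
           powi (int (H_degree v) - 2))
    * (\<Prod>e\<in>H_edges. (zeta k (of_int (\<Prod>v\<in>e. l $ v) / 2)
                   - zeta k (- of_int (\<Prod>v\<in>e. l $ v) / 2)) / 2)"

text \<open>The summand depends only on the classes of the \<open>l $ v\<close> modulo \<open>2k\<close>
  (\<open>wrt_summand_periodic\<close> below). The sum over these classes, with multiples of \<open>k\<close> excluded,
  is therefore taken over the representatives \<open>0 \<le> l $ v < 2k\<close>. The result is
  \<open>\<tau>\<^sub>k(M\<^sub>3(\<Gamma>))\<close>, normalised so that the 3-sphere has invariant 1, in its explicit form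
  obtained from the surgery presentation given by the graph.\<close>

definition wrt_invariant :: "nat \<Rightarrow> int ^ 6 \<Rightarrow> complex"
  where "wrt_invariant k w =
    - \<i> * zeta k (- 9 / 2) / (16 * of_nat k ^ 3 * (zeta (2 * k) 1 - zeta (2 * k) (- 1)))
    * (\<Sum>l | \<forall>v. l $ v \<in> {0..<2 * int k} \<and> \<not> int k dvd l $ v. wrt_summand k w l)"

lemma zeta_add_of_int_mult:
  assumes "k > 0"
  shows "zeta k (r + real k * of_int n) = zeta k r"
proof -
  have "zeta k (r + real k * of_int n)
      = exp (2 * of_real pi * \<i> * of_real (r / real k) + 2 * of_int n * of_real pi * \<i>)"
    using assms unfolding zeta_def ee_def by (intro arg_cong[of _ _ exp]) (simp add: field_simps)
  then show ?thesis
    unfolding zeta_def ee_def by (simp add: exp_add exp_eq_1 exp_integer_2pi)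
qed

lemma wrt_summand_periodic:
  fixes l l' m :: "int ^ 6"
  assumes k: "k > 0" and l': "\<And>v. l' $ v = l $ v + 2 * int k * m $ v"
  shows "wrt_summand k w l' = wrt_summand k w l"
proof -
  have zeta_eq: "zeta k a = zeta k b" if "a = b + real k * of_int n" for a b n
    using zeta_add_of_int_mult[OF k] that by simp
  have weight: "zeta k (of_int (w $ v * ((l' $ v)\<^sup>2 - 1)) / 4)
              = zeta k (of_int (w $ v * ((l $ v)\<^sup>2 - 1)) / 4)" for v
    by (rule zeta_eq[where n = "w $ v * (l $ v * m $ v + int k * (m $ v)\<^sup>2)"])
       (simp add: l' field_simps power2_eq_square)
  have vertex: "zeta k (of_int (l' $ v) / 2) = zeta k (of_int (l $ v) / 2)"
    "zeta k (- of_int (l' $ v) / 2) = zeta k (- of_int (l $ v) / 2)" for v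
    by (rule zeta_eq[where n = "m $ v"], simp add: l' field_simps)
       (rule zeta_eq[where n = "- m $ v"], simp add: l' field_simps)
  have edge: "zeta k (of_int (\<Prod>v\<in>e. l' $ v) / 2) = zeta k (of_int (\<Prod>v\<in>e. l $ v) / 2)"
    "zeta k (- of_int (\<Prod>v\<in>e. l' $ v) / 2) = zeta k (- of_int (\<Prod>v\<in>e. l $ v) / 2)"
    for e :: "6 set"
  proof -
    have "(\<Prod>v\<in>e. l' $ v) mod (2 * int k) = (\<Prod>v\<in>e. l' $ v mod (2 * int k)) mod (2 * int k)"
      by (simp only: mod_prod_eq)
    also have "\<dots> = (\<Prod>v\<in>e. l $ v mod (2 * int k)) mod (2 * int k)"
      by (simp add: l')
    also have "\<dots> = (\<Prod>v\<in>e. l $ v) mod (2 * int k)"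
      by (simp only: mod_prod_eq)
    finally have "2 * int k dvd (\<Prod>v\<in>e. l' $ v) - (\<Prod>v\<in>e. l $ v)"
      by (simp only: mod_eq_dvd_iff)
    then obtain n where "(\<Prod>v\<in>e. l' $ v) - (\<Prod>v\<in>e. l $ v) = 2 * int k * n" ..
    then have n: "(\<Prod>v\<in>e. l' $ v) = (\<Prod>v\<in>e. l $ v) + 2 * int k * n"
      by simp
    show "zeta k (of_int (\<Prod>v\<in>e. l' $ v) / 2) = zeta k (of_int (\<Prod>v\<in>e. l $ v) / 2)"
      unfolding n by (rule zeta_eq[where n = n]) (simp add: field_simps)
    show "zeta k (- of_int (\<Prod>v\<in>e. l' $ v) / 2) = zeta k (- of_int (\<Prod>v\<in>e. l $ v) / 2)"
      unfolding n by (rule zeta_eq[where n = "- n"]) (simp add: field_simps)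
  qed
  show ?thesis
    unfolding wrt_summand_def weight vertex edge ..
qed


section \<open>The homological block\<close>

text \<open>Because of the fractional powers \<open>q\<^sup>r = e(r\<tau>)\<close>, theta function and homological block are
  written as functions of \<open>\<tau>\<close> in the upper half plane, where \<open>q = e(\<tau>)\<close>.\<close>

definition theta :: "int ^ 6 \<Rightarrow> complex \<Rightarrow> complex ^ 6 \<Rightarrow> complex"
  where "theta w \<tau> z =
    (\<Sum>\<^sub>\<infinity>l\<in>{l :: int ^ 6. \<forall>v. odd (l $ v)}.
       (let x = (\<chi> v. of_int (l $ v)) :: real ^ 6 in
          ee (- of_real (x \<bullet> (matrix_inv (linking_matrix w) *v x)) / 4 * \<tau>))
       * (\<Prod>v\<in>UNIV. (z $ v) powi (l $ v)))"

definition block_integrand :: "int ^ 6 \<Rightarrow> complex \<Rightarrow> complex ^ 6 \<Rightarrow> complex"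
  where "block_integrand w \<tau> z =
    (\<Prod>v\<in>{3, 4, 5, 6}. z $ v - 1 / z $ v) / ((z $ 1 - 1 / z $ 1) * (z $ 2 - 1 / z $ 2))
    * theta w \<tau> z"

definition circle_integral :: "real \<Rightarrow> (complex \<Rightarrow> complex) \<Rightarrow> complex"
  where "circle_integral r f =
    contour_integral (circlepath 0 r) (\<lambda>z. f z / (2 * of_real pi * \<i> * z))"

text \<open>For \<open>f\<close> holomorphic near the unit circle except for poles on the circle itself, the average
  does not depend on \<open>\<epsilon>\<close> once \<open>\<epsilon> > 0\<close> is small, and the limit is that common value.\<close>

definition pv_circle_integral :: "(complex \<Rightarrow> complex) \<Rightarrow> complex"
  where "pv_circle_integral f =
    Lim (at_right 0) (\<lambda>\<epsilon>. (circle_integral (1 + \<epsilon>) f + circle_integral (1 - \<epsilon>) f) / 2)"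

definition homological_block :: "int ^ 6 \<Rightarrow> complex \<Rightarrow> complex"
  where "homological_block w \<tau> =
    ee (of_int (- 18 - (\<Sum>v\<in>UNIV. w $ v)) / 4 * \<tau>) *
    pv_circle_integral (\<lambda>z1. pv_circle_integral (\<lambda>z2.
      circle_integral 1 (\<lambda>z3. circle_integral 1 (\<lambda>z4.
      circle_integral 1 (\<lambda>z5. circle_integral 1 (\<lambda>z6.
        block_integrand w \<tau> (vector [z1, z2, z3, z4, z5, z6])))))))"

end

(*
  Idea. Complete the square modulo c = 2k: since W is unimodular, e(- l^T W^-1 l / 4k) is the
  quotient of the shifted Gauss sum of W over (Z/cZ)^6 by the unshifted one. The latter equals
  i c^3: going up the tree, each vertex is eliminated by one-dimensional Gauss sum reciprocity, and
  the auxiliary sums over coprime moduli are multiplied by the Chinese remainder theorem.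

  The principal value integrals turn the block into a false theta series over pairs of odd integers,
  with summand sgn l1 * sgn l2 * (periodic) * exp(- t * (quadratic form)). Written as characters
  z1^l1 * z2^l2 times Gaussians, and the Gaussians as averages of exponentials along a contour
  shifted into the region of convergence, the series over each quadrant becomes geometric. As
  t -> 0, dominated convergence replaces it by the value of 1 / (z1 - 1/z1) / (z2 - 1/z2) times the
  leaf factors; where z^2 = 1 the leaf factors have a double zero, so these terms vanish, in
  accordance with the exclusion of multiples of k in the WRT sum. On the WRT side the four leaf
  sums are evaluated first, and the remaining double sum is the limit just found.
*)

theory Submission
  imports Defs "HOL-Probability.Characteristic_Functions"
begin

section \<open>Gauss sums\<close>

text \<open>At q = zeta_k the exponent \<open>l^T W^-1 l\<close> couples all six coordinates.
  Written as a quotient of Gauss sums, the same root of unity is an average of characters: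
  \<open>l\<close> enters only linearly. For fixed \<open>x1\<close>, \<open>x2\<close> each leaf
  then contributes a one-dimensional Gauss sum, and \<open>l1\<close>, \<open>l2\<close> occur only
  in z1^l1 and z2^l2 with 2k-th roots of unity z1, z2. The leaf sums of the WRT invariant are
  differences of these same Gauss sums, so the two sides agree term by term in
  \<open>(x1, x2)\<close> and neither double sum needs a value.

  As t -> 0 the false theta series has no majorant independent of t, so the limit cannot be taken
  termwise. Each quadrant sum is therefore rewritten as an integral over a measure that does not
  depend on t.

  Constants: the two principal values give 1/4, and the four quadrants have equal limits, which
  restores the 4. With c = 2k, 1/(2 i c^3) = -i/(16 k^3) is the prefactor of the invariant. In the
  exponent (-18 - w_1 - ... - w_6)/4 of q, the -18 gives zeta_k^(-9/2), and the weights cancel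
  against the -1 in l_v^2 - 1.\<close>

definition e1 :: "real \<Rightarrow> complex" where "e1 x = cis (2 * pi * x)"

lemma zeta_e1: "zeta k r = e1 (r / real k)"
  unfolding zeta_def ee_def e1_def cis_conv_exp by (simp add: mult_ac)

lemma ee_of_real: "ee (of_real r) = e1 r"
  unfolding ee_def e1_def cis_conv_exp by (simp add: mult_ac)

lemma e1_add: "e1 (x + y) = e1 x * e1 y"
  by (simp add: e1_def cis_mult ring_distribs)

lemma e1_0 [simp]: "e1 0 = 1"
  by (simp add: e1_def)

lemma norm_e1 [simp]: "norm (e1 x) = 1"
  by (simp add: e1_def)

lemma e1_of_int [simp]: "e1 (of_int n) = 1"
  using cis_multiple_2pi[of "of_int n"] by (simp add: e1_def)

lemma e1_nonzero [simp]: "e1 x \<noteq> 0"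
  by (metis norm_e1 norm_zero zero_neq_one)

lemma e1_minus: "e1 (- x) = inverse (e1 x)"
  using e1_add[of x "-x"] by (simp add: field_simps)

lemma cnj_e1: "cnj (e1 x) = e1 (- x)"
  by (simp add: e1_def cis_cnj)

lemma e1_eqI: "e1 x = e1 y" if "x = y + of_int n"
  using that by (simp add: e1_add)

lemma e1_powi: "e1 x powi n = e1 (of_int n * x)"
  unfolding e1_def cis_power_int by (simp add: mult_ac)

lemma e1_eq_1_iff: "e1 x = 1 \<longleftrightarrow> x \<in> \<int>"
proof
  assume "e1 x = 1"
  then obtain n where "2 * pi * x = of_int n * 2 * pi"
    unfolding e1_def cis_conv_exp exp_eq_1 by auto
  then show "x \<in> \<int>" by simp
qed (auto elim!: Ints_cases)

section \<open>Sums over residue classes\<close>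

lemma sum_int_split:
  fixes F :: "int \<Rightarrow> 'a::comm_monoid_add"
  assumes "c > 0" "n \<ge> 0"
  shows "(\<Sum>x=0..<c. \<Sum>y=0..<n. F (x + c * y)) = (\<Sum>z=0..<c * n. F z)"
proof -
  have bij: "bij_betw (\<lambda>(x, y). x + c * y) ({0..<c} \<times> {0..<n}) {0..<c * n}"
  proof (rule bij_betwI[where g = "\<lambda>z. (z mod c, z div c)"])
    show "(\<lambda>(x, y). x + c * y) \<in> {0..<c} \<times> {0..<n} \<rightarrow> {0..<c * n}"
    proof (rule Pi_I)
      fix z assume "z \<in> {0..<c} \<times> {0..<n}"
      then obtain a b where *: "z = (a, b)" "0 \<le> a" "a < c" "0 \<le> b" "b < n" by auto
      have "c * b \<le> c * (n - 1)" using * assms by (intro mult_left_mono) auto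
      then show "(case z of (x, y) \<Rightarrow> x + c * y) \<in> {0..<c * n}"
        using * assms by (auto simp: algebra_simps)
    qed
    show "(\<lambda>z. (z mod c, z div c)) \<in> {0..<c * n} \<rightarrow> {0..<c} \<times> {0..<n}"
    proof (rule Pi_I)
      fix x assume "x \<in> {0..<c * n}"
      then have x: "0 \<le> x" "x < c * n" by auto
      have "c * (x div c) < c * n"
        using x mult_div_mod_eq[of c x] pos_mod_sign[OF assms(1), of x] by linarith
      then have "x div c < n" "0 \<le> x div c"
        using assms(1) x by (simp_all only: mult_less_cancel_left_pos pos_imp_zdiv_nonneg_iff)
      then show "(x mod c, x div c) \<in> {0..<c} \<times> {0..<n}"
        using assms by simp
    qed
  next
    fix z assume "z \<in> {0..<c} \<times> {0..<n}"
    then obtain a b where "z = (a, b)" "0 \<le> a" "a < c" by auto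
    then show "((case z of (x, y) \<Rightarrow> x + c * y) mod c, (case z of (x, y) \<Rightarrow> x + c * y) div c) = z"
      by (simp add: div_add1_eq)
  next
    fix z
    show "(case (z mod c, z div c) of (x, y) \<Rightarrow> x + c * y) = z" by simp
  qed
  show ?thesis
    unfolding sum.cartesian_product
    using sum.reindex_bij_betw[OF bij, of F] by (simp add: case_prod_unfold)
qed

lemma periodic_mod:
  fixes f :: "int \<Rightarrow> 'a"
  assumes "\<And>x. f (x + n) = f x"
  shows "f (x + n * m) = f x" "f (x mod n) = f x"
proof -
  have nat: "f (x + n * int j) = f x" for x j
  proof (induction j)
    case (Suc j)
    then show ?case using assms[of "x + n * int j"] by (simp add: algebra_simps)
  qed auto
  show *: "f (x + n * m) = f x" for x m
  proof (cases "m \<ge> 0")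
    case True
    then show ?thesis using nat[of x "nat m"] by simp
  next
    case False
    then show ?thesis using nat[of "x + n * m" "nat (- m)"] by simp
  qed
  show "f (x mod n) = f x"
    using *[of "x mod n" "x div n"] by simp
qed

lemma sum_int_shift:
  fixes f :: "int \<Rightarrow> 'a::comm_monoid_add"
  assumes "\<And>x. f (x + n) = f x" "n > 0"
  shows "(\<Sum>x=0..<n. f (x + a)) = (\<Sum>x=0..<n. f x)"
proof -
  have bij: "bij_betw (\<lambda>x. (x + a) mod n) {0..<n} {0..<n}"
    by (rule bij_betwI[where g = "\<lambda>x. (x - a) mod n"]) (use assms(2) in \<open>auto simp: mod_simps\<close>)
  have "(\<Sum>x=0..<n. f (x + a)) = (\<Sum>x=0..<n. f ((x + a) mod n))"
    using periodic_mod(2)[of f n, OF assms(1)] by simp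
  also have "\<dots> = (\<Sum>x=0..<n. f x)"
    by (rule sum.reindex_bij_betw[OF bij])
  finally show ?thesis .
qed

lemma sum_int_neg:
  fixes f :: "int \<Rightarrow> 'a::comm_monoid_add"
  assumes "\<And>x. f (x + n) = f x" "n > 0"
  shows "(\<Sum>x=0..<n. f (- x)) = (\<Sum>x=0..<n. f x)"
proof -
  have bij: "bij_betw (\<lambda>x. (- x) mod n) {0..<n} {0..<n}"
    by (rule bij_betwI[where g = "\<lambda>x. (- x) mod n"]) (use assms(2) in \<open>auto simp: mod_simps\<close>)
  have "(\<Sum>x=0..<n. f (- x)) = (\<Sum>x=0..<n. f ((- x) mod n))"
    using periodic_mod(2)[of f n, OF assms(1)] by simp
  also have "\<dots> = (\<Sum>x=0..<n. f x)"
    by (rule sum.reindex_bij_betw[OF bij])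
  finally show ?thesis .
qed

text \<open>The bijection of the Chinese remainder theorem is obtained from injectivity and a
  comparison of cardinalities; its inverse is not constructed.\<close>

lemma sum_int_crt:
  fixes f g :: "int \<Rightarrow> complex"
  assumes "\<And>x. f (x + a) = f x" "\<And>x. g (x + b) = g x" "a > 0" "b > 0" "coprime a b"
  shows "(\<Sum>y=0..<a. f y) * (\<Sum>z=0..<b. g z) = (\<Sum>y=0..<a * b. f y * g y)"
proof -
  have inj: "inj_on (\<lambda>y. (y mod a, y mod b)) {0..<a * b}"
  proof (rule inj_onI, clarsimp)
    fix x y assume *: "0 \<le> x" "x < a * b" "0 \<le> y" "y < a * b"
      "x mod a = y mod a" "x mod b = y mod b"
    then have "a dvd x - y" "b dvd x - y" by (simp_all add: mod_eq_dvd_iff)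
    then have "a * b dvd x - y" using assms(5) by (simp add: divides_mult)
    then have "x mod (a * b) = y mod (a * b)" by (simp add: mod_eq_dvd_iff)
    then show "x = y" using * by simp
  qed
  have sub: "(\<lambda>y. (y mod a, y mod b)) ` {0..<a * b} \<subseteq> {0..<a} \<times> {0..<b}"
    using assms(3,4) by auto
  have "card ((\<lambda>y. (y mod a, y mod b)) ` {0..<a * b}) = card ({0..<a} \<times> {0..<b})"
    using card_image[OF inj] assms(3,4) by (simp add: nat_mult_distrib)
  then have "(\<lambda>y. (y mod a, y mod b)) ` {0..<a * b} = {0..<a} \<times> {0..<b}"
    by (intro card_subset_eq sub) auto
  then have bij: "bij_betw (\<lambda>y. (y mod a, y mod b)) {0..<a * b} ({0..<a} \<times> {0..<b})"
    using inj by (simp add: bij_betw_def)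
  have "(\<Sum>y=0..<a. f y) * (\<Sum>z=0..<b. g z) = (\<Sum>p\<in>{0..<a} \<times> {0..<b}. f (fst p) * g (snd p))"
    by (simp add: sum_product sum.cartesian_product case_prod_unfold)
  also have "\<dots> = (\<Sum>y=0..<a * b. f (y mod a) * g (y mod b))"
    using sum.reindex_bij_betw[OF bij, of "\<lambda>p. f (fst p) * g (snd p)"] by simp
  also have "\<dots> = (\<Sum>y=0..<a * b. f y * g y)"
    using periodic_mod(2)[of f a, OF assms(1)] periodic_mod(2)[of g b, OF assms(2)] by simp
  finally show ?thesis .
qed

text \<open>If \<open>c\<close> does not divide \<open>d\<close>, the shift x -> x + 1 multiplies
  the sum by e(d/c), which differs from 1, so the sum vanishes.\<close>

lemma sum_e1_orthogonal:
  fixes c d :: int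
  assumes "c > 0"
  shows "(\<Sum>x=0..<c. e1 (of_int (d * x) / of_int c)) = (if c dvd d then of_int c else 0)"
proof (cases "c dvd d")
  case True
  then obtain m where d: "d = c * m" by auto
  have "e1 (of_int (d * x) / of_int c) = 1" for x
    using e1_of_int[of "m * x"] assms by (simp add: d)
  then show ?thesis using True assms by simp
next
  case False
  define S where "S = (\<Sum>x=0..<c. e1 (of_int (d * x) / of_int c))"
  have "(\<Sum>x=0..<c. e1 (of_int (d * (x + 1)) / of_int c)) = S"
    unfolding S_def
  proof (rule sum_int_shift[where f = "\<lambda>x. e1 (of_int (d * x) / of_int c)"])
    show "e1 (of_int (d * (x + c)) / of_int c) = e1 (of_int (d * x) / of_int c)" for x
      by (rule e1_eqI[where n = d]) (use assms in \<open>simp add: field_simps\<close>)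
  qed (use assms in auto)
  moreover have "(\<Sum>x=0..<c. e1 (of_int (d * (x + 1)) / of_int c)) = e1 (of_int d / of_int c) * S"
    by (simp add: S_def sum_distrib_left e1_add[symmetric] algebra_simps add_divide_distrib)
  ultimately have "(e1 (of_int d / of_int c) - 1) * S = 0" by (simp add: algebra_simps)
  moreover have "e1 (of_int d / of_int c) \<noteq> 1"
  proof
    assume "e1 (of_int d / of_int c) = 1"
    then obtain n where "of_int d / of_int c = (of_int n :: real)"
      by (auto simp: e1_eq_1_iff elim!: Ints_cases)
    then have "real_of_int d = of_int (c * n)" using assms by (simp add: field_simps)
    then show False using False by (simp only: of_int_eq_iff) auto
  qed
  ultimately show ?thesis using False by (simp add: S_def)
qed

text \<open>With \<open>2 * n\<close> in the denominator the summand has period \<open>n\<close>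
  exactly when \<open>n\<close> is even; this is the source of the parity assumptions below.\<close>

definition gsum :: "int \<Rightarrow> complex"
  where "gsum n = (\<Sum>x=0..<n. e1 (of_int (x\<^sup>2) / (2 * of_int n)))"

lemma gauss_periodic:
  fixes n u :: int
  assumes "n > 0" "even n"
  shows "e1 (of_int ((x + n)\<^sup>2) / (2 * of_int n)) = e1 (of_int (x\<^sup>2) / (2 * of_int n))"
proof -
  obtain m where m: "n = 2 * m" using assms by auto
  show ?thesis
    by (rule e1_eqI[where n = "x + m"]) (use assms in \<open>simp add: m field_simps power2_eq_square\<close>)
qed

text \<open>Multiplying by \<open>gsum (c * a)\<close>, whose summation variable may be shifted by \<open>- a * x\<close>, removes the
  quadratic term in \<open>x\<close>.\<close>

lemma gauss_dual:
  fixes a c u :: int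
  assumes "a > 0" "c > 0" "even (c * a)"
  shows "gsum (c * a) * (\<Sum>x=0..<c. e1 (- of_int (a * x\<^sup>2) / (2 * of_int c) + of_int (u * x) / of_int c))
       = of_int c * (\<Sum>y=0..<a. e1 (of_int ((u + c * y)\<^sup>2) / (2 * of_int (c * a))))"
proof -
  define n where "n = c * a"
  have n: "n > 0" "even n" using assms by (auto simp: n_def)
  define E where "E = (\<lambda>x::int. e1 (of_int (x\<^sup>2) / (2 * of_int n)))"
  have E_per: "E (x + n) = E x" for x
    unfolding E_def by (rule gauss_periodic[OF n])
  have g: "gsum n = (\<Sum>U=0..<n. E (U + b))" for b
    unfolding gsum_def sum_int_shift[of E n, OF E_per n(1)] by (simp add: E_def)
  have comb: "e1 (- of_int (a * x\<^sup>2) / (2 * of_int c) + of_int (u * x) / of_int c) * E (U + (- a * x))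
     = E U * e1 (of_int ((u - U) * x) / of_int c)" for x U
  proof -
    have "- of_int (a * x\<^sup>2) / (2 * of_int c) + of_int (u * x) / of_int c + of_int ((U + (- a * x))\<^sup>2) / (2 * of_int n)
      = of_int (U\<^sup>2) / (2 * of_int n) + (of_int ((u - U) * x) / of_int c :: real)"
      using assms by (simp add: n_def divide_simps) (simp add: power2_eq_square algebra_simps)
    then show ?thesis unfolding E_def by (metis e1_add)
  qed
  have "gsum n * (\<Sum>x=0..<c. e1 (- of_int (a * x\<^sup>2) / (2 * of_int c) + of_int (u * x) / of_int c))
      = (\<Sum>x=0..<c. \<Sum>U=0..<n. E U * e1 (of_int ((u - U) * x) / of_int c))"
    unfolding sum_distrib_left
  proof (rule sum.cong)
    fix x
    show "gsum n * e1 (- of_int (a * x\<^sup>2) / (2 * of_int c) + of_int (u * x) / of_int c)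
      = (\<Sum>U=0..<n. E U * e1 (of_int ((u - U) * x) / of_int c))"
      unfolding g[of "- a * x"] sum_distrib_right
      by (rule sum.cong) (use comb[of x] in \<open>simp_all add: mult.commute\<close>)
  qed simp
  also have "\<dots> = (\<Sum>U=0..<n. E U * (if c dvd u - U then of_int c else 0))"
    by (subst sum.swap) (simp only: sum_distrib_left[symmetric] sum_e1_orthogonal[OF assms(2)])
  \<comment> \<open>Centring the sum at \<open>u\<close> makes the divisibility condition single out
    \<open>x = 0\<close> in the decomposition \<open>U = x + c * y\<close>.\<close>
  also have "\<dots> = (\<Sum>U=0..<n. E (U + u) * (if c dvd u - (U + u) then of_int c else 0))"
  proof (rule sum_int_shift[symmetric])
    fix x
    have "c dvd u - (x + n) \<longleftrightarrow> c dvd u - x"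
      unfolding n_def diff_diff_eq[symmetric] by (simp add: dvd_diff_left_iff)
    then show "E (x + n) * (if c dvd u - (x + n) then of_int c else 0) = E x * (if c dvd u - x then of_int c else 0)"
      by (simp add: E_per)
  qed (rule n)
  also have "\<dots> = (\<Sum>x=0..<c. \<Sum>y=0..<a. E (x + c * y + u) * (if c dvd u - (x + c * y + u) then of_int c else 0))"
    unfolding n_def by (rule sum_int_split[symmetric]) (use assms in auto)
  also have "\<dots> = (\<Sum>x=0..<c. if x = 0 then \<Sum>y=0..<a. E (u + c * y) * of_int c else 0)"
  proof (intro sum.cong refl)
    fix x assume x: "x \<in> {0..<c}"
    have "c dvd u - (x + c * y + u) \<longleftrightarrow> x = 0" for y
    proof -
      have "u - (x + c * y + u) = - (x + c * y)" by simp
      then have "c dvd u - (x + c * y + u) \<longleftrightarrow> c dvd x"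
        by (simp only: dvd_minus_iff dvd_add_left_iff[OF dvd_triv_left])
      also have "\<dots> \<longleftrightarrow> x = 0" using x zdvd_imp_le[of c x] by (cases "x = 0") auto
      finally show ?thesis .
    qed
    then show "(\<Sum>y=0..<a. E (x + c * y + u) * (if c dvd u - (x + c * y + u) then of_int c else 0))
      = (if x = 0 then \<Sum>y=0..<a. E (u + c * y) * of_int c else 0)"
      by (simp add: add.commute)
  qed
  also have "\<dots> = of_int c * (\<Sum>y=0..<a. E (u + c * y))"
    using assms(2) by (simp add: sum_distrib_left mult.commute)
  finally show ?thesis by (simp add: n_def E_def)
qed

text \<open>Reciprocity with \<open>a = c * n\<close> and \<open>u = 0\<close>: as \<open>n\<close>
  is even, every summand on the left is 1, while the right-hand side runs through \<open>c\<close>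
  full periods of the summand of \<open>gsum n\<close>.\<close>

lemma gsum_square:
  fixes c n :: int
  assumes "c > 0" "n > 0" "even n"
  shows "gsum (c\<^sup>2 * n) = of_int c * gsum n"
proof -
  have "gsum (c * (c * n)) * (\<Sum>x=0..<c. e1 (- of_int ((c * n) * x\<^sup>2) / (2 * of_int c) + of_int (0 * x) / of_int c))
       = of_int c * (\<Sum>y=0..<c * n. e1 (of_int ((0 + c * y)\<^sup>2) / (2 * of_int (c * (c * n)))))"
    by (rule gauss_dual) (use assms in auto)
  moreover have "e1 (- of_int ((c * n) * x\<^sup>2) / (2 * of_int c) + of_int (0 * x) / of_int c) = 1" for x
  proof -
    obtain m where m: "n = 2 * m" using assms by auto
    have "- of_int ((c * n) * x\<^sup>2) / (2 * of_int c) + of_int (0 * x) / of_int c = (of_int (- m * x\<^sup>2) :: real)"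
      using assms by (simp add: m)
    then show ?thesis by (metis e1_of_int)
  qed
  moreover have "(\<Sum>y=0..<c * n. e1 (of_int ((0 + c * y)\<^sup>2) / (2 * of_int (c * (c * n))))) = of_int c * gsum n"
  proof -
    have "(\<Sum>y=0..<c * n. e1 (of_int ((0 + c * y)\<^sup>2) / (2 * of_int (c * (c * n)))))
        = (\<Sum>y=0..<n * c. e1 (of_int (y\<^sup>2) / (2 * of_int n)))"
      using assms by (intro sum.cong) (auto simp: power2_eq_square mult.commute)
    also have "\<dots> = (\<Sum>x=0..<n. \<Sum>y=0..<c. e1 (of_int ((x + n * y)\<^sup>2) / (2 * of_int n)))"
      by (rule sum_int_split[symmetric]) (use assms in auto)
    also have "\<dots> = (\<Sum>x=0..<n. \<Sum>y=0..<c. e1 (of_int (x\<^sup>2) / (2 * of_int n)))"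
      using periodic_mod(1)[of "\<lambda>x. e1 (of_int (x\<^sup>2) / (2 * of_int n))" n, OF gauss_periodic[OF assms(2,3)]]
      by simp
    also have "\<dots> = of_int c * gsum n" using assms by (simp add: gsum_def sum_distrib_left)
    finally show ?thesis .
  qed
  ultimately show ?thesis using assms by (simp add: power2_eq_square mult.assoc)
qed

section \<open>The value of the quadratic Gauss sum\<close>

text \<open>By \<open>gsum_square\<close>, the quotient \<open>gsum n / sqrt n\<close> is unchanged under \<open>n \<mapsto> c\<^sup>2 * n\<close>. Letting \<open>c\<close> tend to
  infinity therefore identifies it with a Fresnel integral that does not depend on \<open>n\<close>, and its
  value is read off at \<open>n = 2\<close>. The Kusmin--Landau bound controls the tail of the Gauss sum.\<close>

lemma kusmin_landau_aux:
  fixes a :: "nat \<Rightarrow> complex" and c :: "nat \<Rightarrow> real"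
  assumes "\<And>x. norm (a x) = 1" "K \<le> L"
    and "\<And>x. K \<le> x \<Longrightarrow> x < L \<Longrightarrow> c (Suc x) \<le> c x" "c L \<ge> 0"
  shows "norm (\<Sum>x\<in>{K..<L}. (a (Suc x) - a x) * of_real (c x)) \<le> 2 * c K"
proof -
  have id: "(\<Sum>x\<in>{K..<L}. (a (Suc x) - a x) * of_real (c x)) = a L * of_real (c L) - a K * of_real (c K)
    + (\<Sum>x\<in>{K..<L}. a (Suc x) * of_real (c x - c (Suc x)))"
    using assms(2) by (induction L rule: dec_induct) (simp_all add: algebra_simps)
  have mono: "c L \<le> c K"
    using assms(2,3) by (induction L rule: dec_induct) (auto intro: order_trans)
  have "norm (\<Sum>x\<in>{K..<L}. a (Suc x) * of_real (c x - c (Suc x))) \<le> (\<Sum>x\<in>{K..<L}. c x - c (Suc x))"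
  proof (rule sum_norm_le)
    fix x assume "x \<in> {K..<L}"
    then have "c (Suc x) \<le> c x" using assms(3) by auto
    then show "norm (a (Suc x) * of_real (c x - c (Suc x))) \<le> c x - c (Suc x)"
      unfolding norm_mult assms(1) norm_of_real by simp
  qed
  also have "\<dots> = c K - c L"
    using assms(2) by (induction L rule: dec_induct) simp_all
  finally have "norm (\<Sum>x\<in>{K..<L}. (a (Suc x) - a x) * of_real (c x)) \<le> c L + c K + (c K - c L)"
    unfolding id using assms(4) mono
    by (intro norm_triangle_le norm_triangle_le_diff add_mono) (simp_all add: norm_mult assms(1))
  then show ?thesis by simp
qed

text \<open>The reciprocal of e(x) - 1 has constant real part -1/2, so in the summation by parts
  only the monotone cotangent needs an estimate.\<close>

lemma inverse_e1_minus_1: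
  assumes "0 < x" "x < 1 / 2"
  shows "(e1 x - 1) * (- 1 / 2 - \<i> / 2 * of_real (cot (pi * x))) = 1"
proof -
  have s: "sin (pi * x) > 0" using assms by (intro sin_gt_zero) auto
  define y where "y = pi * x"
  have "(cis (2 * y) - 1) * (- 1 / 2 - \<i> / 2 * of_real (cot y)) = 1"
  proof -
    have 1: "cos y * cos y + sin y * sin y = 1"
      using sin_cos_squared_add3[of y] by simp
    have "cos y * (cos y * (sin y * 2)) + sin y * (sin y * (sin y * 2)) = (cos y * cos y + sin y * sin y) * (sin y * 2)"
      by (simp only: distrib_right mult.assoc)
    then have 2: "cos y * (cos y * (sin y * 2)) + sin y * (sin y * (sin y * 2)) = sin y * 2"
      unfolding 1 by (simp only: mult_1)
    show ?thesis
      using s[folded y_def]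
      by (simp add: complex_eq_iff cot_def sin_double cos_double_sin divide_simps)
         (simp add: power2_eq_square algebra_simps, rule 2)
  qed
  then show ?thesis by (simp add: y_def e1_def mult_ac)
qed

lemma cot_mono: "0 < x \<Longrightarrow> x \<le> y \<Longrightarrow> y < pi / 2 \<Longrightarrow> cot y \<le> cot (x::real)"
  by (simp add: cot_altdef tan_gt_zero tan_mono_le le_imp_inverse_le)

lemma cot_le: "0 < x \<Longrightarrow> x < pi / 2 \<Longrightarrow> cot (x::real) \<le> 1 / x"
  using abs_tan_ge[of x] tan_gt_zero[of x] by (simp add: cot_altdef inverse_eq_divide frac_le)

text \<open>The summand of \<open>gsum (2 * M)\<close>. For \<open>x < M\<close> its phase
  increments stay below 1/2, where the cotangent is positive and decreasing.\<close>

definition gterm :: "nat \<Rightarrow> nat \<Rightarrow> complex"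
  where "gterm M x = e1 (real (x\<^sup>2) / (4 * real M))"

text \<open>Dividing the difference of consecutive terms by e(\<theta>) - 1 recovers the term. The
  constant part -1/2 then telescopes, the cotangent part is at most
  \<open>cot (pi * \<theta> K)\<close>, hence at most \<open>M / K\<close>, and
  \<open>K \<le> M\<close> absorbs the remaining 2.\<close>

lemma gterm_tail:
  assumes "0 < K" "K \<le> M"
  shows "norm (\<Sum>x\<in>{K..<M}. gterm M x) \<le> 3 * real M / real K"
proof (cases "K = M")
  case False
  then have KM: "K < M" using assms by simp
  define \<theta> where "\<theta> = (\<lambda>x::nat. (2 * real x + 1) / (4 * real M))"
  define c where "c = (\<lambda>x. cot (pi * \<theta> x))"
  have th: "0 < \<theta> x" "\<theta> x < 1 / 2" if "x < M" for x
    using that by (auto simp: \<theta>_def field_simps)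
  have step: "gterm M x = (gterm M (Suc x) - gterm M x) * (- 1 / 2 - \<i> / 2 * of_real (c x))" if "x < M" for x
  proof -
    have "gterm M (Suc x) = gterm M x * e1 (\<theta> x)"
      unfolding gterm_def \<theta>_def e1_add[symmetric]
      by (simp add: add_divide_distrib[symmetric] power2_eq_square algebra_simps)
    then have "gterm M (Suc x) - gterm M x = gterm M x * (e1 (\<theta> x) - 1)" by (simp add: algebra_simps)
    then have "(gterm M (Suc x) - gterm M x) * (- 1 / 2 - \<i> / 2 * of_real (c x))
       = gterm M x * ((e1 (\<theta> x) - 1) * (- 1 / 2 - \<i> / 2 * of_real (c x)))" by (simp only: mult.assoc)
    also have "\<dots> = gterm M x"
      unfolding c_def using inverse_e1_minus_1[OF th[OF that]] by simp
    finally show ?thesis by simp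
  qed
  \<comment> \<open>Stopping at \<open>M - 1\<close> keeps every angle, including
    \<open>\<theta> L\<close>, below 1/2; at \<open>M\<close> the cotangent would be
    negative.\<close>
  define L where "L = M - 1"
  have "(\<Sum>x\<in>{K..<M}. gterm M x) = (\<Sum>x\<in>{K..<L}. gterm M x) + gterm M L"
    using KM sum.atLeastLessThan_Suc[of K L "gterm M"] by (simp add: L_def)
  moreover have "(\<Sum>x\<in>{K..<L}. gterm M x)
    = (\<Sum>x\<in>{K..<L}. (gterm M (Suc x) - gterm M x) * (- 1 / 2 - \<i> / 2 * of_real (c x)))"
    by (intro sum.cong refl step) (auto simp: L_def)
  moreover have "\<dots> = - 1 / 2 * (\<Sum>x\<in>{K..<L}. gterm M (Suc x) - gterm M x)
     - \<i> / 2 * (\<Sum>x\<in>{K..<L}. (gterm M (Suc x) - gterm M x) * of_real (c x))"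
    unfolding sum_distrib_left sum_subtractf[symmetric]
    by (intro sum.cong refl) (simp add: field_simps)
  moreover have "(\<Sum>x\<in>{K..<L}. gterm M (Suc x) - gterm M x) = gterm M L - gterm M K"
    using KM by (intro sum_Suc_diff') (auto simp: L_def)
  moreover have cle: "norm (\<Sum>x\<in>{K..<L}. (gterm M (Suc x) - gterm M x) * of_real (c x)) \<le> 2 * c K"
  proof (rule kusmin_landau_aux)
    show "K \<le> L" using KM by (auto simp: L_def)
    have "\<theta> L < 1 / 2" "\<theta> L > 0" using th[of L] KM by (auto simp: L_def)
    then show "c L \<ge> 0" unfolding c_def
      using cot_gt_zero[of "pi * \<theta> L"] by simp
    fix x assume "x < L"
    then have "\<theta> (Suc x) < 1 / 2" "\<theta> x > 0" using th[of x] th[of "Suc x"] by (auto simp: L_def)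
    moreover have "\<theta> x \<le> \<theta> (Suc x)" by (simp add: \<theta>_def divide_right_mono)
    ultimately show "c (Suc x) \<le> c x"
      unfolding c_def by (intro cot_mono) auto
  qed (simp add: gterm_def)
  moreover have "norm (- 1 / 2 * (gterm M L - gterm M K) - \<i> / 2 * S + gterm M L) \<le> 2 + c K" if "norm S \<le> 2 * c K" for S
  proof -
    have "norm (gterm M L - gterm M K) \<le> 2"
      using norm_triangle_ineq4[of "gterm M L" "gterm M K"] by (simp add: gterm_def)
    then have "norm (- 1 / 2 * (gterm M L - gterm M K)) \<le> 1" unfolding norm_mult by simp
    moreover have "norm (\<i> / 2 * S) \<le> c K" unfolding norm_mult using that by simp
    moreover have "norm (gterm M L) = 1" by (simp add: gterm_def)
    ultimately show ?thesis
      using norm_triangle_ineq[of "- 1 / 2 * (gterm M L - gterm M K) - \<i> / 2 * S" "gterm M L"]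
        norm_triangle_ineq4[of "- 1 / 2 * (gterm M L - gterm M K)" "\<i> / 2 * S"] by linarith
  qed
  ultimately have "norm (\<Sum>x\<in>{K..<M}. gterm M x) \<le> 2 + c K" by simp
  also have "c K \<le> 1 / (pi * \<theta> K)"
    unfolding c_def using th[OF KM] by (intro cot_le) auto
  also have "1 / (pi * \<theta> K) \<le> real M / real K"
  proof -
    have "4 * real K \<le> pi * (2 * real K)" using pi_gt3 by (intro order_trans[OF _ mult_right_mono[of 3 pi]]) auto
    also have "\<dots> \<le> pi * (2 * real K + 1)" by simp
    finally have "4 * real K * real M \<le> pi * (2 * real K + 1) * real M" by (intro mult_right_mono) auto
    then show ?thesis unfolding \<theta>_def using assms KM
      by (simp add: divide_simps)
  qed
  also have "2 + real M / real K \<le> 3 * real M / real K"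
    using assms by (simp add: field_simps)
  finally show ?thesis by simp
qed auto

text \<open>The reflection x -> 2M - x changes the phase by an integer, so the second half of the
  sum repeats the first up to the end terms at 0 and \<open>M\<close>.\<close>

lemma gsum_even_conv_gterm:
  assumes "M > 0"
  shows "norm (gsum (2 * int M) - 2 * (\<Sum>x<M. gterm M x)) \<le> 2"
proof -
  have "gsum (2 * int M) = (\<Sum>x<2 * M. gterm M x)"
    unfolding gsum_def
    by (rule sum.reindex_bij_witness[of _ int nat]) (auto simp: gterm_def)
  also have "\<dots> = (\<Sum>x<M. gterm M x) + (\<Sum>x\<in>{M..<2 * M}. gterm M x)"
    using sum.atLeastLessThan_concat[of 0 M "2 * M" "gterm M"] by (simp add: atLeast0LessThan)
  also have "(\<Sum>x\<in>{M..<2 * M}. gterm M x) = (\<Sum>x\<in>{0<..M}. gterm M x)"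
  proof (rule sum.reindex_bij_witness[of _ "\<lambda>x. 2 * M - x" "\<lambda>x. 2 * M - x"])
    fix x assume x: "x \<in> {M..<2 * M}"
    show "gterm M (2 * M - x) = gterm M x"
      unfolding gterm_def
    proof (rule e1_eqI[where n = "int M - int x"])
      show "real ((2 * M - x)\<^sup>2) / (4 * real M) = real (x\<^sup>2) / (4 * real M) + of_int (int M - int x)"
        using x assms by (simp add: of_nat_diff field_simps power2_eq_square)
    qed
  qed auto
  also have "(\<Sum>x\<in>{0<..M}. gterm M x) = (\<Sum>x<M. gterm M x) - gterm M 0 + gterm M M"
  proof -
    have "(\<Sum>x<Suc M. gterm M x) = gterm M 0 + (\<Sum>x\<in>{0<..M}. gterm M x)"
      using sum.remove[of "{..<Suc M}" 0 "gterm M"]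
      by (simp add: lessThan_Suc_atMost) (metis atLeast0AtMost greaterThanAtMost_eq_atLeastAtMost_diff)
    then show ?thesis by (simp add: algebra_simps)
  qed
  finally have "gsum (2 * int M) - 2 * (\<Sum>x<M. gterm M x) = gterm M M - gterm M 0" by simp
  also have "norm \<dots> \<le> 2"
    using norm_triangle_ineq4[of "gterm M M" "gterm M 0"] by (simp add: gterm_def)
  finally show ?thesis .
qed

section \<open>Comparison with the Fresnel integral\<close>

definition chirp :: "real \<Rightarrow> complex"
  where "chirp x = e1 (x\<^sup>2 / 2)"

lemma chirp_deriv: "(chirp has_vector_derivative (2 * pi * \<i> * x * chirp x)) (at x within S)"
  unfolding chirp_def e1_def cis_conv_exp
  by (auto intro!: derivative_eq_intros has_vector_derivative_real_field simp: power2_eq_square field_simps)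

lemma continuous_chirp: "continuous_on S chirp"
  unfolding chirp_def e1_def by (intro continuous_intros) auto

lemma chirp_lipschitz:
  assumes "0 \<le> x" "x \<le> y" "y \<le> T"
  shows "norm (chirp y - chirp x) \<le> 2 * pi * T * (y - x)"
proof -
  have "norm (chirp y - chirp x) \<le> 2 * pi * T * norm (y - x)"
  proof (rule differentiable_bound[where S = "{0..T}"])
    show "(chirp has_derivative (\<lambda>h. h *\<^sub>R (2 * pi * \<i> * t * chirp t))) (at t within {0..T})" for t
      using chirp_deriv[of t] unfolding has_vector_derivative_def .
    show "onorm (\<lambda>h. h *\<^sub>R (2 * pi * \<i> * t * chirp t)) \<le> 2 * pi * T" if "t \<in> {0..T}" for t
    proof (rule onorm_bound)
      fix h :: real
      have "norm (h *\<^sub>R (2 * pi * \<i> * t * chirp t)) = \<bar>h\<bar> * (2 * pi * t)"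
        using that by (simp add: norm_mult chirp_def)
      also have "\<dots> \<le> \<bar>h\<bar> * (2 * pi * T)" using that by (intro mult_left_mono) auto
      finally show "norm (h *\<^sub>R (2 * pi * \<i> * t * chirp t)) \<le> 2 * pi * T * norm h" by (simp add: mult_ac)
    qed (use that in auto)
  qed (use assms in auto)
  then show ?thesis using assms by simp
qed

text \<open>A left Riemann sum: the Lipschitz constant \<open>2 * pi * T\<close> costs at most
  \<open>2 * pi * T * \<delta>\<^sup>2\<close> per cell, and
  \<open>K * \<delta> \<le> T\<close>.\<close>

lemma chirp_riemann_sum:
  assumes "\<delta> > 0" "real K * \<delta> \<le> T"
  shows "norm (of_real \<delta> * (\<Sum>x<K. chirp (real x * \<delta>)) - integral {0..real K * \<delta>} chirp) \<le> 2 * pi * T\<^sup>2 * \<delta>"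
proof -
  have int: "chirp integrable_on {a..b}" for a b
    by (rule integrable_continuous_interval[OF continuous_chirp])
  have "norm (of_real \<delta> * (\<Sum>x<K. chirp (real x * \<delta>)) - integral {0..real K * \<delta>} chirp) \<le> real K * (2 * pi * T * \<delta> * \<delta>)"
    using assms(2)
  proof (induction K)
    case (Suc K)
    define a where "a = real K * \<delta>"
    have aT: "0 \<le> a" "a + \<delta> \<le> T" using Suc.prems assms(1) by (auto simp: a_def algebra_simps)
    have "integral {0..a + \<delta>} chirp = integral {0..a} chirp + integral {a..a + \<delta>} chirp"
      using aT assms(1) by (intro Henstock_Kurzweil_Integration.integral_combine[symmetric] int) auto
    moreover have "norm (integral {a..a + \<delta>} (\<lambda>t. chirp t - chirp a)) \<le> 2 * pi * T * \<delta> * (a + \<delta> - a)"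
    proof (rule integral_bound)
      fix t assume t: "t \<in> {a..a + \<delta>}"
      have "norm (chirp t - chirp a) \<le> 2 * pi * T * (t - a)"
        using t aT by (intro chirp_lipschitz) auto
      also have "\<dots> \<le> 2 * pi * T * \<delta>" using t aT assms(1) by (intro mult_left_mono) auto
      finally show "norm (chirp t - chirp a) \<le> 2 * pi * T * \<delta>" .
    qed (use assms(1) in \<open>auto intro!: continuous_intros continuous_chirp\<close>)
    moreover have d: "integral {a..a + \<delta>} (\<lambda>t. chirp t - chirp a) = integral {a..a + \<delta>} chirp - of_real \<delta> * chirp a"
      using assms(1) by (subst Henstock_Kurzweil_Integration.integral_diff[OF int]) (auto simp: scaleR_conv_of_real)
    moreover have "norm (of_real \<delta> * (\<Sum>x<K. chirp (real x * \<delta>)) - integral {0..a} chirp) \<le> real K * (2 * pi * T * \<delta> * \<delta>)"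
      using Suc.IH aT assms(1) by (simp add: a_def)
    ultimately have split: "integral {0..a + \<delta>} chirp = integral {0..a} chirp + integral {a..a + \<delta>} chirp"
      and bA: "norm (integral {a..a + \<delta>} chirp - of_real \<delta> * chirp a) \<le> 2 * pi * T * \<delta> * \<delta>"
      and bB: "norm (of_real \<delta> * (\<Sum>x<K. chirp (real x * \<delta>)) - integral {0..a} chirp) \<le> real K * (2 * pi * T * \<delta> * \<delta>)"
      unfolding d by simp_all
    have *: "norm ((of_real \<delta> * (\<Sum>x<K. chirp (real x * \<delta>)) - integral {0..a} chirp)
        - (integral {a..a + \<delta>} chirp - of_real \<delta> * chirp a))
       \<le> real K * (2 * pi * T * \<delta> * \<delta>) + 2 * pi * T * \<delta> * \<delta>"
      by (rule order_trans[OF norm_triangle_ineq4 add_mono[OF bB bA]])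
    have "of_real \<delta> * (\<Sum>x<K. chirp (real x * \<delta>)) + of_real \<delta> * chirp a - integral {0..a + \<delta>} chirp
      = (of_real \<delta> * (\<Sum>x<K. chirp (real x * \<delta>)) - integral {0..a} chirp)
        - (integral {a..a + \<delta>} chirp - of_real \<delta> * chirp a)"
      unfolding split by simp
    with * have "norm (of_real \<delta> * (\<Sum>x<K. chirp (real x * \<delta>)) + of_real \<delta> * chirp a - integral {0..a + \<delta>} chirp)
       \<le> real K * (2 * pi * T * \<delta> * \<delta>) + 2 * pi * T * \<delta> * \<delta>" by (simp only:)
    then show ?case by (simp add: a_def algebra_simps)
  qed auto
  also have "\<dots> = 2 * pi * T * \<delta> * (real K * \<delta>)" by simp
  also have "\<dots> \<le> 2 * pi * T * \<delta> * T"
    using assms by (intro mult_left_mono order_trans[OF _ assms(2)] mult_nonneg_nonneg) auto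
  finally show ?thesis by (simp add: power2_eq_square mult_ac)
qed

lemma chirp_integral_diff:
  assumes "0 \<le> a" "a \<le> b"
  shows "norm (integral {0..b} chirp - integral {0..a} chirp) \<le> b - a"
proof -
  have "integral {0..b} chirp = integral {0..a} chirp + integral {a..b} chirp"
    using assms by (intro Henstock_Kurzweil_Integration.integral_combine[symmetric] integrable_continuous_interval continuous_chirp) auto
  moreover have "norm (integral {a..b} chirp) \<le> 1 * (b - a)"
    using assms by (intro integral_bound continuous_chirp) (auto simp: chirp_def)
  ultimately show ?thesis by simp
qed

text \<open>The sum is cut at \<open>K\<close>, the integer part of \<open>T * sqrt (2 * M)\<close>.
  Below \<open>K\<close> it is a Riemann sum of step \<open>1 / sqrt (2 * M)\<close>; beyond
  \<open>K\<close> the tail bound contributes \<open>6 / T\<close>.\<close>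

lemma gsum_approx:
  assumes "T > 0" "M > 0" "T * sqrt (2 * real M) \<ge> 2" "T * sqrt (2 * real M) \<le> real M"
  shows "norm (gsum (2 * int M) / of_real (sqrt (2 * real M)) - 2 * integral {0..T} chirp)
     \<le> 6 / T + (4 + 4 * pi * T\<^sup>2) / sqrt (2 * real M)"
proof -
  define s where "s = sqrt (2 * real M)"
  define \<delta> where "\<delta> = 1 / s"
  define K where "K = nat \<lfloor>T * s\<rfloor>"
  have s: "s > 0" "s * s = 2 * real M" using assms(2) by (auto simp: s_def)
  have d: "\<delta> > 0" using s by (simp add: \<delta>_def)
  have K: "real K \<le> T * s" "T * s - 1 \<le> real K" using assms(3) unfolding K_def s_def by linarith+
  have K2: "T * s / 2 \<le> real K" "K > 0" using K assms(3) unfolding s_def by linarith+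
  have KM: "K \<le> M" using K(1) assms(4) unfolding s_def by linarith
  have Kd: "real K * \<delta> \<le> T" "T - \<delta> \<le> real K * \<delta>"
    using divide_right_mono[OF K(1), of s] divide_right_mono[OF K(2), of s] s
    unfolding \<delta>_def by (simp_all add: diff_divide_distrib)
  have gt: "gterm M x = chirp (real x * \<delta>)" for x
  proof -
    have "(real x * \<delta>)\<^sup>2 / 2 = (real x)\<^sup>2 / (2 * (s * s))" unfolding \<delta>_def by (simp add: power2_eq_square)
    also have "\<dots> = real (x\<^sup>2) / (4 * real M)" unfolding s(2) by simp
    finally show ?thesis unfolding gterm_def chirp_def by simp
  qed
  define S1 S2 G where "S1 = (\<Sum>x<K. gterm M x)" and "S2 = (\<Sum>x\<in>{K..<M}. gterm M x)" and "G = gsum (2 * int M)"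
  have split: "(\<Sum>x<M. gterm M x) = S1 + S2"
    using sum.atLeastLessThan_concat[of 0 K M "gterm M"] KM by (simp add: atLeast0LessThan S1_def S2_def)
  have b1: "norm (of_real \<delta> * (G - 2 * (S1 + S2))) \<le> 2 * \<delta>"
    using gsum_even_conv_gterm[OF assms(2)] d unfolding split G_def norm_mult by (simp add: mult.commute)
  have "norm S2 \<le> 3 * real M / real K"
    unfolding S2_def by (rule gterm_tail[OF K2(2) KM])
  also have "\<dots> \<le> 3 * real M / (T * s / 2)"
    using K2 assms s by (intro divide_left_mono) auto
  also have "\<dots> = 3 * s / T" using s assms(1) by (simp add: field_simps)
  finally have "\<delta> * 2 * norm S2 \<le> \<delta> * 2 * (3 * s / T)" using d by (intro mult_left_mono) auto
  then have "norm (of_real \<delta> * 2 * S2) \<le> \<delta> * 2 * (3 * s / T)" using d unfolding norm_mult by simp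
  then have b2: "norm (of_real \<delta> * 2 * S2) \<le> 6 / T" using s by (simp add: \<delta>_def)
  have b3: "norm (of_real \<delta> * S1 - integral {0..real K * \<delta>} chirp) \<le> 2 * pi * T\<^sup>2 * \<delta>"
    unfolding S1_def gt using chirp_riemann_sum[OF d Kd(1)] .
  have b4: "norm (integral {0..T} chirp - integral {0..real K * \<delta>} chirp) \<le> \<delta>"
    using chirp_integral_diff[of "real K * \<delta>" T] Kd d by simp
  have "of_real \<delta> * G - 2 * integral {0..T} chirp = of_real \<delta> * (G - 2 * (S1 + S2)) + of_real \<delta> * 2 * S2
     + 2 * (of_real \<delta> * S1 - integral {0..real K * \<delta>} chirp) - 2 * (integral {0..T} chirp - integral {0..real K * \<delta>} chirp)"
    by (simp add: algebra_simps)
  also have "norm \<dots> \<le> 2 * \<delta> + 6 / T + 2 * (2 * pi * T\<^sup>2 * \<delta>) + 2 * \<delta>"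
  proof -
    have tri: "norm (A + B + 2 * C - 2 * D) \<le> a + b + 2 * c + d * 2"
      if "norm A \<le> a" "norm B \<le> b" "norm C \<le> c" "norm D \<le> d" for A B C D :: complex and a b c d
      using that norm_triangle_ineq4[of "A + B + 2 * C" "2 * D"] norm_triangle_ineq[of "A + B" "2 * C"]
        norm_triangle_ineq[of A B] by (simp add: norm_mult)
    show ?thesis using tri[OF b1 b2 b3 b4] by (simp only: mult.commute[of \<delta> 2])
  qed
  also have "of_real \<delta> * G = G / of_real s" by (simp add: \<delta>_def)
  also have "2 * \<delta> + 6 / T + 2 * (2 * pi * T\<^sup>2 * \<delta>) + 2 * \<delta> = 6 / T + (4 + 4 * pi * T\<^sup>2) / s"
    by (simp add: \<delta>_def add_divide_distrib)
  finally show ?thesis unfolding G_def s_def .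
qed

lemma gsum_chirp_integral:
  fixes n :: int
  assumes "n > 0" "even n" "T > 0"
  shows "norm (gsum n / of_real (sqrt (of_int n)) - 2 * integral {0..T} chirp) \<le> 6 / T"
proof -
  define m where "m = nat (n div 2)"
  have m: "n = 2 * int m" "m > 0" using assms by (auto simp: m_def elim!: evenE)
  define h where "h = gsum n / of_real (sqrt (of_int n))"
  have h: "gsum (2 * int (c\<^sup>2 * m)) / of_real (sqrt (2 * real (c\<^sup>2 * m))) = h" if "c > 0" for c
  proof -
    have "gsum (2 * int (c\<^sup>2 * m)) = of_nat c * gsum n"
      using gsum_square[of "int c" n] that assms m by (simp add: mult_ac)
    moreover have "sqrt (2 * real (c\<^sup>2 * m)) = real c * sqrt (of_int n)"
      by (simp add: m real_sqrt_mult)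
    ultimately show ?thesis using that by (simp add: h_def)
  qed
  define r where "r = sqrt (2 * real m)"
  have r: "r > 0" using m(2) by (simp add: r_def)
  have sq: "sqrt (2 * real (c\<^sup>2 * m)) = real c * r" for c
    by (simp add: r_def real_sqrt_mult)
  have rr: "real (c\<^sup>2 * m) = (real c)\<^sup>2 * r\<^sup>2 / 2" for c
    by (simp add: r_def)
  have lim: "(\<lambda>c. 6 / T + (4 + 4 * pi * T\<^sup>2) / sqrt (2 * real (c\<^sup>2 * m))) \<longlonglongrightarrow> 6 / T + 0"
    unfolding sq
  proof (rule tendsto_add[OF tendsto_const tendsto_divide_0[OF tendsto_const]])
    have "filterlim (\<lambda>c. r * real c) at_top sequentially"
      by (rule filterlim_tendsto_pos_mult_at_top[OF tendsto_const r filterlim_real_sequentially])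
    then have "filterlim (\<lambda>c. real c * r) at_top sequentially" by (simp only: mult.commute)
    then show "filterlim (\<lambda>c. real c * r) at_infinity sequentially" by (rule filterlim_at_top_imp_at_infinity)
  qed
  have big: "eventually (\<lambda>c. B \<le> real c) sequentially" for B
    using filterlim_real_sequentially by (simp add: filterlim_at_top)
  have "eventually (\<lambda>c. T * sqrt (2 * real (c\<^sup>2 * m)) \<ge> 2) sequentially"
    using big[of "2 / (T * r)"]
    unfolding sq by eventually_elim (use r assms(3) in \<open>simp add: field_simps\<close>)
  moreover have "eventually (\<lambda>c. T * sqrt (2 * real (c\<^sup>2 * m)) \<le> real (c\<^sup>2 * m)) sequentially"
    using big[of "2 * T / r"]
  proof eventually_elim
    case (elim c)
    then have "2 * T \<le> real c * r" using r by (simp add: field_simps)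
    then have "2 * T * (real c * r) \<le> real c * r * (real c * r)" using r by (intro mult_right_mono) auto
    then show ?case unfolding sq unfolding rr by (simp add: power2_eq_square mult_ac)
  qed
  ultimately have "eventually (\<lambda>c. norm (h - 2 * integral {0..T} chirp) \<le> 6 / T + (4 + 4 * pi * T\<^sup>2) / sqrt (2 * real (c\<^sup>2 * m))) sequentially"
    using eventually_gt_at_top[of 0]
  proof eventually_elim
    case (elim c)
    then show ?case using gsum_approx[of T "c\<^sup>2 * m"] unfolding h[OF elim(3)]
      using assms(3) m(2) elim(3) by simp
  qed
  then show ?thesis
    using tendsto_lowerbound[OF lim] unfolding h_def by (simp only: add_0_right sequentially_bot not_False_eq_True)
qed

theorem gsum_eq:
  fixes n :: int
  assumes "n > 0" "even n"
  shows "gsum n = of_real (sqrt (of_int n)) * e1 (1 / 8)"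
proof -
  define h where "h = (\<lambda>n::int. gsum n / of_real (sqrt (of_int n)))"
  have "norm (h n - h 2) \<le> \<epsilon>" if "\<epsilon> > 0" for \<epsilon>
  proof -
    define T where "T = 12 / \<epsilon>"
    have T: "T > 0" "6 / T = \<epsilon> / 2" using that by (simp_all add: T_def)
    define I where "I = 2 * integral {0..T} chirp"
    have 1: "norm (h n - I) \<le> \<epsilon> / 2"
      using gsum_chirp_integral[OF assms T(1)] unfolding h_def I_def T(2) .
    have 2: "norm (h 2 - I) \<le> \<epsilon> / 2"
      using gsum_chirp_integral[of 2, OF _ _ T(1)] unfolding h_def I_def T(2) by simp
    show ?thesis
      using norm_triangle_ineq4[of "h n - I" "h 2 - I"] 1 2 by simp
  qed
  \<comment> \<open>With half the distance as \<epsilon> the bound is contradictory unless the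
    distance is 0.\<close>
  from this[of "norm (h n - h 2) / 2"] have "\<not> norm (h n - h 2) > 0" by linarith
  then have "h n = h 2" by simp
  also have "h 2 = (1 + \<i>) / of_real (sqrt 2)"
  proof -
    have "{0..<2::int} = {0, 1}" by auto
    then show ?thesis unfolding h_def gsum_def by (simp add: e1_def)
  qed
  also have "\<dots> = e1 (1 / 8)"
    by (simp add: e1_def complex_eq_iff cos_45 sin_45 field_simps)
  finally show ?thesis using assms by (simp add: h_def field_simps)
qed

section \<open>The Gauss sum of the H-graph\<close>

text \<open>The one-dimensional Gauss sum with weight \<open>w\<close> and linear term
  \<open>u\<close>. Besides the leaves it also describes a node already merged with its leaves, with
  modulus \<open>c * M\<close> and weight \<open>- P\<close>.\<close>

definition leaf_sum :: "int \<Rightarrow> int \<Rightarrow> int \<Rightarrow> complex"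
  where "leaf_sum c w u = (\<Sum>x=0..<c. e1 (of_int (w * x\<^sup>2) / (2 * of_int c) + of_int (u * x) / of_int c))"

lemma e1_quadratic_periodic:
  fixes c w u x y :: int
  assumes "c > 0" "even (c * w)"
  shows "e1 (of_int (w * (x + c * y)\<^sup>2) / (2 * of_int c) + of_int (u * (x + c * y)) / of_int c)
       = e1 (of_int (w * x\<^sup>2) / (2 * of_int c) + of_int (u * x) / of_int c)"
proof -
  obtain m where m: "c * w = 2 * m" using assms(2) by (auto elim: evenE)
  have m': "real_of_int c * of_int w = 2 * of_int m" using m by (metis of_int_mult of_int_numeral)
  have "of_int (w * (x + c * y)\<^sup>2) / (2 * of_int c) + of_int (u * (x + c * y)) / of_int c
     = of_int (w * x\<^sup>2) / (2 * of_int c) + of_int (u * x) / of_int c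
       + (of_int (w * x * y + u * y) + real_of_int c * of_int w * of_int (y\<^sup>2) / 2)"
    using assms(1) by (simp add: field_simps power2_eq_square)
  also have "real_of_int c * of_int w * of_int (y\<^sup>2) / 2 = of_int (m * y\<^sup>2)"
    unfolding m' by simp
  finally show ?thesis by (intro e1_eqI[where n = "w * x * y + u * y + m * y\<^sup>2"]) simp
qed

text \<open>This is \<open>gauss_dual\<close> with the value of \<open>gsum (c * a)\<close>
  inserted; the constant in front is \<open>c / gsum (c * a)\<close>.\<close>

lemma leaf_sum_reciprocity:
  fixes c a u :: int
  assumes "c > 0" "a > 0" "even (c * a)"
  shows "leaf_sum c (- a) u = of_real (sqrt (of_int c / of_int a)) * e1 (- 1 / 8)
     * (\<Sum>y=0..<a. e1 (of_int ((u + c * y)\<^sup>2) / (2 * of_int (c * a))))"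
proof -
  define S where "S = (\<Sum>y=0..<a. e1 (of_int ((u + c * y)\<^sup>2) / (2 * of_int (c * a))))"
  define K where "K = of_real (sqrt (of_int c / of_int a)) * e1 (- 1 / 8)"
  have pos: "real_of_int c > 0" "real_of_int a > 0" using assms(1,2) by auto
  have g: "gsum (c * a) = of_real (sqrt (of_int c * of_int a)) * e1 (1 / 8)"
    using gsum_eq[of "c * a"] assms(3) mult_pos_pos[OF assms(1,2)] by (simp only: of_int_mult)
  have "sqrt (of_int c / of_int a) * sqrt (of_int c * of_int a) = sqrt ((of_int c)\<^sup>2)"
    unfolding real_sqrt_mult[symmetric] using pos by (intro arg_cong[of _ _ sqrt]) (simp add: power2_eq_square)
  also have "\<dots> = of_int c" using pos by simp
  finally have sq: "sqrt (of_int c / of_int a) * sqrt (of_int c * of_int a) = of_int c" .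
  have "K * gsum (c * a) = of_real (sqrt (of_int c / of_int a) * sqrt (of_int c * of_int a)) * (e1 (- 1 / 8) * e1 (1 / 8))"
    unfolding K_def g of_real_mult by (simp only: mult_ac)
  also have "\<dots> = of_int c" unfolding sq e1_add[symmetric] by simp
  finally have Kg: "K * gsum (c * a) = of_int c" .
  have g0: "gsum (c * a) \<noteq> 0" using Kg pos by auto
  have "gsum (c * a) * leaf_sum c (- a) u = of_int c * S"
    using gauss_dual[OF assms(2,1,3), of u] by (simp add: leaf_sum_def S_def)
  also have "\<dots> = gsum (c * a) * (K * S)" unfolding Kg[symmetric] by (simp only: mult_ac)
  finally have "leaf_sum c (- a) u = K * S" using g0 by simp
  then show ?thesis unfolding K_def S_def .
qed

text \<open>Along \<open>x + c * y\<close> the functions have periods \<open>a\<close> and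
  \<open>b\<close> in \<open>y\<close>, so the Chinese remainder theorem applies although
  \<open>c * a\<close> and \<open>c * b\<close> share the factor \<open>c\<close>.\<close>

lemma pointwise_crt:
  fixes f g :: "int \<Rightarrow> complex"
  assumes "\<And>x y. f (x + c * a * y) = f x" "\<And>x y. g (x + c * b * y) = g x" "a > 0" "b > 0" "coprime a b"
  shows "(\<Sum>y=0..<a. f (x + c * y)) * (\<Sum>z=0..<b. g (x + c * z)) = (\<Sum>y=0..<a * b. f (x + c * y) * g (x + c * y))"
proof (rule sum_int_crt[OF _ _ assms(3-5)])
  show "f (x + c * (y + a)) = f (x + c * y)" for y
    using assms(1)[of "x + c * y" 1] by (simp add: algebra_simps)
  show "g (x + c * (y + b)) = g (x + c * y)" for y
    using assms(2)[of "x + c * y" 1] by (simp add: algebra_simps)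
qed

lemma sum6_shift:
  fixes f :: "int \<Rightarrow> int \<Rightarrow> int \<Rightarrow> int \<Rightarrow> int \<Rightarrow> int \<Rightarrow> complex"
  assumes c: "c > 0"
    and per: "\<And>x1 x2 x3 x4 x5 x6. f (x1 + c) x2 x3 x4 x5 x6 = f x1 x2 x3 x4 x5 x6"
    "\<And>x1 x2 x3 x4 x5 x6. f x1 (x2 + c) x3 x4 x5 x6 = f x1 x2 x3 x4 x5 x6"
    "\<And>x1 x2 x3 x4 x5 x6. f x1 x2 (x3 + c) x4 x5 x6 = f x1 x2 x3 x4 x5 x6"
    "\<And>x1 x2 x3 x4 x5 x6. f x1 x2 x3 (x4 + c) x5 x6 = f x1 x2 x3 x4 x5 x6"
    "\<And>x1 x2 x3 x4 x5 x6. f x1 x2 x3 x4 (x5 + c) x6 = f x1 x2 x3 x4 x5 x6"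
    "\<And>x1 x2 x3 x4 x5 x6. f x1 x2 x3 x4 x5 (x6 + c) = f x1 x2 x3 x4 x5 x6"
  shows "(\<Sum>x1=0..<c. \<Sum>x2=0..<c. \<Sum>x3=0..<c. \<Sum>x4=0..<c. \<Sum>x5=0..<c. \<Sum>x6=0..<c.
      f (x1 + y1) (x2 + y2) (x3 + y3) (x4 + y4) (x5 + y5) (x6 + y6))
    = (\<Sum>x1=0..<c. \<Sum>x2=0..<c. \<Sum>x3=0..<c. \<Sum>x4=0..<c. \<Sum>x5=0..<c. \<Sum>x6=0..<c.
      f x1 x2 x3 x4 x5 x6)"
proof -
  note sh = sum_int_shift[OF _ c]
  have 6: "(\<Sum>x6=0..<c. f a1 a2 a3 a4 a5 (x6 + y6)) = (\<Sum>x6=0..<c. f a1 a2 a3 a4 a5 x6)" for a1 a2 a3 a4 a5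
    by (rule sh[of "f a1 a2 a3 a4 a5"]) (simp only: per)
  have 5: "(\<Sum>x5=0..<c. \<Sum>x6=0..<c. f a1 a2 a3 a4 (x5 + y5) x6)
     = (\<Sum>x5=0..<c. \<Sum>x6=0..<c. f a1 a2 a3 a4 x5 x6)" for a1 a2 a3 a4
    by (rule sh[of "\<lambda>u. \<Sum>x6=0..<c. f a1 a2 a3 a4 u x6"]) (simp only: per)
  have 4: "(\<Sum>x4=0..<c. \<Sum>x5=0..<c. \<Sum>x6=0..<c. f a1 a2 a3 (x4 + y4) x5 x6)
     = (\<Sum>x4=0..<c. \<Sum>x5=0..<c. \<Sum>x6=0..<c. f a1 a2 a3 x4 x5 x6)" for a1 a2 a3
    by (rule sh[of "\<lambda>u. \<Sum>x5=0..<c. \<Sum>x6=0..<c. f a1 a2 a3 u x5 x6"]) (simp only: per)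
  have 3: "(\<Sum>x3=0..<c. \<Sum>x4=0..<c. \<Sum>x5=0..<c. \<Sum>x6=0..<c. f a1 a2 (x3 + y3) x4 x5 x6)
     = (\<Sum>x3=0..<c. \<Sum>x4=0..<c. \<Sum>x5=0..<c. \<Sum>x6=0..<c. f a1 a2 x3 x4 x5 x6)" for a1 a2
    by (rule sh[of "\<lambda>u. \<Sum>x4=0..<c. \<Sum>x5=0..<c. \<Sum>x6=0..<c. f a1 a2 u x4 x5 x6"]) (simp only: per)
  have 2: "(\<Sum>x2=0..<c. \<Sum>x3=0..<c. \<Sum>x4=0..<c. \<Sum>x5=0..<c. \<Sum>x6=0..<c. f a1 (x2 + y2) x3 x4 x5 x6)
     = (\<Sum>x2=0..<c. \<Sum>x3=0..<c. \<Sum>x4=0..<c. \<Sum>x5=0..<c. \<Sum>x6=0..<c. f a1 x2 x3 x4 x5 x6)" for a1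
    by (rule sh[of "\<lambda>u. \<Sum>x3=0..<c. \<Sum>x4=0..<c. \<Sum>x5=0..<c. \<Sum>x6=0..<c. f a1 u x3 x4 x5 x6"]) (simp only: per)
  have 1: "(\<Sum>x1=0..<c. \<Sum>x2=0..<c. \<Sum>x3=0..<c. \<Sum>x4=0..<c. \<Sum>x5=0..<c. \<Sum>x6=0..<c. f (x1 + y1) x2 x3 x4 x5 x6)
     = (\<Sum>x1=0..<c. \<Sum>x2=0..<c. \<Sum>x3=0..<c. \<Sum>x4=0..<c. \<Sum>x5=0..<c. \<Sum>x6=0..<c. f x1 x2 x3 x4 x5 x6)"
    by (rule sh[of "\<lambda>u. \<Sum>x2=0..<c. \<Sum>x3=0..<c. \<Sum>x4=0..<c. \<Sum>x5=0..<c. \<Sum>x6=0..<c. f u x2 x3 x4 x5 x6"]) (simp only: per)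
  show ?thesis by (simp only: 6 5 4 3 2 1)
qed

text \<open>\<open>p_neg\<close> and \<open>r_neg\<close> concern the determinants of the subtrees
  {1, 3, 4} and {2, 5, 6}, which are negative for a negative definite form of rank 3.
  \<open>unimod\<close> is det W = 1 expanded along the edge {1, 2}. Integer weights are kept for
  the divisibility arguments.\<close>

locale H_form =
  fixes w1 w2 w3 w4 w5 w6 :: int
  assumes leaf_neg: "w3 < 0" "w4 < 0" "w5 < 0" "w6 < 0"
    and p_neg: "w1 * (w3 * w4) - w3 - w4 < 0"
    and r_neg: "w2 * (w5 * w6) - w5 - w6 < 0"
    and unimod: "(w1 * (w3 * w4) - w3 - w4) * (w2 * (w5 * w6) - w5 - w6) - (w3 * w4) * (w5 * w6) = 1"
begin

definition "M = w3 * w4"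
definition "N = w5 * w6"
definition "P = - (w1 * (w3 * w4) - w3 - w4)"
definition "R = - (w2 * (w5 * w6) - w5 - w6)"

lemma MNPR_pos: "M > 0" "N > 0" "P > 0" "R > 0"
  using leaf_neg p_neg r_neg by (simp_all add: M_def N_def P_def R_def mult_neg_neg)

lemma PR: "P * R = M * N + 1"
  using unimod unfolding M_def N_def P_def R_def by (simp only: minus_mult_minus)

text \<open>In each case a common divisor divides \<open>P * R - M * N = 1\<close>; for instance, a
  common divisor of \<open>w3\<close> and \<open>w4\<close> divides both \<open>P\<close> and
  \<open>M\<close>.\<close>

lemma coprime_facts: "coprime (- w3) (- w4)" "coprime (- w5) (- w6)" "coprime N P"
proof -
  show "coprime (- w3) (- w4)"
  proof (rule coprimeI)
    fix d assume "d dvd - w3" "d dvd - w4"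
    then have "d dvd P" "d dvd M" by (auto simp: P_def M_def)
    then have "d dvd P * R - M * N" by auto
    then show "is_unit d" by (simp add: PR)
  qed
  show "coprime (- w5) (- w6)"
  proof (rule coprimeI)
    fix d assume "d dvd - w5" "d dvd - w6"
    then have "d dvd R" "d dvd N" by (auto simp: R_def N_def)
    then have "d dvd P * R - M * N" by auto
    then show "is_unit d" by (simp add: PR)
  qed
  show "coprime N P"
  proof (rule coprimeI)
    fix d assume "d dvd N" "d dvd P"
    then have "d dvd P * R - M * N" by auto
    then show "is_unit d" by (simp add: PR)
  qed
qed

text \<open>The leaf variables are already summed inside \<open>leaf_sum\<close>, where the value at
  the adjacent node joins the linear term. \<open>gauss_sum_expand\<close> recovers the sixfold
  sum.\<close>

definition gauss_sum :: "int \<Rightarrow> int \<Rightarrow> int \<Rightarrow> int \<Rightarrow> int \<Rightarrow> int \<Rightarrow> int \<Rightarrow> complex"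
  where "gauss_sum c l1 l2 l3 l4 l5 l6 = (\<Sum>x1=0..<c. \<Sum>x2=0..<c.
     e1 (of_int (w1 * x1\<^sup>2 + w2 * x2\<^sup>2 + 2 * x1 * x2) / (2 * of_int c) + of_int (x1 * l1 + x2 * l2) / of_int c)
     * (leaf_sum c w3 (x1 + l3) * leaf_sum c w4 (x1 + l4) * leaf_sum c w5 (x2 + l5) * leaf_sum c w6 (x2 + l6)))"

definition qform :: "int \<Rightarrow> int \<Rightarrow> int \<Rightarrow> int \<Rightarrow> int \<Rightarrow> int \<Rightarrow> int"
  where "qform x1 x2 x3 x4 x5 x6 = w1 * x1\<^sup>2 + w2 * x2\<^sup>2 + w3 * x3\<^sup>2 + w4 * x4\<^sup>2 + w5 * x5\<^sup>2 + w6 * x6\<^sup>2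
     + 2 * (x1 * x2 + x1 * x3 + x1 * x4 + x2 * x5 + x2 * x6)"

lemma half_add_divide: "a / (2 * c) + b / c = (a + 2 * b) / (2 * c)" if "c \<noteq> 0" for a b c :: real
  using that by (simp add: field_simps)

lemma sum4_product:
  fixes f g h j :: "int \<Rightarrow> complex"
  shows "sum f A * sum g A * sum h A * sum j A = (\<Sum>x\<in>A. \<Sum>y\<in>A. \<Sum>z\<in>A. \<Sum>t\<in>A. f x * g y * h z * j t)"
  by (simp only: sum_distrib_left[symmetric] sum_distrib_right[symmetric] mult.assoc)

lemma gauss_sum_expand:
  assumes "c > 0"
  shows "gauss_sum c l1 l2 l3 l4 l5 l6 = (\<Sum>x1=0..<c. \<Sum>x2=0..<c. \<Sum>x3=0..<c. \<Sum>x4=0..<c. \<Sum>x5=0..<c. \<Sum>x6=0..<c.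
     e1 (of_int (qform x1 x2 x3 x4 x5 x6) / (2 * of_int c) + of_int (x1 * l1 + x2 * l2 + x3 * l3 + x4 * l4 + x5 * l5 + x6 * l6) / of_int c))"
proof -
  have e: "e1 (of_int (qform x1 x2 x3 x4 x5 x6) / (2 * of_int c) + of_int (x1 * l1 + x2 * l2 + x3 * l3 + x4 * l4 + x5 * l5 + x6 * l6) / of_int c)
   = e1 (of_int (w1 * x1\<^sup>2 + w2 * x2\<^sup>2 + 2 * x1 * x2) / (2 * of_int c) + of_int (x1 * l1 + x2 * l2) / of_int c)
     * (e1 (of_int (w3 * x3\<^sup>2) / (2 * of_int c) + of_int ((x1 + l3) * x3) / of_int c)
     * e1 (of_int (w4 * x4\<^sup>2) / (2 * of_int c) + of_int ((x1 + l4) * x4) / of_int c)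
     * e1 (of_int (w5 * x5\<^sup>2) / (2 * of_int c) + of_int ((x2 + l5) * x5) / of_int c)
     * e1 (of_int (w6 * x6\<^sup>2) / (2 * of_int c) + of_int ((x2 + l6) * x6) / of_int c))" for x1 x2 x3 x4 x5 x6
  proof -
    have c: "real_of_int c \<noteq> 0" using assms by simp
    show ?thesis
      unfolding e1_add[symmetric] half_add_divide[OF c] add_divide_distrib[symmetric] qform_def
      by (rule arg_cong[of _ _ "\<lambda>x. e1 (x / (2 * of_int c))"]) (simp add: algebra_simps)
  qed
  show ?thesis
    unfolding gauss_sum_def leaf_sum_def sum4_product e unfolding sum_distrib_left ..
qed

text \<open>For \<open>l = W y\<close> with integral \<open>y\<close>, the linear term is absorbed
  by the shift x -> x + y, at the price of the constant phase
  \<open>- l^T y / (2 * c)\<close>.\<close>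

lemma gauss_sum_shift:
  assumes c: "c > 0" "even c"
    and y: "l1 = w1 * y1 + y2 + y3 + y4" "l2 = w2 * y2 + y1 + y5 + y6" "l3 = w3 * y3 + y1" "l4 = w4 * y4 + y1"
      "l5 = w5 * y5 + y2" "l6 = w6 * y6 + y2"
  shows "gauss_sum c l1 l2 l3 l4 l5 l6 =
    e1 (- of_int (l1 * y1 + l2 * y2 + l3 * y3 + l4 * y4 + l5 * y5 + l6 * y6) / (2 * of_int c)) * gauss_sum c 0 0 0 0 0 0"
proof -
  define f where "f = (\<lambda>x1 x2 x3 x4 x5 x6. e1 (of_int (qform x1 x2 x3 x4 x5 x6) / (2 * of_int c)))"
  \<comment> \<open>As \<open>c\<close> is even, the contribution \<open>w * c\<^sup>2\<close> of a
    square to the shifted form is a multiple of \<open>2 * c\<close>.\<close>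
  obtain m where m: "c = 2 * m" using c by auto
  have per: "e1 (of_int a / (2 * of_int c)) = e1 (of_int b / (2 * of_int c))" if "a = b + 2 * c * j" for a b j :: int
    by (rule e1_eqI[where n = j]) (use c that in \<open>simp add: field_simps\<close>)
  have sh: "e1 (of_int (qform x1 x2 x3 x4 x5 x6) / (2 * of_int c) + of_int (x1 * l1 + x2 * l2 + x3 * l3 + x4 * l4 + x5 * l5 + x6 * l6) / of_int c)
    = e1 (- of_int (l1 * y1 + l2 * y2 + l3 * y3 + l4 * y4 + l5 * y5 + l6 * y6) / (2 * of_int c))
      * f (x1 + y1) (x2 + y2) (x3 + y3) (x4 + y4) (x5 + y5) (x6 + y6)" for x1 x2 x3 x4 x5 x6
  proof -
    have "qform (x1 + y1) (x2 + y2) (x3 + y3) (x4 + y4) (x5 + y5) (x6 + y6)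
      = qform x1 x2 x3 x4 x5 x6 + 2 * (x1 * l1 + x2 * l2 + x3 * l3 + x4 * l4 + x5 * l5 + x6 * l6)
        + (l1 * y1 + l2 * y2 + l3 * y3 + l4 * y4 + l5 * y5 + l6 * y6)"
      unfolding y qform_def by (simp add: algebra_simps power2_eq_square)
    then have "real_of_int (qform (x1 + y1) (x2 + y2) (x3 + y3) (x4 + y4) (x5 + y5) (x6 + y6))
      = of_int (qform x1 x2 x3 x4 x5 x6) + 2 * of_int (x1 * l1 + x2 * l2 + x3 * l3 + x4 * l4 + x5 * l5 + x6 * l6)
        + of_int (l1 * y1 + l2 * y2 + l3 * y3 + l4 * y4 + l5 * y5 + l6 * y6)"
      by (simp only: of_int_add of_int_mult of_int_numeral)
    then show ?thesis
      unfolding f_def e1_add[symmetric] using c(1)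
      by (intro arg_cong[of _ _ e1]) (simp only: half_add_divide[of "of_int c"] add_divide_distrib[symmetric] of_int_eq_0_iff, simp)
  qed
  have "gauss_sum c l1 l2 l3 l4 l5 l6 = e1 (- of_int (l1 * y1 + l2 * y2 + l3 * y3 + l4 * y4 + l5 * y5 + l6 * y6) / (2 * of_int c)) *
    (\<Sum>x1=0..<c. \<Sum>x2=0..<c. \<Sum>x3=0..<c. \<Sum>x4=0..<c. \<Sum>x5=0..<c. \<Sum>x6=0..<c.
      f (x1 + y1) (x2 + y2) (x3 + y3) (x4 + y4) (x5 + y5) (x6 + y6))"
    unfolding gauss_sum_expand[OF c(1)] sh by (simp only: sum_distrib_left)
  also have "(\<Sum>x1=0..<c. \<Sum>x2=0..<c. \<Sum>x3=0..<c. \<Sum>x4=0..<c. \<Sum>x5=0..<c. \<Sum>x6=0..<c.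
      f (x1 + y1) (x2 + y2) (x3 + y3) (x4 + y4) (x5 + y5) (x6 + y6))
    = (\<Sum>x1=0..<c. \<Sum>x2=0..<c. \<Sum>x3=0..<c. \<Sum>x4=0..<c. \<Sum>x5=0..<c. \<Sum>x6=0..<c.
      f x1 x2 x3 x4 x5 x6)"
  proof (rule sum6_shift[OF c(1)])
    fix x1 x2 x3 x4 x5 x6
    show "f (x1 + c) x2 x3 x4 x5 x6 = f x1 x2 x3 x4 x5 x6" unfolding f_def
      by (rule per[where j = "w1 * x1 + w1 * m + x2 + x3 + x4"]) (simp add: qform_def m algebra_simps power2_eq_square)
    show "f x1 (x2 + c) x3 x4 x5 x6 = f x1 x2 x3 x4 x5 x6" unfolding f_def
      by (rule per[where j = "w2 * x2 + w2 * m + x1 + x5 + x6"]) (simp add: qform_def m algebra_simps power2_eq_square)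
    show "f x1 x2 (x3 + c) x4 x5 x6 = f x1 x2 x3 x4 x5 x6" unfolding f_def
      by (rule per[where j = "w3 * x3 + w3 * m + x1"]) (simp add: qform_def m algebra_simps power2_eq_square)
    show "f x1 x2 x3 (x4 + c) x5 x6 = f x1 x2 x3 x4 x5 x6" unfolding f_def
      by (rule per[where j = "w4 * x4 + w4 * m + x1"]) (simp add: qform_def m algebra_simps power2_eq_square)
    show "f x1 x2 x3 x4 (x5 + c) x6 = f x1 x2 x3 x4 x5 x6" unfolding f_def
      by (rule per[where j = "w5 * x5 + w5 * m + x2"]) (simp add: qform_def m algebra_simps power2_eq_square)
    show "f x1 x2 x3 x4 x5 (x6 + c) = f x1 x2 x3 x4 x5 x6" unfolding f_def
      by (rule per[where j = "w6 * x6 + w6 * m + x2"]) (simp add: qform_def m algebra_simps power2_eq_square)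
  qed
  also have "\<dots> = gauss_sum c 0 0 0 0 0 0"
    unfolding gauss_sum_expand[OF c(1)] f_def by simp
  finally show ?thesis .
qed

end

text \<open>Reciprocity turns each leaf into a sum along \<open>x + c * y\<close> of length its
  weight up to sign. Coprimality merges the two leaves of a node into one such sum, in which 1/a +
  1/b = (a + b)/(a b) appears.\<close>

lemma leaf_sum_pair:
  fixes a b c x :: int
  assumes "a > 0" "b > 0" "coprime a b" "c > 0" "even c"
  shows "leaf_sum c (- a) x * leaf_sum c (- b) x = of_real (of_int c / sqrt (of_int (a * b))) * e1 (- 1 / 4)
    * (\<Sum>y=0..<a * b. e1 (of_int ((a + b) * (x + c * y)\<^sup>2) / (2 * of_int (c * (a * b)))))"
proof -
  define f where "f = (\<lambda>a X::int. e1 (of_int (X\<^sup>2) / (2 * of_int (c * a))))"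
  have per: "f a (X + c * a * y) = f a X" if "a > 0" for a X y
    using e1_quadratic_periodic[of "c * a" 1 X y 0] that assms(4,5) by (simp add: f_def)
  have ff: "f a X * f b X = e1 (of_int ((a + b) * X\<^sup>2) / (2 * of_int (c * (a * b))))" for X
    unfolding f_def e1_add[symmetric] using assms
    by (intro arg_cong[of _ _ e1]) (simp add: field_simps)
  have "real_of_int c > 0" "real_of_int a > 0" "real_of_int b > 0" using assms by auto
  then have "sqrt (of_int c / of_int a) * sqrt (of_int c / of_int b) = sqrt ((of_int c)\<^sup>2 / of_int (a * b))"
    unfolding real_sqrt_mult[symmetric] by (simp add: power2_eq_square)
  also have "\<dots> = of_int c / sqrt (of_int (a * b))"
    unfolding real_sqrt_divide using assms(4) by simp
  finally have sq: "sqrt (of_int c / of_int a) * sqrt (of_int c / of_int b) = of_int c / sqrt (of_int (a * b))" .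
  have "leaf_sum c (- a) x * leaf_sum c (- b) x
      = of_real (sqrt (of_int c / of_int a)) * e1 (- 1 / 8) * (\<Sum>y=0..<a. f a (x + c * y))
      * (of_real (sqrt (of_int c / of_int b)) * e1 (- 1 / 8) * (\<Sum>y=0..<b. f b (x + c * y)))"
    unfolding f_def using assms by (subst (1 2) leaf_sum_reciprocity) auto
  also have "\<dots> = of_real (sqrt (of_int c / of_int a) * sqrt (of_int c / of_int b)) * (e1 (- 1 / 8) * e1 (- 1 / 8))
      * ((\<Sum>y=0..<a. f a (x + c * y)) * (\<Sum>y=0..<b. f b (x + c * y)))"
    unfolding of_real_mult by (simp only: mult_ac)
  also have "(\<Sum>y=0..<a. f a (x + c * y)) * (\<Sum>y=0..<b. f b (x + c * y))
      = (\<Sum>y=0..<a * b. f a (x + c * y) * f b (x + c * y))"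
    by (rule pointwise_crt) (use per assms in auto)
  also have "\<dots> = (\<Sum>y=0..<a * b. e1 (of_int ((a + b) * (x + c * y)\<^sup>2) / (2 * of_int (c * (a * b)))))"
    unfolding ff ..
  also have "e1 (- 1 / 8) * e1 (- 1 / 8) = e1 (- 1 / 4)" unfolding e1_add[symmetric] by simp
  finally show ?thesis unfolding sq .
qed

context H_form
begin

text \<open>Eliminates node 1 together with its leaves. The sums over \<open>x\<close> and
  \<open>y\<close> join into one over \<open>x + c * y\<close> modulo \<open>c * M\<close>, whose
  weight is \<open>w1 * M - w3 - w4 = - P\<close>; reciprocity is then applied once more.\<close>

lemma side_sum:
  assumes c: "c > 0" "even c"
  shows "(\<Sum>x=0..<c. e1 (of_int (w1 * x\<^sup>2) / (2 * of_int c) + of_int (v * x) / of_int c)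
      * (\<Sum>y=0..<M. e1 (of_int ((- w3 + - w4) * (x + c * y)\<^sup>2) / (2 * of_int (c * M)))))
    = of_real (sqrt (of_int (c * M) / of_int P)) * e1 (- 1 / 8)
      * (\<Sum>z=0..<P. e1 (of_int (M * (v + c * z)\<^sup>2) / (2 * of_int (c * P))))"
proof -
  have pt: "e1 (of_int (w1 * x\<^sup>2) / (2 * of_int c) + of_int (v * x) / of_int c)
      * e1 (of_int ((- w3 + - w4) * (x + c * y)\<^sup>2) / (2 * of_int (c * M)))
    = e1 (of_int (- P * (x + c * y)\<^sup>2) / (2 * of_int (c * M)) + of_int (M * v * (x + c * y)) / of_int (c * M))" for x y
  proof -
    have w: "of_int w1 = (real_of_int (- P) - of_int (- w3 + - w4)) / of_int M"
      using leaf_neg by (simp add: P_def M_def field_simps)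
    have "e1 (of_int (w1 * x\<^sup>2) / (2 * of_int c) + of_int (v * x) / of_int c)
       = e1 (of_int (w1 * (x + c * y)\<^sup>2) / (2 * of_int c) + of_int (v * (x + c * y)) / of_int c)"
      by (rule e1_quadratic_periodic[symmetric]) (use c in auto)
    moreover have "of_int (w1 * X\<^sup>2) / (2 * of_int c) + of_int (v * X) / of_int c + of_int ((- w3 + - w4) * X\<^sup>2) / (2 * of_int (c * M))
       = (of_int (- P * X\<^sup>2) / (2 * of_int (c * M)) + of_int (M * v * X) / of_int (c * M) :: real)" for X
      unfolding of_int_mult w using MNPR_pos c by (simp add: field_simps)
    ultimately show ?thesis by (simp only: e1_add[symmetric])
  qed
  have "(\<Sum>x=0..<c. e1 (of_int (w1 * x\<^sup>2) / (2 * of_int c) + of_int (v * x) / of_int c)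
      * (\<Sum>y=0..<M. e1 (of_int ((- w3 + - w4) * (x + c * y)\<^sup>2) / (2 * of_int (c * M)))))
    = leaf_sum (c * M) (- P) (M * v)"
    unfolding sum_distrib_left pt leaf_sum_def by (rule sum_int_split) (use c MNPR_pos in auto)
  also have "\<dots> = of_real (sqrt (of_int (c * M) / of_int P)) * e1 (- 1 / 8)
      * (\<Sum>z=0..<P. e1 (of_int ((M * v + c * M * z)\<^sup>2) / (2 * of_int (c * M * P))))"
    by (rule leaf_sum_reciprocity) (use c MNPR_pos in auto)
  also have "(\<lambda>z. real_of_int ((M * v + c * M * z)\<^sup>2) / (2 * of_int (c * M * P)))
     = (\<lambda>z. of_int (M * (v + c * z)\<^sup>2) / (2 * of_int (c * P)))"
  proof
    fix z
    have "(M * v + c * M * z)\<^sup>2 = M * (M * (v + c * z)\<^sup>2)" by (simp add: power2_eq_square algebra_simps)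
    moreover have "2 * real_of_int (c * M * P) = of_int M * (2 * of_int (c * P))" by simp
    ultimately show "real_of_int ((M * v + c * M * z)\<^sup>2) / (2 * of_int (c * M * P)) = of_int (M * (v + c * z)\<^sup>2) / (2 * of_int (c * P))"
      using MNPR_pos(1) by (simp only: of_int_mult[of M] mult_divide_mult_cancel_left_if of_int_eq_0_iff) simp
  qed
  finally show ?thesis .
qed

text \<open>Node 1 goes first, with \<open>x2\<close> as its linear term. At node 2 the weights
  \<open>- R / N\<close> and \<open>M / P\<close> then meet, and they add up to
  \<open>- 1 / (N * P)\<close> by \<open>P * R = M * N + 1\<close>. The last sum is thus the
  conjugate of \<open>gsum (c * (N * P))\<close>.\<close>

theorem gauss_sum_0:
  assumes c: "c > 0" "even c"
  shows "gauss_sum c 0 0 0 0 0 0 = \<i> * of_int c ^ 3"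
proof -
  define E3 where "E3 = (\<lambda>x. \<Sum>y=0..<M. e1 (of_int ((- w3 + - w4) * (x + c * y)\<^sup>2) / (2 * of_int (c * M))))"
  define E5 where "E5 = (\<lambda>x. \<Sum>y=0..<N. e1 (of_int ((- w5 + - w6) * (x + c * y)\<^sup>2) / (2 * of_int (c * N))))"
  define K3 where "K3 = of_real (of_int c / sqrt (of_int M)) * e1 (- 1 / 4)"
  define K5 where "K5 = of_real (of_int c / sqrt (of_int N)) * e1 (- 1 / 4)"
  have leaves3: "leaf_sum c w3 x * leaf_sum c w4 x = K3 * E3 x" for x
    using leaf_sum_pair[of "- w3" "- w4" c x] leaf_neg coprime_facts c
    by (simp add: K3_def E3_def M_def)
  have leaves5: "leaf_sum c w5 x * leaf_sum c w6 x = K5 * E5 x" for x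
    using leaf_sum_pair[of "- w5" "- w6" c x] leaf_neg coprime_facts c
    by (simp add: K5_def E5_def N_def)
  define f where "f = (\<lambda>X::int. e1 (of_int (- R * X\<^sup>2) / (2 * of_int (c * N))))"
  define g where "g = (\<lambda>X::int. e1 (of_int (M * X\<^sup>2) / (2 * of_int (c * P))))"
  have f: "e1 (of_int (w2 * x\<^sup>2) / (2 * of_int c)) * E5 x = (\<Sum>z=0..<N. f (x + c * z))" for x
    unfolding E5_def sum_distrib_left
  proof (rule sum.cong)
    fix y
    have w: "of_int w2 = (real_of_int (- R) - of_int (- w5 + - w6)) / of_int N"
      using leaf_neg by (simp add: R_def N_def field_simps)
    have "e1 (of_int (w2 * x\<^sup>2) / (2 * of_int c)) = e1 (of_int (w2 * (x + c * y)\<^sup>2) / (2 * of_int c))"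
      using e1_quadratic_periodic[of c w2 x y 0] c by simp
    moreover have "of_int (w2 * X\<^sup>2) / (2 * of_int c) + of_int ((- w5 + - w6) * X\<^sup>2) / (2 * of_int (c * N))
       = (of_int (- R * X\<^sup>2) / (2 * of_int (c * N)) :: real)" for X
      unfolding of_int_mult w using MNPR_pos c by (simp add: field_simps)
    ultimately show "e1 (of_int (w2 * x\<^sup>2) / (2 * of_int c)) * e1 (of_int ((- w5 + - w6) * (x + c * y)\<^sup>2) / (2 * of_int (c * N)))
      = f (x + c * y)" unfolding f_def by (simp only: e1_add[symmetric])
  qed simp
  have fg: "f X * g X = cnj (e1 (of_int (X\<^sup>2) / (2 * of_int (c * (N * P)))))" for X
  proof -
    have eq: "real_of_int P * of_int R = of_int M * of_int N + 1" using PR by (metis of_int_add of_int_mult of_int_1)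
    have "real_of_int P * (of_int R * (of_int X)\<^sup>2) = real_of_int P * of_int R * (of_int X)\<^sup>2"
      by (simp only: mult.assoc)
    also have "\<dots> = (of_int X)\<^sup>2 + real_of_int M * (real_of_int N * (real_of_int X)\<^sup>2)"
      unfolding eq by (simp add: algebra_simps)
    finally have PX: "real_of_int P * (of_int R * (of_int X)\<^sup>2) = (of_int X)\<^sup>2 + real_of_int M * (real_of_int N * (real_of_int X)\<^sup>2)" .
    have "real_of_int (- R * X\<^sup>2) / (2 * of_int (c * N)) + of_int (M * X\<^sup>2) / (2 * of_int (c * P))
      = of_int (- (X\<^sup>2)) / (2 * of_int (c * (N * P)))"
      using MNPR_pos c by (simp add: divide_simps) (simp add: algebra_simps, rule PX[symmetric])
    then show ?thesis unfolding f_def g_def e1_add[symmetric] cnj_e1 by simp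
  qed
  have "gauss_sum c 0 0 0 0 0 0 = (\<Sum>x1=0..<c. \<Sum>x2=0..<c. K3 * K5 * (e1 (of_int (w2 * x2\<^sup>2) / (2 * of_int c)) * E5 x2
     * (e1 (of_int (w1 * x1\<^sup>2) / (2 * of_int c) + of_int (x2 * x1) / of_int c) * E3 x1)))"
    unfolding gauss_sum_def
  proof (intro sum.cong refl)
    fix x1 x2
    have "e1 (of_int (w1 * x1\<^sup>2 + w2 * x2\<^sup>2 + 2 * x1 * x2) / (2 * of_int c) + of_int (x1 * 0 + x2 * 0) / of_int c)
       = e1 (of_int (w2 * x2\<^sup>2) / (2 * of_int c)) * e1 (of_int (w1 * x1\<^sup>2) / (2 * of_int c) + of_int (x2 * x1) / of_int c)"
      unfolding e1_add[symmetric] using c(1) by (intro arg_cong[of _ _ e1]) (simp add: field_simps)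
    moreover have "leaf_sum c w3 (x1 + 0) * leaf_sum c w4 (x1 + 0) * leaf_sum c w5 (x2 + 0) * leaf_sum c w6 (x2 + 0)
       = K3 * E3 x1 * (K5 * E5 x2)"
      unfolding leaves3[symmetric] leaves5[symmetric] by simp
    ultimately show "e1 (of_int (w1 * x1\<^sup>2 + w2 * x2\<^sup>2 + 2 * x1 * x2) / (2 * of_int c) + of_int (x1 * 0 + x2 * 0) / of_int c)
        * (leaf_sum c w3 (x1 + 0) * leaf_sum c w4 (x1 + 0) * leaf_sum c w5 (x2 + 0) * leaf_sum c w6 (x2 + 0))
      = K3 * K5 * (e1 (of_int (w2 * x2\<^sup>2) / (2 * of_int c)) * E5 x2
     * (e1 (of_int (w1 * x1\<^sup>2) / (2 * of_int c) + of_int (x2 * x1) / of_int c) * E3 x1))"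
      by (simp only: mult_ac)
  qed
  also have "\<dots> = K3 * K5 * (\<Sum>x2=0..<c. (e1 (of_int (w2 * x2\<^sup>2) / (2 * of_int c)) * E5 x2)
     * (\<Sum>x1=0..<c. e1 (of_int (w1 * x1\<^sup>2) / (2 * of_int c) + of_int (x2 * x1) / of_int c) * E3 x1))"
    by (subst sum.swap) (simp only: sum_distrib_left)
  also have "(\<lambda>x2. (\<Sum>x1=0..<c. e1 (of_int (w1 * x1\<^sup>2) / (2 * of_int c) + of_int (x2 * x1) / of_int c) * E3 x1))
     = (\<lambda>x2. of_real (sqrt (of_int (c * M) / of_int P)) * e1 (- 1 / 8) * (\<Sum>z=0..<P. g (x2 + c * z)))"
    unfolding E3_def side_sum[OF c] g_def ..
  also have "(\<Sum>x2=0..<c. (e1 (of_int (w2 * x2\<^sup>2) / (2 * of_int c)) * E5 x2)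
     * (of_real (sqrt (of_int (c * M) / of_int P)) * e1 (- 1 / 8) * (\<Sum>z=0..<P. g (x2 + c * z))))
    = of_real (sqrt (of_int (c * M) / of_int P)) * e1 (- 1 / 8) *
      (\<Sum>x2=0..<c. (\<Sum>z=0..<N. f (x2 + c * z)) * (\<Sum>z=0..<P. g (x2 + c * z)))"
    unfolding f sum_distrib_left by (intro sum.cong refl) (simp only: mult_ac)
  also have "(\<lambda>x. (\<Sum>z=0..<N. f (x + c * z)) * (\<Sum>z=0..<P. g (x + c * z)))
     = (\<lambda>x. \<Sum>z=0..<N * P. f (x + c * z) * g (x + c * z))"
  proof
    fix x
    show "(\<Sum>z=0..<N. f (x + c * z)) * (\<Sum>z=0..<P. g (x + c * z)) = (\<Sum>z=0..<N * P. f (x + c * z) * g (x + c * z))"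
    proof (rule pointwise_crt)
      show "f (X + c * N * y) = f X" for X y
        using e1_quadratic_periodic[of "c * N" "- R" X y 0] c MNPR_pos by (simp add: f_def)
      show "g (X + c * P * y) = g X" for X y
        using e1_quadratic_periodic[of "c * P" M X y 0] c MNPR_pos by (simp add: g_def)
    qed (use MNPR_pos coprime_facts in auto)
  qed
  also have "(\<Sum>x=0..<c. \<Sum>z=0..<N * P. f (x + c * z) * g (x + c * z)) = (\<Sum>X=0..<c * (N * P). f X * g X)"
    by (rule sum_int_split) (use c MNPR_pos in auto)
  also have "\<dots> = cnj (gsum (c * (N * P)))"
    unfolding fg gsum_def cnj_sum ..
  also have "gsum (c * (N * P)) = of_real (sqrt (of_int (c * (N * P)))) * e1 (1 / 8)"
    by (rule gsum_eq) (use c MNPR_pos in auto)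
  also have "cnj \<dots> = of_real (sqrt (of_int (c * (N * P)))) * e1 (- 1 / 8)"
    by (simp add: cnj_e1)
  also have "K3 * K5 * (of_real (sqrt (of_int (c * M) / of_int P)) * e1 (- 1 / 8) * (of_real (sqrt (of_int (c * (N * P)))) * e1 (- 1 / 8)))
     = of_real (of_int c / sqrt (of_int M) * (of_int c / sqrt (of_int N)) * (sqrt (of_int (c * M) / of_int P) * sqrt (of_int (c * (N * P)))))
       * (e1 (- 1 / 4) * e1 (- 1 / 4) * (e1 (- 1 / 8) * e1 (- 1 / 8)))"
    unfolding K3_def K5_def of_real_mult by (simp only: mult_ac)
  \<comment> \<open>Each of the six vertices contributes e(-1/8), corresponding to signature -6; in
    all e(-3/4) = e(1/4).\<close>
  also have "e1 (- 1 / 4) * e1 (- 1 / 4) * (e1 (- 1 / 8) * e1 (- 1 / 8)) = \<i>"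
  proof -
    have "e1 (- 1 / 4) * e1 (- 1 / 4) * (e1 (- 1 / 8) * e1 (- 1 / 8)) = e1 (1 / 4)"
      unfolding e1_add[symmetric] by (rule e1_eqI[where n = "- 1"]) simp
    then show ?thesis by (simp add: e1_def)
  qed
  also have "of_int c / sqrt (of_int M) * (of_int c / sqrt (of_int N)) * (sqrt (of_int (c * M) / of_int P) * sqrt (of_int (c * (N * P)))) = of_int c ^ 3"
  proof -
    define cc mm nn pp where "cc = real_of_int c" "mm = real_of_int M" "nn = real_of_int N" "pp = real_of_int P"
    have pos: "cc > 0" "mm > 0" "nn > 0" "pp > 0" using c MNPR_pos by (auto simp: cc_mm_nn_pp_def)
    have "sqrt (cc * mm / pp) * sqrt (cc * (nn * pp)) = sqrt (cc\<^sup>2 * (mm * nn))"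
      unfolding real_sqrt_mult[symmetric] using pos by (intro arg_cong[of _ _ sqrt]) (simp add: power2_eq_square)
    also have "\<dots> = cc * (sqrt mm * sqrt nn)" using pos by (simp add: real_sqrt_mult)
    finally have "cc / sqrt mm * (cc / sqrt nn) * (sqrt (cc * mm / pp) * sqrt (cc * (nn * pp))) = cc ^ 3"
      using pos by (simp add: power3_eq_cube)
    then show ?thesis by (simp add: cc_mm_nn_pp_def)
  qed
  finally show ?thesis by (simp add: mult.commute)
qed

end

section \<open>Contour integrals of the theta function\<close>

definition odd_vecs :: "(int ^ 6) set"
  where "odd_vecs = {l. \<forall>v. odd (l $ v)}"

definition size1 :: "int ^ 'n \<Rightarrow> nat"
  where "size1 l = nat (\<Sum>v\<in>UNIV. \<bar>l $ v\<bar>)"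

text \<open>Summability against every exponential \<open>R ^ size1 l\<close> survives multiplication
  by \<open>z powi (l $ v)\<close> for any nonzero \<open>z\<close>, so circles of every radius are
  admissible, and by bounded factors such as signs.\<close>

definition rapid :: "(int ^ 6 \<Rightarrow> complex) \<Rightarrow> bool"
  where "rapid a \<longleftrightarrow> (\<forall>R\<ge>1. (\<lambda>l. norm (a l) * R ^ size1 l) summable_on odd_vecs)"

lemma component_le_size1: "nat \<bar>l $ v\<bar> \<le> size1 l"
  unfolding size1_def by (intro nat_mono member_le_sum) auto

lemma rapid_summable:
  assumes "rapid a"
  shows "a summable_on odd_vecs" "(\<lambda>l. norm (a l)) summable_on odd_vecs"
proof -
  show "(\<lambda>l. norm (a l)) summable_on odd_vecs"
    using assms unfolding rapid_def by (auto dest: spec[of _ 1])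
  then show "a summable_on odd_vecs" by (rule abs_summable_summable)
qed

lemma rapid_bounded_mult:
  assumes "rapid a" "\<And>l. norm (b l) \<le> B"
  shows "rapid (\<lambda>l. a l * b l)"
  unfolding rapid_def
proof (intro allI impI)
  fix R :: real assume R: "R \<ge> 1"
  have "(\<lambda>l. norm (a l) * R ^ size1 l * B) summable_on odd_vecs"
    using assms(1) R unfolding rapid_def by (intro summable_on_cmult_left) auto
  then show "(\<lambda>l. norm (a l * b l) * R ^ size1 l) summable_on odd_vecs"
  proof (rule summable_on_comparison_test)
    fix l
    have "norm (a l * b l) * R ^ size1 l = norm (a l) * R ^ size1 l * norm (b l)" by (simp add: norm_mult mult_ac)
    also have "\<dots> \<le> norm (a l) * R ^ size1 l * B" using assms(2)[of l] R by (intro mult_left_mono) auto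
    finally show "norm (a l * b l) * R ^ size1 l \<le> norm (a l) * R ^ size1 l * B" .
  qed (use R in auto)
qed

lemma norm_powi_le:
  fixes z :: complex
  assumes "z \<noteq> 0" "norm z \<le> R" "inverse (norm z) \<le> R"
  shows "norm (z powi n) \<le> R ^ nat \<bar>n\<bar>"
proof (cases "n \<ge> 0")
  case True
  then show ?thesis using assms by (simp add: power_int_def norm_power power_mono)
next
  case False
  then show ?thesis using assms power_mono[OF assms(3), of "nat (- n)"]
    by (simp add: power_int_def norm_power norm_inverse power_inverse)
qed

lemma rapid_powi:
  assumes "rapid a" "z \<noteq> 0"
  shows "rapid (\<lambda>l. a l * z powi (l $ v))"
  unfolding rapid_def
proof (intro allI impI)
  fix R :: real assume R: "R \<ge> 1"
  define R0 where "R0 = max (norm z) (inverse (norm z))"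
  have R0: "R0 \<ge> 1"
  proof (cases "norm z \<ge> 1")
    case True then show ?thesis by (simp add: R0_def le_max_iff_disj)
  next
    case False
    then have "inverse (norm z) \<ge> 1" using assms(2) by (intro one_le_inverse) auto
    then show ?thesis by (simp add: R0_def le_max_iff_disj)
  qed
  have "(\<lambda>l. norm (a l) * (R0 * R) ^ size1 l) summable_on odd_vecs"
    using assms(1) mult_mono[of 1 R0 1 R] R R0 unfolding rapid_def by auto
  then show "(\<lambda>l. norm (a l * z powi (l $ v)) * R ^ size1 l) summable_on odd_vecs"
  proof (rule summable_on_comparison_test)
    fix l
    have "norm (z powi (l $ v)) \<le> R0 ^ nat \<bar>l $ v\<bar>"
      by (rule norm_powi_le[OF assms(2)]) (auto simp: R0_def)
    also have "\<dots> \<le> R0 ^ size1 l" using R0 by (intro power_increasing component_le_size1)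
    finally show "norm (a l * z powi (l $ v)) * R ^ size1 l \<le> norm (a l) * (R0 * R) ^ size1 l"
      using R by (simp add: norm_mult power_mult_distrib mult_mono mult.assoc)
  qed (use R in auto)
qed

text \<open>A finite set of vectors lies in a cube, over which the sum is a product of
  one-dimensional sums, each at most \<open>2 / (1 - q)\<close>.\<close>

lemma summable_geometric_size1:
  fixes q :: real
  assumes "0 \<le> q" "q < 1"
  shows "(\<lambda>l :: int ^ 'n. q ^ size1 l) summable_on A"
proof -
  define C where "C = 2 / (1 - q)"
  have "C \<ge> 0" using assms by (simp add: C_def)
  have one: "(\<Sum>n\<in>{- int K..int K}. q ^ nat \<bar>n\<bar>) \<le> C" for K
  proof -
    have "{- int K..int K} = {0..int K} \<union> {- int K..-1}" by auto
    then have "(\<Sum>n\<in>{- int K..int K}. q ^ nat \<bar>n\<bar>) \<le> (\<Sum>n\<in>{0..int K}. q ^ nat \<bar>n\<bar>) + (\<Sum>n\<in>{- int K..-1}. q ^ nat \<bar>n\<bar>)"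
      by (simp add: sum.union_disjoint)
    also have "(\<Sum>n\<in>{0..int K}. q ^ nat \<bar>n\<bar>) = (\<Sum>n\<le>K. q ^ n)"
      by (rule sum.reindex_bij_witness[of _ int nat]) auto
    also have "(\<Sum>n\<in>{- int K..-1}. q ^ nat \<bar>n\<bar>) = (\<Sum>n\<in>{1..K}. q ^ n)"
      by (rule sum.reindex_bij_witness[of _ "\<lambda>n. - int n" "\<lambda>n. nat (- n)"]) auto
    also have "(\<Sum>n\<in>{1..K}. q ^ n) \<le> (\<Sum>n\<le>K. q ^ n)" using assms by (intro sum_mono2) auto
    also have "(\<Sum>n\<le>K. q ^ n) \<le> 1 / (1 - q)"
      using sum_le_suminf[of "\<lambda>n. q ^ n" "{..K}"] assms by (simp add: suminf_geometric)
    finally show ?thesis by (simp add: C_def)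
  qed
  have prod: "q ^ size1 l = (\<Prod>v\<in>UNIV. q ^ nat \<bar>l $ v\<bar>)" for l :: "int ^ 'n"
  proof -
    have "int (\<Sum>v\<in>UNIV. nat \<bar>l $ v\<bar>) = (\<Sum>v\<in>UNIV. \<bar>l $ v\<bar>)" by simp
    then have "size1 l = (\<Sum>v\<in>UNIV. nat \<bar>l $ v\<bar>)" unfolding size1_def by (metis nat_int)
    then show ?thesis by (simp add: power_sum)
  qed
  have "(\<lambda>l :: int ^ 'n. q ^ size1 l) summable_on UNIV"
  proof (rule nonneg_bdd_above_summable_on)
    show "bdd_above (sum (\<lambda>l :: int ^ 'n. q ^ size1 l) ` {F. F \<subseteq> UNIV \<and> finite F})"
    proof (rule bdd_aboveI2)
      fix F :: "(int ^ 'n) set" assume "F \<in> {F. F \<subseteq> UNIV \<and> finite F}"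
      then have F: "finite F" by simp
      define K where "K = (\<Sum>l\<in>F. size1 l)"
      define B where "B = {l :: int ^ 'n. \<forall>v. l $ v \<in> {- int K..int K}}"
      have bij: "bij_betw vec_nth B (PiE (UNIV :: 'n set) (\<lambda>_. {- int K..int K}))"
        by (rule bij_betwI[where g = vec_lambda]) (auto simp: B_def)
      have finB: "finite B" using bij_betw_finite[OF bij] by (simp add: finite_PiE)
      have "F \<subseteq> B"
      proof
        fix l assume "l \<in> F"
        then have "size1 l \<le> K" unfolding K_def using F by (intro member_le_sum) auto
        then have "nat \<bar>l $ v\<bar> \<le> K" for v using component_le_size1[of l v] by linarith
        then have "\<bar>l $ v\<bar> \<le> int K" for v by (simp add: nat_le_iff)
        then show "l \<in> B" unfolding B_def by (auto simp: abs_le_iff) (metis minus_le_iff)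
      qed
      then have "(\<Sum>l\<in>F. q ^ size1 l) \<le> (\<Sum>l\<in>B. q ^ size1 l)"
        using finB assms by (intro sum_mono2) auto
      also have "\<dots> = (\<Sum>l\<in>B. \<Prod>v\<in>UNIV. q ^ nat \<bar>l $ v\<bar>)" by (simp only: prod)
      also have "\<dots> = (\<Sum>g\<in>PiE (UNIV :: 'n set) (\<lambda>_. {- int K..int K}). \<Prod>v\<in>UNIV. q ^ nat \<bar>g v\<bar>)"
        by (rule sum.reindex_bij_betw[OF bij])
      also have "\<dots> = (\<Prod>v\<in>(UNIV :: 'n set). \<Sum>n\<in>{- int K..int K}. q ^ nat \<bar>n\<bar>)"
        by (rule prod_sum_PiE[symmetric]) auto
      also have "\<dots> \<le> (\<Prod>v\<in>(UNIV :: 'n set). C)"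
        using assms by (intro prod_mono conjI one sum_nonneg) auto
      finally show "(\<Sum>l\<in>F. q ^ size1 l) \<le> C ^ CARD('n)" by simp
    qed
  qed (use assms in auto)
  then show ?thesis by (rule summable_on_subset_banach) simp
qed

lemma rapid_gaussian:
  assumes "c > 0" "\<And>l. norm (a l) \<le> exp (- c * real (size1 l) ^ 2)"
  shows "rapid a"
  unfolding rapid_def
proof (intro allI impI)
  fix R :: real assume R: "R \<ge> 1"
  \<comment> \<open>With this \<open>b\<close>, completing the square in the exponent absorbs
    \<open>R ^ N\<close> and leaves \<open>(1 / 2) ^ N\<close> to spare.\<close>
  define b where "b = ln (2 * R)"
  have key: "exp (- c * real N ^ 2) * R ^ N \<le> exp (b\<^sup>2 / (4 * c)) * (1 / 2) ^ N" for N
  proof -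
    have "0 \<le> (2 * c * real N - b)\<^sup>2 / (4 * c)" using assms by simp
    also have "\<dots> = c * real N ^ 2 - real N * b + b\<^sup>2 / (4 * c)"
      using assms by (simp add: field_simps power2_eq_square)
    finally have "- c * real N ^ 2 + real N * b \<le> b\<^sup>2 / (4 * c)" by simp
    then have "exp (- c * real N ^ 2) * exp (real N * b) \<le> exp (b\<^sup>2 / (4 * c))" unfolding exp_add[symmetric] by simp
    moreover have "exp (real N * b) = 2 ^ N * R ^ N" using R by (simp add: exp_of_nat_mult b_def power_mult_distrib)
    ultimately have "exp (- c * real N ^ 2) * R ^ N * 2 ^ N \<le> exp (b\<^sup>2 / (4 * c))" by (simp add: mult_ac)
    then show ?thesis by (simp add: power_divide field_simps)
  qed
  have "(\<lambda>l. exp (b\<^sup>2 / (4 * c)) * (1 / 2) ^ size1 l) summable_on odd_vecs"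
    by (intro summable_on_cmult_right summable_geometric_size1) auto
  then show "(\<lambda>l. norm (a l) * R ^ size1 l) summable_on odd_vecs"
  proof (rule summable_on_comparison_test)
    fix l
    have "norm (a l) * R ^ size1 l \<le> exp (- c * real (size1 l) ^ 2) * R ^ size1 l"
      using assms(2) R by (intro mult_right_mono) auto
    then show "norm (a l) * R ^ size1 l \<le> exp (b\<^sup>2 / (4 * c)) * (1 / 2) ^ size1 l"
      using key order_trans by blast
  qed (use R in auto)
qed

section \<open>Termwise integration over circles\<close>

lemma circle_integral_cong:
  assumes "r > 0" "\<And>z. norm z = r \<Longrightarrow> f z = g z"
  shows "circle_integral r f = circle_integral r g"
  unfolding circle_integral_def
  by (rule contour_integral_eq) (use assms in \<open>auto simp: path_image_circlepath_nonneg sphere_def dist_norm\<close>)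

text \<open>Rapid decay supplies a Weierstrass majorant on the circle. The second claim bounds the
  moments of \<open>h\<close> by \<open>r powi n\<close>; it later decides which constant vanishes
  in \<open>circle_integral_node\<close>.\<close>

lemma circle_integral_infsum:
  assumes r: "r > 0" and h: "continuous_on (sphere 0 r) h"
    and d: "rapid d"
  shows "circle_integral r (\<lambda>z. h z * (\<Sum>\<^sub>\<infinity>l\<in>odd_vecs. d l * z powi (l $ v)))
       = (\<Sum>\<^sub>\<infinity>l\<in>odd_vecs. d l * circle_integral r (\<lambda>z. h z * z powi (l $ v)))"
    and "\<exists>B. \<forall>n. norm (circle_integral r (\<lambda>z. h z * z powi n)) \<le> B * r powi n"
proof -
  define p where "p = (\<lambda>z::complex. 2 * of_real pi * \<i> * z)"
  have pim: "path_image (circlepath 0 r) = sphere 0 r" using r by (simp add: path_image_circlepath_nonneg)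
  have p: "continuous_on (sphere 0 r) p" "\<And>z. z \<in> sphere 0 r \<Longrightarrow> p z \<noteq> 0"
    using r by (auto simp: p_def intro!: continuous_intros)
  define H where "H = (\<lambda>z. h z / p z)"
  have Hc: "continuous_on (sphere 0 r) H" unfolding H_def by (intro continuous_intros h p) (use p in auto)
  then obtain B where B: "\<And>z. z \<in> sphere 0 r \<Longrightarrow> norm (H z) \<le> B" "B \<ge> 0"
    using compact_imp_bounded[OF compact_continuous_image[OF Hc compact_sphere]] unfolding bounded_pos by fastforce
  have zc: "continuous_on (sphere 0 r) (\<lambda>z::complex. z powi n)" for n
    using r by (intro continuous_intros) auto
  have term_int: "(\<lambda>z. c * (H z * z powi n)) contour_integrable_on circlepath 0 r" for n and c :: complex
    by (rule contour_integrable_continuous_circlepath) (unfold pim, intro continuous_intros Hc zc)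
  have Ci: "circle_integral r (\<lambda>z. h z * z powi n) = contour_integral (circlepath 0 r) (\<lambda>z. H z * z powi n)" for n
    unfolding circle_integral_def H_def p_def by (simp only: times_divide_eq_left)
  have nz: "norm (z powi n) = r powi n" if "z \<in> sphere 0 r" for z :: complex and n
    using that by (simp add: norm_power_int)
  show "\<exists>B. \<forall>n. norm (circle_integral r (\<lambda>z. h z * z powi n)) \<le> B * r powi n"
  proof (intro exI allI)
    fix n :: int
    have "norm (contour_integral (circlepath 0 r) (\<lambda>z. H z * z powi n)) \<le> (B * r powi n) * (2 * pi * r)"
    proof (rule has_contour_integral_bound_circlepath)
      show "((\<lambda>z. H z * z powi n) has_contour_integral contour_integral (circlepath 0 r) (\<lambda>z. H z * z powi n)) (circlepath 0 r)"
        using term_int[of 1 n] by (intro has_contour_integral_integral) simp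
      show "norm (H x * x powi n) \<le> B * r powi n" if "norm (x - 0) = r" for x
        using B(1)[of x] nz[of x n] that r by (simp add: norm_mult mult_right_mono)
    qed (use B r in auto)
    then show "norm (circle_integral r (\<lambda>z. h z * z powi n)) \<le> (B * (2 * pi * r)) * r powi n"
      unfolding Ci by (simp only: mult_ac)
  qed
  define f where "f = (\<lambda>l z. d l * (H z * z powi (l $ v)))"
  have dr: "rapid (\<lambda>l. d l * (of_real r) powi (l $ v))" using d r by (intro rapid_powi) auto
  have summ: "(\<lambda>l. norm (d l) * (B * r powi (l $ v))) summable_on odd_vecs"
    using summable_on_cmult_left[OF rapid_summable(2)[OF dr], of B] r
    by (simp add: norm_mult norm_power_int mult_ac)
  have ul: "uniform_limit (path_image (circlepath 0 r)) (\<lambda>X z. \<Sum>l\<in>X. f l z) (\<lambda>z. \<Sum>\<^sub>\<infinity>l\<in>odd_vecs. f l z) (finite_subsets_at_top odd_vecs)"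
    unfolding pim
  proof (rule Weierstrass_m_test_general[OF _ summ])
    fix l z assume "z \<in> sphere (0::complex) r"
    then show "norm (f l z) \<le> norm (d l) * (B * r powi (l $ v))"
      unfolding f_def norm_mult using B nz by (intro mult_left_mono mult_mono) auto
  qed
  have int: "(\<lambda>z. \<Sum>l\<in>X. f l z) contour_integrable_on circlepath 0 r" if "finite X" for X
    unfolding f_def using that by (intro contour_integrable_sum term_int)
  obtain D where D: "\<And>t. t \<in> {0..1} \<Longrightarrow> norm (vector_derivative (circlepath 0 r) (at t)) \<le> D"
  proof
    fix t :: real
    show "norm (vector_derivative (circlepath 0 r) (at t)) \<le> 2 * pi * r"
      using r by (simp add: vector_derivative_circlepath norm_mult)
  qed
  have "((\<lambda>X. contour_integral (circlepath 0 r) (\<lambda>z. \<Sum>l\<in>X. f l z)) \<longlongrightarrow> contour_integral (circlepath 0 r) (\<lambda>z. \<Sum>\<^sub>\<infinity>l\<in>odd_vecs. f l z)) (finite_subsets_at_top odd_vecs)"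
    by (rule contour_integral_uniform_limit(2)[OF _ ul D])
       (auto intro!: eventually_finite_subsets_at_top_weakI int)
  moreover have "eventually (\<lambda>X. contour_integral (circlepath 0 r) (\<lambda>z. \<Sum>l\<in>X. f l z) = (\<Sum>l\<in>X. d l * circle_integral r (\<lambda>z. h z * z powi (l $ v)))) (finite_subsets_at_top odd_vecs)"
  proof (rule eventually_finite_subsets_at_top_weakI)
    fix X :: "(int ^ 6) set" assume "finite X"
    then show "contour_integral (circlepath 0 r) (\<lambda>z. \<Sum>l\<in>X. f l z) = (\<Sum>l\<in>X. d l * circle_integral r (\<lambda>z. h z * z powi (l $ v)))"
      unfolding f_def Ci using term_int[of 1] term_int
      by (subst contour_integral_sum) (auto simp: contour_integral_lmul)
  qed
  ultimately have "((\<lambda>X. \<Sum>l\<in>X. d l * circle_integral r (\<lambda>z. h z * z powi (l $ v))) \<longlongrightarrow> contour_integral (circlepath 0 r) (\<lambda>z. \<Sum>\<^sub>\<infinity>l\<in>odd_vecs. f l z)) (finite_subsets_at_top odd_vecs)"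
    by (rule Lim_transform_eventually)
  then have "((\<lambda>l. d l * circle_integral r (\<lambda>z. h z * z powi (l $ v))) has_sum contour_integral (circlepath 0 r) (\<lambda>z. \<Sum>\<^sub>\<infinity>l\<in>odd_vecs. f l z)) odd_vecs"
    unfolding has_sum_def .
  then have "(\<Sum>\<^sub>\<infinity>l\<in>odd_vecs. d l * circle_integral r (\<lambda>z. h z * z powi (l $ v))) = contour_integral (circlepath 0 r) (\<lambda>z. \<Sum>\<^sub>\<infinity>l\<in>odd_vecs. f l z)"
    by (rule infsumI)
  also have "(\<lambda>z. \<Sum>\<^sub>\<infinity>l\<in>odd_vecs. f l z) = (\<lambda>z. h z * (\<Sum>\<^sub>\<infinity>l\<in>odd_vecs. d l * z powi (l $ v)) / (2 * of_real pi * \<i> * z))"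
  proof
    fix z
    have "(\<Sum>\<^sub>\<infinity>l\<in>odd_vecs. f l z) = (\<Sum>\<^sub>\<infinity>l\<in>odd_vecs. H z * (d l * z powi (l $ v)))"
      unfolding f_def by (simp only: mult_ac)
    also have "\<dots> = H z * (\<Sum>\<^sub>\<infinity>l\<in>odd_vecs. d l * z powi (l $ v))" by (rule infsum_cmult_right')
    finally show "(\<Sum>\<^sub>\<infinity>l\<in>odd_vecs. f l z) = h z * (\<Sum>\<^sub>\<infinity>l\<in>odd_vecs. d l * z powi (l $ v)) / (2 * of_real pi * \<i> * z)"
      by (simp add: H_def p_def)
  qed
  finally show "circle_integral r (\<lambda>z. h z * (\<Sum>\<^sub>\<infinity>l\<in>odd_vecs. d l * z powi (l $ v)))
       = (\<Sum>\<^sub>\<infinity>l\<in>odd_vecs. d l * circle_integral r (\<lambda>z. h z * z powi (l $ v)))"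
    unfolding circle_integral_def by simp
qed

section \<open>Coordinates and the elementary contour integrals\<close>

lemma UNIV_6: "(UNIV :: 6 set) = {1, 2, 3, 4, 5, 6}"
proof -
  have d: "distinct [1, 2, 3, 4, 5, 6 :: 6]" by simp
  have "card {1, 2, 3, 4, 5, 6 :: 6} = 6" using distinct_card[OF d] by simp
  then show ?thesis by (intro card_subset_eq[symmetric]) auto
qed

lemma prod_6: "(\<Prod>v\<in>(UNIV :: 6 set). f v) = f 1 * f 2 * f 3 * f 4 * f 5 * f 6"
  unfolding UNIV_6 by (simp add: mult.assoc)

lemma sum_6: "(\<Sum>v\<in>(UNIV :: 6 set). f v) = f 1 + f 2 + f 3 + f 4 + f 5 + f 6"
  unfolding UNIV_6 by (simp add: add.assoc)

lemma all_6: "(\<forall>v :: 6. P v) \<longleftrightarrow> P 1 \<and> P 2 \<and> P 3 \<and> P 4 \<and> P 5 \<and> P 6"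
proof -
  have "(\<forall>v :: 6. P v) \<longleftrightarrow> (\<forall>v\<in>UNIV. P v)" by simp
  then show ?thesis unfolding UNIV_6 by simp
qed

lemma vector_6:
  fixes a b c d e f :: "'a::zero"
  shows "(vector [a, b, c, d, e, f] :: 'a ^ 6) $ 1 = a" "(vector [a, b, c, d, e, f] :: 'a ^ 6) $ 2 = b"
    "(vector [a, b, c, d, e, f] :: 'a ^ 6) $ 3 = c" "(vector [a, b, c, d, e, f] :: 'a ^ 6) $ 4 = d"
    "(vector [a, b, c, d, e, f] :: 'a ^ 6) $ 5 = e" "(vector [a, b, c, d, e, f] :: 'a ^ 6) $ 6 = f"
  unfolding vector_def by simp_all

lemma circle_integral_diff:
  assumes "r > 0" "continuous_on (sphere 0 r) f" "continuous_on (sphere 0 r) g"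
  shows "circle_integral r (\<lambda>z. f z - g z) = circle_integral r f - circle_integral r g"
proof -
  have int: "(\<lambda>z. f z / (2 * of_real pi * \<i> * z)) contour_integrable_on circlepath 0 r" if "continuous_on (sphere 0 r) f" for f
    using assms(1) that
    by (intro contour_integrable_continuous_circlepath continuous_intros) (auto simp: path_image_circlepath_nonneg)
  show ?thesis
    unfolding circle_integral_def diff_divide_distrib by (intro contour_integral_diff int assms)
qed

lemma circle_integral_powi:
  assumes "r > 0"
  shows "circle_integral r (\<lambda>z. z powi n) = (if n = 0 then 1 else 0)"
proof (cases "n = 0")
  case True
  have "circle_integral r (\<lambda>z. z powi n) = contour_integral (circlepath 0 r) (\<lambda>z. 1 / (2 * of_real pi * \<i>) * (1 / (z - 0)))"
    unfolding circle_integral_def by (simp add: True)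
  also have "\<dots> = 1 / (2 * of_real pi * \<i>) * contour_integral (circlepath 0 r) (\<lambda>z. 1 / (z - 0))"
    using assms by (intro contour_integral_lmul contour_integrable_continuous_circlepath continuous_intros) (auto simp: path_image_circlepath_nonneg)
  also have "\<dots> = 1" unfolding contour_integral_circlepath[OF assms] by simp
  finally show ?thesis by (simp add: True)
next
  case False
  have "((\<lambda>z. z powi n / (2 * of_real pi * \<i> * z)) has_contour_integral 0) (circlepath 0 r)"
  proof (rule Cauchy_theorem_primitive[where S = "- {0}" and f = "\<lambda>z. z powi n / (2 * of_real pi * \<i> * of_int n)"])
    fix z :: complex assume "z \<in> - {0}"
    then have z: "z \<noteq> 0" by simp
    have "((\<lambda>z. z powi n) has_field_derivative of_int n * z powi (n - 1)) (at z within - {0})"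
      using z by (auto intro!: derivative_eq_intros)
    then have "((\<lambda>z. z powi n / (2 * of_real pi * \<i> * of_int n)) has_field_derivative (of_int n * z powi (n - 1)) / (2 * of_real pi * \<i> * of_int n)) (at z within - {0})"
      by (rule DERIV_cdivide)
    also have "(of_int n * z powi (n - 1)) / (2 * of_real pi * \<i> * of_int n) = z powi n / (2 * of_real pi * \<i> * z)"
      using z False by (simp add: power_int_diff)
    finally show "((\<lambda>z. z powi n / (2 * of_real pi * \<i> * of_int n)) has_field_derivative z powi n / (2 * of_real pi * \<i> * z)) (at z within - {0})" .
  qed (use assms in \<open>auto simp: path_image_circlepath_nonneg\<close>)
  then show ?thesis unfolding circle_integral_def using False by (simp add: contour_integral_unique)
qed

definition leaf_coeff :: "int \<Rightarrow> complex"
  where "leaf_coeff n = (if n = - 1 then 1 else if n = 1 then - 1 else 0)"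

lemma circle_integral_leaf: "circle_integral 1 (\<lambda>z. (z - 1 / z) * z powi n) = leaf_coeff n"
proof -
  have "circle_integral 1 (\<lambda>z. (z - 1 / z) * z powi n) = circle_integral 1 (\<lambda>z. z powi (n + 1) - z powi (n - 1))"
  proof (rule circle_integral_cong)
    fix z :: complex assume "norm z = 1"
    then have "z \<noteq> 0" by auto
    then show "(z - 1 / z) * z powi n = z powi (n + 1) - z powi (n - 1)"
      by (simp add: power_int_add power_int_diff algebra_simps)
  qed simp
  also have "\<dots> = circle_integral 1 (\<lambda>z. z powi (n + 1)) - circle_integral 1 (\<lambda>z. z powi (n - 1))"
    by (intro circle_integral_diff continuous_intros) auto
  also have "\<dots> = leaf_coeff n" by (simp add: circle_integral_powi leaf_coeff_def)
  finally show ?thesis .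
qed

lemma node_continuous:
  assumes "r > 0" "r \<noteq> 1"
  shows "continuous_on (sphere (0::complex) r) (\<lambda>z. 1 / (z - 1 / z))"
proof -
  have "z - 1 / z \<noteq> 0" if "z \<in> sphere (0::complex) r" for z
  proof
    assume "z - 1 / z = 0"
    then have "z * z = 1" using that assms by (auto simp: field_simps)
    then have "norm z * norm z = 1" by (metis norm_mult norm_one)
    then show False using that assms by (auto simp: square_eq_1_iff)
  qed
  then show ?thesis using assms by (intro continuous_intros) auto
qed

text \<open>The integrals \<open>J n\<close> satisfy \<open>J (n + 1) = J (n - 1)\<close> for \<open>n \<noteq> 0\<close>; the bound by \<open>r powi n\<close> forces one of
  the two constants to vanish.\<close>

lemma circle_integral_node:
  assumes r: "r > 0" "r \<noteq> 1" and n: "odd n"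
  shows "circle_integral r (\<lambda>z. 1 / (z - 1 / z) * z powi n) = (if r > 1 then (if n > 0 then 1 else 0) else (if n > 0 then 0 else - 1))"
proof -
  define J where "J = (\<lambda>n. circle_integral r (\<lambda>z. 1 / (z - 1 / z) * z powi n))"
  have c: "continuous_on (sphere (0::complex) r) (\<lambda>z. 1 / (z - 1 / z) * z powi n)" for n
    using r by (intro continuous_on_mult node_continuous continuous_intros) auto
  \<comment> \<open>The zero family serves as coefficients, since only the bound on the moments is
    wanted.\<close>
  have rapid0: "rapid (\<lambda>_. 0)" unfolding rapid_def by simp
  obtain B where B: "\<And>n. norm (J n) \<le> B * r powi n"
    using circle_integral_infsum(2)[OF r(1) node_continuous[OF r] rapid0] unfolding J_def by blast
  have rec: "J (n + 1) = J (n - 1) + (if n = 0 then 1 else 0)" for n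
  proof -
    have "J (n + 1) - J (n - 1) = circle_integral r (\<lambda>z. 1 / (z - 1 / z) * z powi (n + 1) - 1 / (z - 1 / z) * z powi (n - 1))"
      unfolding J_def by (intro circle_integral_diff[symmetric] c r)
    also have "\<dots> = circle_integral r (\<lambda>z. z powi n)"
    proof (rule circle_integral_cong[OF r(1)])
      fix z :: complex assume z: "norm z = r"
      then have z0: "z \<noteq> 0" using r by auto
      have "norm (z * z) \<noteq> 1" using z r by (auto simp: norm_mult square_eq_1_iff)
      then have ne: "z * z - 1 \<noteq> 0" by auto
      have "1 / (z - 1 / z) * z powi (n + 1) - 1 / (z - 1 / z) * z powi (n - 1) = 1 / (z - 1 / z) * (z powi n * (z - 1 / z))"
        using z0 by (simp add: power_int_add power_int_diff algebra_simps)
      also have "\<dots> = z powi n" using z0 ne by (auto simp: field_simps)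
      finally show "1 / (z - 1 / z) * z powi (n + 1) - 1 / (z - 1 / z) * z powi (n - 1) = z powi n" .
    qed
    finally show ?thesis using circle_integral_powi[OF r(1), of n] by (simp add: algebra_simps)
  qed
  have pos: "J (2 * int m + 1) = J 1" for m
  proof (induction m)
    case (Suc m)
    then show ?case using rec[of "2 * int m + 2"] by (simp add: algebra_simps)
  qed simp
  have neg: "J (- (2 * int m + 1)) = J (- 1)" for m
  proof (induction m)
    case (Suc m)
    then show ?case using rec[of "- (2 * int m + 2)"] by (simp add: algebra_simps)
  qed simp
  have one: "J 1 = J (- 1) + 1" using rec[of 0] by simp
  have zero: "x = 0" if "\<And>m::nat. norm x \<le> B * q ^ (2 * m + 1)" "0 < q" "q < 1" for x :: complex and q :: real
  proof -
    have "norm (q\<^sup>2) < 1" using that by (simp add: power_less_one_iff)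
    then have "(\<lambda>m. B * (q * (q\<^sup>2) ^ m)) \<longlonglongrightarrow> B * (q * 0)"
      by (intro tendsto_mult tendsto_const LIMSEQ_power_zero)
    then have "(\<lambda>m. B * q ^ (2 * m + 1)) \<longlonglongrightarrow> B * 0" by (simp add: power_mult)
    then have "norm x \<le> B * 0" by (rule tendsto_lowerbound) (use that in auto)
    then show ?thesis by simp
  qed
  have J: "J n = (if n > 0 then J 1 else J (- 1))"
  proof (cases "n > 0")
    case True
    then have "n = 2 * int (nat (n div 2)) + 1"
      using odd_two_times_div_two_succ[OF n] pos_imp_zdiv_nonneg_iff[of 2 n] by simp
    then show ?thesis using pos[of "nat (n div 2)"] True by simp
  next
    case False
    then have "n = - (2 * int (nat ((- n) div 2)) + 1)"
      using odd_two_times_div_two_succ[of "- n"] n pos_imp_zdiv_nonneg_iff[of 2 "- n"] by simp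
    then show ?thesis using neg[of "nat ((- n) div 2)"] False by simp
  qed
  show ?thesis
  proof (cases "r > 1")
    case True
    have "J (- 1) = 0"
    proof (rule zero[where q = "inverse r"])
      fix m :: nat
      have "r powi - (2 * int m + 1) = inverse r ^ (2 * m + 1)"
        unfolding power_int_minus using power_int_of_nat[of r "2 * m + 1"] by (simp add: power_inverse add.commute)
      then show "norm (J (- 1)) \<le> B * inverse r ^ (2 * m + 1)"
        using B[of "- (2 * int m + 1)"] unfolding neg by simp
    qed (use True in \<open>auto simp: inverse_less_1_iff\<close>)
    then show ?thesis using J one True unfolding J_def by simp
  next
    case False
    have "J 1 = 0"
    proof (rule zero[where q = r])
      fix m :: nat
      have "r powi (2 * int m + 1) = r ^ (2 * m + 1)"
        using power_int_of_nat[of r "2 * m + 1"] by (simp add: add.commute)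
      then show "norm (J 1) \<le> B * r ^ (2 * m + 1)" using B[of "2 * int m + 1"] unfolding pos by simp
    qed (use False r in auto)
    moreover have "J (- 1) = J 1 - 1" using one by simp
    ultimately have "J (- 1) = - 1" by simp
    then show ?thesis using J \<open>J 1 = 0\<close> False unfolding J_def by simp
  qed
qed

lemma circle_integral_leaf_series:
  assumes "rapid d" "\<And>z. norm z = 1 \<Longrightarrow> G z = (z - 1 / z) * (\<Sum>\<^sub>\<infinity>l\<in>odd_vecs. d l * z powi (l $ v))"
  shows "circle_integral 1 G = (\<Sum>\<^sub>\<infinity>l\<in>odd_vecs. d l * leaf_coeff (l $ v))"
proof -
  have "circle_integral 1 G = circle_integral 1 (\<lambda>z. (z - 1 / z) * (\<Sum>\<^sub>\<infinity>l\<in>odd_vecs. d l * z powi (l $ v)))"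
    by (rule circle_integral_cong) (use assms in auto)
  also have "\<dots> = (\<Sum>\<^sub>\<infinity>l\<in>odd_vecs. d l * circle_integral 1 (\<lambda>z. (z - 1 / z) * z powi (l $ v)))"
    by (intro circle_integral_infsum(1) continuous_intros assms) auto
  finally show ?thesis unfolding circle_integral_leaf .
qed

text \<open>A circle outside the unit circle selects the positive exponents, one inside selects the
  negative ones with a minus sign. The average is sgn / 2 for every \<epsilon> in
  \<open>{0<..<1}\<close>, so the limit is that of a constant.\<close>

lemma pv_circle_integral_node_series:
  assumes "rapid d" "\<And>z. z \<noteq> 0 \<Longrightarrow> norm z \<noteq> 1 \<Longrightarrow> G z = 1 / (z - 1 / z) * (\<Sum>\<^sub>\<infinity>l\<in>odd_vecs. d l * z powi (l $ v))"
  shows "pv_circle_integral G = (\<Sum>\<^sub>\<infinity>l\<in>odd_vecs. d l * (of_int (sgn (l $ v)) / 2))"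
proof -
  have ci: "circle_integral r G = (\<Sum>\<^sub>\<infinity>l\<in>odd_vecs. d l * (if r > 1 then (if l $ v > 0 then 1 else 0) else (if l $ v > 0 then 0 else - 1)))"
    if r: "r > 0" "r \<noteq> 1" for r
  proof -
    have "circle_integral r G = circle_integral r (\<lambda>z. 1 / (z - 1 / z) * (\<Sum>\<^sub>\<infinity>l\<in>odd_vecs. d l * z powi (l $ v)))"
    proof (rule circle_integral_cong[OF r(1)])
      fix z :: complex assume "norm z = r"
      then show "G z = 1 / (z - 1 / z) * (\<Sum>\<^sub>\<infinity>l\<in>odd_vecs. d l * z powi (l $ v))" using r by (intro assms(2)) auto
    qed
    also have "\<dots> = (\<Sum>\<^sub>\<infinity>l\<in>odd_vecs. d l * circle_integral r (\<lambda>z. 1 / (z - 1 / z) * z powi (l $ v)))"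
      by (intro circle_integral_infsum(1) node_continuous r assms)
    also have "\<dots> = (\<Sum>\<^sub>\<infinity>l\<in>odd_vecs. d l * (if r > 1 then (if l $ v > 0 then 1 else 0) else (if l $ v > 0 then 0 else - 1)))"
      by (rule infsum_cong) (use circle_integral_node[OF r] in \<open>auto simp: odd_vecs_def\<close>)
    finally show ?thesis .
  qed
  have const: "(circle_integral (1 + \<epsilon>) G + circle_integral (1 - \<epsilon>) G) / 2 = (\<Sum>\<^sub>\<infinity>l\<in>odd_vecs. d l * (of_int (sgn (l $ v)) / 2))"
    if "\<epsilon> \<in> {0<..<1}" for \<epsilon>
  proof -
    define f1 f2 where "f1 = (\<lambda>l. d l * (if l $ v > 0 then 1 else 0))" and "f2 = (\<lambda>l. d l * (if l $ v > 0 then 0 else - 1))"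
    have s: "f1 summable_on odd_vecs" "f2 summable_on odd_vecs"
      unfolding f1_def f2_def by (rule rapid_summable(1)[OF rapid_bounded_mult[OF assms(1), of _ 1]], simp)+
    have "circle_integral (1 + \<epsilon>) G + circle_integral (1 - \<epsilon>) G = infsum f1 odd_vecs + infsum f2 odd_vecs"
      using that ci[of "1 + \<epsilon>"] ci[of "1 - \<epsilon>"] by (simp add: f1_def f2_def)
    also have "\<dots> = (\<Sum>\<^sub>\<infinity>l\<in>odd_vecs. f1 l + f2 l)" by (rule infsum_add[OF s, symmetric])
    also have "\<dots> = (\<Sum>\<^sub>\<infinity>l\<in>odd_vecs. d l * (of_int (sgn (l $ v)) / 2) * 2)"
    proof (rule infsum_cong)
      fix l assume "l \<in> odd_vecs"
      then have "odd (l $ v)" by (simp add: odd_vecs_def)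
      then have "l $ v \<noteq> 0" by auto
      then show "f1 l + f2 l = d l * (of_int (sgn (l $ v)) / 2) * 2" by (simp add: f1_def f2_def sgn_if)
    qed
    also have "\<dots> = (\<Sum>\<^sub>\<infinity>l\<in>odd_vecs. d l * (of_int (sgn (l $ v)) / 2)) * 2" by (rule infsum_cmult_left')
    finally show ?thesis by simp
  qed
  have "((\<lambda>\<epsilon>. (circle_integral (1 + \<epsilon>) G + circle_integral (1 - \<epsilon>) G) / 2) \<longlongrightarrow> (\<Sum>\<^sub>\<infinity>l\<in>odd_vecs. d l * (of_int (sgn (l $ v)) / 2))) (at_right 0)"
    by (rule Lim_transform_eventually[OF tendsto_const]) (use const in \<open>auto intro!: eventually_at_rightI[of 0 1]\<close>)
  then show ?thesis unfolding pv_circle_integral_def by (intro tendsto_Lim) auto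
qed

section \<open>The block as a lattice series\<close>

definition theta_coeff :: "int ^ 6 \<Rightarrow> complex \<Rightarrow> int ^ 6 \<Rightarrow> complex"
  where "theta_coeff w \<tau> l = ee (- of_real (((\<chi> v. of_int (l $ v)) :: real ^ 6) \<bullet> (matrix_inv (linking_matrix w) *v (\<chi> v. of_int (l $ v)))) / 4 * \<tau>)"

text \<open>The integrals are carried out from the innermost outwards. Before each one, the factors
  in the remaining variables are moved into the coefficients, which stay
  \<open>rapid\<close>.\<close>

theorem homological_block_series:
  assumes rapid: "rapid (theta_coeff w \<tau>)"
  shows "homological_block w \<tau> = ee (of_int (- 18 - (\<Sum>v\<in>UNIV. w $ v)) / 4 * \<tau>) *
    (\<Sum>\<^sub>\<infinity>l\<in>odd_vecs. theta_coeff w \<tau> l * leaf_coeff (l $ 6) * leaf_coeff (l $ 5) * leaf_coeff (l $ 4) * leaf_coeff (l $ 3)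
       * (of_int (sgn (l $ 2)) / 2) * (of_int (sgn (l $ 1)) / 2))"
proof -
  define a where "a = theta_coeff w \<tau>"
  have lb: "norm (leaf_coeff n) \<le> 1" for n by (simp add: leaf_coeff_def)
  have sb: "norm (of_int (sgn n) / 2 :: complex) \<le> 1" for n by (simp add: sgn_if norm_divide)
  note rapid_mult = rapid_bounded_mult[where B = 1, OF _ lb] rapid_bounded_mult[where B = 1, OF _ sb]
  have rapid_const: "rapid (\<lambda>l. d l * c)" if "rapid d" for d c
    by (rule rapid_bounded_mult[OF that, of _ "norm c"]) simp
  have nz1: "z \<noteq> 0" if "norm z = 1" for z :: complex using that by auto
  have block: "block_integrand w \<tau> (vector [z1, z2, z3, z4, z5, z6]) =
     (z3 - 1 / z3) * (z4 - 1 / z4) * (z5 - 1 / z5) * (z6 - 1 / z6) * (1 / (z1 - 1 / z1) * (1 / (z2 - 1 / z2))) *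
     (\<Sum>\<^sub>\<infinity>l\<in>odd_vecs. a l * z1 powi (l $ 1) * z2 powi (l $ 2) * z3 powi (l $ 3) * z4 powi (l $ 4) * z5 powi (l $ 5) * z6 powi (l $ 6))"
    for z1 z2 z3 z4 z5 z6
  proof -
    have "(\<Prod>v\<in>{3, 4, 5, 6 :: 6}. f v) = f 3 * f 4 * f 5 * f 6" for f :: "6 \<Rightarrow> complex" by (simp add: mult.assoc)
    then show ?thesis
      unfolding block_integrand_def theta_def a_def theta_coeff_def Let_def odd_vecs_def prod_6
      by (simp add: mult.assoc vector_6)
  qed
  have i6: "circle_integral 1 (\<lambda>z6. block_integrand w \<tau> (vector [z1, z2, z3, z4, z5, z6])) =
     (z3 - 1 / z3) * (z4 - 1 / z4) * (z5 - 1 / z5) * (1 / (z1 - 1 / z1) * (1 / (z2 - 1 / z2))) *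
     (\<Sum>\<^sub>\<infinity>l\<in>odd_vecs. a l * leaf_coeff (l $ 6) * z1 powi (l $ 1) * z2 powi (l $ 2) * z3 powi (l $ 3) * z4 powi (l $ 4) * z5 powi (l $ 5))"
    (is "_ = ?P * _")
    if nz: "z1 \<noteq> 0" "z2 \<noteq> 0" "z3 \<noteq> 0" "z4 \<noteq> 0" "z5 \<noteq> 0" for z1 z2 z3 z4 z5
  proof -
    let ?d = "\<lambda>l. a l * z1 powi (l $ 1) * z2 powi (l $ 2) * z3 powi (l $ 3) * z4 powi (l $ 4) * z5 powi (l $ 5) * ?P"
    have "circle_integral 1 (\<lambda>z6. block_integrand w \<tau> (vector [z1, z2, z3, z4, z5, z6])) = (\<Sum>\<^sub>\<infinity>l\<in>odd_vecs. ?d l * leaf_coeff (l $ 6))"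
    proof (rule circle_integral_leaf_series)
      show "rapid ?d" using nz rapid unfolding a_def by (intro rapid_const rapid_powi)
      show "block_integrand w \<tau> (vector [z1, z2, z3, z4, z5, z]) = (z - 1 / z) * (\<Sum>\<^sub>\<infinity>l\<in>odd_vecs. ?d l * z powi (l $ 6))" for z
        unfolding block infsum_cmult_right'[symmetric] by (simp only: mult_ac)
    qed
    also have "\<dots> = ?P * (\<Sum>\<^sub>\<infinity>l\<in>odd_vecs. a l * leaf_coeff (l $ 6) * z1 powi (l $ 1) * z2 powi (l $ 2) * z3 powi (l $ 3) * z4 powi (l $ 4) * z5 powi (l $ 5))"
      unfolding infsum_cmult_right'[symmetric] by (simp only: mult_ac)
    finally show ?thesis .
  qed
  have i5: "circle_integral 1 (\<lambda>z5. circle_integral 1 (\<lambda>z6. block_integrand w \<tau> (vector [z1, z2, z3, z4, z5, z6]))) =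
     (z3 - 1 / z3) * (z4 - 1 / z4) * (1 / (z1 - 1 / z1) * (1 / (z2 - 1 / z2))) *
     (\<Sum>\<^sub>\<infinity>l\<in>odd_vecs. a l * leaf_coeff (l $ 6) * leaf_coeff (l $ 5) * z1 powi (l $ 1) * z2 powi (l $ 2) * z3 powi (l $ 3) * z4 powi (l $ 4))"
    (is "_ = ?P * _")
    if nz: "z1 \<noteq> 0" "z2 \<noteq> 0" "z3 \<noteq> 0" "z4 \<noteq> 0" for z1 z2 z3 z4
  proof -
    let ?d = "\<lambda>l. a l * leaf_coeff (l $ 6) * z1 powi (l $ 1) * z2 powi (l $ 2) * z3 powi (l $ 3) * z4 powi (l $ 4) * ?P"
    have "circle_integral 1 (\<lambda>z5. circle_integral 1 (\<lambda>z6. block_integrand w \<tau> (vector [z1, z2, z3, z4, z5, z6]))) = (\<Sum>\<^sub>\<infinity>l\<in>odd_vecs. ?d l * leaf_coeff (l $ 5))"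
    proof (rule circle_integral_leaf_series)
      show "rapid ?d" using nz rapid unfolding a_def by (intro rapid_const rapid_powi rapid_mult)
      show "circle_integral 1 (\<lambda>z6. block_integrand w \<tau> (vector [z1, z2, z3, z4, z, z6])) = (z - 1 / z) * (\<Sum>\<^sub>\<infinity>l\<in>odd_vecs. ?d l * z powi (l $ 5))"
        if "norm z = 1" for z
        unfolding i6[OF nz(1-4) \<open>norm z = 1\<close>[THEN nz1]] infsum_cmult_right'[symmetric] by (simp only: mult_ac)
    qed
    also have "\<dots> = ?P * (\<Sum>\<^sub>\<infinity>l\<in>odd_vecs. a l * leaf_coeff (l $ 6) * leaf_coeff (l $ 5) * z1 powi (l $ 1) * z2 powi (l $ 2) * z3 powi (l $ 3) * z4 powi (l $ 4))"
      unfolding infsum_cmult_right'[symmetric] by (simp only: mult_ac)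
    finally show ?thesis .
  qed
  have i4: "circle_integral 1 (\<lambda>z4. circle_integral 1 (\<lambda>z5. circle_integral 1 (\<lambda>z6. block_integrand w \<tau> (vector [z1, z2, z3, z4, z5, z6])))) =
     (z3 - 1 / z3) * (1 / (z1 - 1 / z1) * (1 / (z2 - 1 / z2))) *
     (\<Sum>\<^sub>\<infinity>l\<in>odd_vecs. a l * leaf_coeff (l $ 6) * leaf_coeff (l $ 5) * leaf_coeff (l $ 4) * z1 powi (l $ 1) * z2 powi (l $ 2) * z3 powi (l $ 3))"
    (is "_ = ?P * _")
    if nz: "z1 \<noteq> 0" "z2 \<noteq> 0" "z3 \<noteq> 0" for z1 z2 z3
  proof -
    let ?d = "\<lambda>l. a l * leaf_coeff (l $ 6) * leaf_coeff (l $ 5) * z1 powi (l $ 1) * z2 powi (l $ 2) * z3 powi (l $ 3) * ?P"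
    have "circle_integral 1 (\<lambda>z4. circle_integral 1 (\<lambda>z5. circle_integral 1 (\<lambda>z6. block_integrand w \<tau> (vector [z1, z2, z3, z4, z5, z6])))) = (\<Sum>\<^sub>\<infinity>l\<in>odd_vecs. ?d l * leaf_coeff (l $ 4))"
    proof (rule circle_integral_leaf_series)
      show "rapid ?d" using nz rapid unfolding a_def by (intro rapid_const rapid_powi rapid_mult)
      show "circle_integral 1 (\<lambda>z5. circle_integral 1 (\<lambda>z6. block_integrand w \<tau> (vector [z1, z2, z3, z, z5, z6]))) = (z - 1 / z) * (\<Sum>\<^sub>\<infinity>l\<in>odd_vecs. ?d l * z powi (l $ 4))"
        if "norm z = 1" for z
        unfolding i5[OF nz(1-3) \<open>norm z = 1\<close>[THEN nz1]] infsum_cmult_right'[symmetric] by (simp only: mult_ac)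
    qed
    also have "\<dots> = ?P * (\<Sum>\<^sub>\<infinity>l\<in>odd_vecs. a l * leaf_coeff (l $ 6) * leaf_coeff (l $ 5) * leaf_coeff (l $ 4) * z1 powi (l $ 1) * z2 powi (l $ 2) * z3 powi (l $ 3))"
      unfolding infsum_cmult_right'[symmetric] by (simp only: mult_ac)
    finally show ?thesis .
  qed
  have i3: "circle_integral 1 (\<lambda>z3. circle_integral 1 (\<lambda>z4. circle_integral 1 (\<lambda>z5. circle_integral 1 (\<lambda>z6. block_integrand w \<tau> (vector [z1, z2, z3, z4, z5, z6]))))) =
     (1 / (z1 - 1 / z1) * (1 / (z2 - 1 / z2))) *
     (\<Sum>\<^sub>\<infinity>l\<in>odd_vecs. a l * leaf_coeff (l $ 6) * leaf_coeff (l $ 5) * leaf_coeff (l $ 4) * leaf_coeff (l $ 3) * z1 powi (l $ 1) * z2 powi (l $ 2))"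
    (is "_ = ?P * _")
    if nz: "z1 \<noteq> 0" "z2 \<noteq> 0" for z1 z2
  proof -
    let ?d = "\<lambda>l. a l * leaf_coeff (l $ 6) * leaf_coeff (l $ 5) * leaf_coeff (l $ 4) * z1 powi (l $ 1) * z2 powi (l $ 2) * ?P"
    have "circle_integral 1 (\<lambda>z3. circle_integral 1 (\<lambda>z4. circle_integral 1 (\<lambda>z5. circle_integral 1 (\<lambda>z6. block_integrand w \<tau> (vector [z1, z2, z3, z4, z5, z6]))))) = (\<Sum>\<^sub>\<infinity>l\<in>odd_vecs. ?d l * leaf_coeff (l $ 3))"
    proof (rule circle_integral_leaf_series)
      show "rapid ?d" using nz rapid unfolding a_def by (intro rapid_const rapid_powi rapid_mult)
      show "circle_integral 1 (\<lambda>z4. circle_integral 1 (\<lambda>z5. circle_integral 1 (\<lambda>z6. block_integrand w \<tau> (vector [z1, z2, z, z4, z5, z6])))) = (z - 1 / z) * (\<Sum>\<^sub>\<infinity>l\<in>odd_vecs. ?d l * z powi (l $ 3))"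
        if "norm z = 1" for z
        unfolding i4[OF nz(1-2) \<open>norm z = 1\<close>[THEN nz1]] infsum_cmult_right'[symmetric] by (simp only: mult_ac)
    qed
    also have "\<dots> = ?P * (\<Sum>\<^sub>\<infinity>l\<in>odd_vecs. a l * leaf_coeff (l $ 6) * leaf_coeff (l $ 5) * leaf_coeff (l $ 4) * leaf_coeff (l $ 3) * z1 powi (l $ 1) * z2 powi (l $ 2))"
      unfolding infsum_cmult_right'[symmetric] by (simp only: mult_ac)
    finally show ?thesis .
  qed
  define b where "b = (\<lambda>l. a l * leaf_coeff (l $ 6) * leaf_coeff (l $ 5) * leaf_coeff (l $ 4) * leaf_coeff (l $ 3))"
  have b: "rapid b" unfolding b_def a_def using rapid by (intro rapid_mult)
  have i2: "pv_circle_integral (\<lambda>z2. circle_integral 1 (\<lambda>z3. circle_integral 1 (\<lambda>z4. circle_integral 1 (\<lambda>z5. circle_integral 1 (\<lambda>z6. block_integrand w \<tau> (vector [z1, z2, z3, z4, z5, z6])))))) =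
     1 / (z1 - 1 / z1) * (\<Sum>\<^sub>\<infinity>l\<in>odd_vecs. b l * (of_int (sgn (l $ 2)) / 2) * z1 powi (l $ 1))"
    if nz: "z1 \<noteq> 0" for z1
  proof -
    let ?d = "\<lambda>l. b l * z1 powi (l $ 1) * (1 / (z1 - 1 / z1))"
    have "pv_circle_integral (\<lambda>z2. circle_integral 1 (\<lambda>z3. circle_integral 1 (\<lambda>z4. circle_integral 1 (\<lambda>z5. circle_integral 1 (\<lambda>z6. block_integrand w \<tau> (vector [z1, z2, z3, z4, z5, z6])))))) = (\<Sum>\<^sub>\<infinity>l\<in>odd_vecs. ?d l * (of_int (sgn (l $ 2)) / 2))"
    proof (rule pv_circle_integral_node_series)
      show "rapid ?d" using nz b by (intro rapid_const rapid_powi)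
      show "circle_integral 1 (\<lambda>z3. circle_integral 1 (\<lambda>z4. circle_integral 1 (\<lambda>z5. circle_integral 1 (\<lambda>z6. block_integrand w \<tau> (vector [z1, z, z3, z4, z5, z6]))))) = 1 / (z - 1 / z) * (\<Sum>\<^sub>\<infinity>l\<in>odd_vecs. ?d l * z powi (l $ 2))"
        if "z \<noteq> 0" for z
        unfolding i3[OF nz that] b_def infsum_cmult_right'[symmetric] by (simp only: mult_ac)
    qed
    also have "\<dots> = 1 / (z1 - 1 / z1) * (\<Sum>\<^sub>\<infinity>l\<in>odd_vecs. b l * (of_int (sgn (l $ 2)) / 2) * z1 powi (l $ 1))"
      unfolding infsum_cmult_right'[symmetric] by (simp only: mult_ac)
    finally show ?thesis .
  qed
  have "pv_circle_integral (\<lambda>z1. pv_circle_integral (\<lambda>z2. circle_integral 1 (\<lambda>z3. circle_integral 1 (\<lambda>z4. circle_integral 1 (\<lambda>z5. circle_integral 1 (\<lambda>z6. block_integrand w \<tau> (vector [z1, z2, z3, z4, z5, z6]))))))) =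
     (\<Sum>\<^sub>\<infinity>l\<in>odd_vecs. b l * (of_int (sgn (l $ 2)) / 2) * (of_int (sgn (l $ 1)) / 2))"
    by (rule pv_circle_integral_node_series[OF rapid_mult(2)[OF b]]) (rule i2)
  then show ?thesis unfolding homological_block_def b_def a_def by simp
qed

section \<open>Radial limits of false theta series\<close>

text \<open>The second claim is uniform in \<open>K\<close> and becomes the majorant for dominated
  convergence.\<close>

lemma odd_geometric_sum:
  fixes v :: complex
  assumes "norm v < 1" "v \<noteq> 0"
  shows "(\<lambda>K. \<Sum>m<K. v ^ (2 * m + 1)) \<longlonglongrightarrow> - 1 / (v - 1 / v)"
    and "norm (\<Sum>m<K. v ^ (2 * m + 1)) \<le> norm v / (1 - (norm v)\<^sup>2)"
proof -
  have n2: "norm (v\<^sup>2) < 1" using assms by (simp add: norm_power power_less_one_iff)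
  have "(\<lambda>m. v * (v\<^sup>2) ^ m) sums (v * (1 / (1 - v\<^sup>2)))"
    by (intro sums_mult geometric_sums n2)
  moreover have "v * (1 / (1 - v\<^sup>2)) = - 1 / (v - 1 / v)"
  proof -
    have "1 - v\<^sup>2 \<noteq> 0" using n2 by auto
    then show ?thesis using assms(2) by (simp add: divide_simps power2_eq_square) (simp add: algebra_simps)
  qed
  moreover have "v * (v\<^sup>2) ^ m = v ^ (2 * m + 1)" for m by (simp add: power_mult)
  ultimately show "(\<lambda>K. \<Sum>m<K. v ^ (2 * m + 1)) \<longlonglongrightarrow> - 1 / (v - 1 / v)"
    by (simp add: sums_def)
  have "norm (\<Sum>m<K. v ^ (2 * m + 1)) \<le> (\<Sum>m<K. norm v * ((norm v)\<^sup>2) ^ m)"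
    by (rule sum_norm_le) (simp add: norm_mult norm_power power_mult)
  also have "\<dots> = norm v * (\<Sum>m<K. ((norm v)\<^sup>2) ^ m)" by (simp add: sum_distrib_left)
  also have "\<dots> \<le> norm v * (1 / (1 - (norm v)\<^sup>2))"
  proof (rule mult_left_mono)
    have "(norm v)\<^sup>2 < 1" using assms by (simp add: power_less_one_iff)
    then show "(\<Sum>m<K. ((norm v)\<^sup>2) ^ m) \<le> 1 / (1 - (norm v)\<^sup>2)"
      using sum_le_suminf[of "\<lambda>m. ((norm v)\<^sup>2) ^ m" "{..<K}"] by (simp add: suminf_geometric)
  qed simp
  finally show "norm (\<Sum>m<K. v ^ (2 * m + 1)) \<le> norm v / (1 - (norm v)\<^sup>2)" by simp
qed

text \<open>Numbers the odd integers of sign \<sigma> by naturals, so that each half line carries an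
  ordinary geometric series.\<close>

definition odd_of :: "int \<Rightarrow> nat \<Rightarrow> int"
  where "odd_of \<sigma> m = \<sigma> * (2 * int m + 1)"

text \<open>On the negative half line the series is one in \<open>1 / w\<close>, and
  \<open>w - 1 / w\<close> changes sign under w -> 1 / w. The factor \<sigma> compensates this, so
  both half lines have the same closed form; this is why the four quadrants share one limit.\<close>

lemma signed_geometric_sum:
  fixes z u :: complex and \<sigma> :: int
  assumes "norm z = 1" "\<sigma> = 1 \<or> \<sigma> = - 1" "Re u * of_int \<sigma> = - a" "a > 0"
  shows "(\<lambda>K. \<Sum>m<K. of_int \<sigma> * (z * exp u) powi (odd_of \<sigma> m)) \<longlonglongrightarrow> - 1 / (z * exp u - 1 / (z * exp u))"
    and "norm (\<Sum>m<K. of_int \<sigma> * (z * exp u) powi (odd_of \<sigma> m)) \<le> exp (- a) / (1 - (exp (- a))\<^sup>2)"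
proof -
  define w where "w = z * exp u"
  have z0: "w \<noteq> 0" using assms(1) by (auto simp: w_def)
  have nw: "norm w = exp (Re u)" by (simp add: w_def norm_mult assms(1))
  define v where "v = (if \<sigma> = 1 then w else 1 / w)"
  have v: "v \<noteq> 0" "norm v = exp (- a)"
    using assms z0 nw by (auto simp: v_def norm_divide exp_minus inverse_eq_divide)
  have pw: "of_int \<sigma> * w powi (odd_of \<sigma> m) = of_int \<sigma> * v ^ (2 * m + 1)" for m
  proof (cases "\<sigma> = 1")
    case True
    moreover have "1 * (2 * int m + 1) = int (2 * m + 1)" by simp
    ultimately show ?thesis unfolding odd_of_def by (simp only: power_int_of_nat v_def if_True simp_thms)
  next
    case False
    then have "\<sigma> = - 1" using assms by simp
    moreover have "- 1 * (2 * int m + 1) = - int (2 * m + 1)" by simp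
    ultimately show ?thesis unfolding odd_of_def
      by (simp only: power_int_minus power_int_of_nat v_def) (simp add: power_divide inverse_eq_divide)
  qed
  have n1: "norm v < 1" using v assms(4) by simp
  have "(\<lambda>K. of_int \<sigma> * (\<Sum>m<K. v ^ (2 * m + 1))) \<longlonglongrightarrow> of_int \<sigma> * (- 1 / (v - 1 / v))"
    by (intro tendsto_mult tendsto_const odd_geometric_sum n1 v)
  moreover have "of_int \<sigma> * (- 1 / (v - 1 / v)) = - 1 / (w - 1 / w)"
    using assms(2) by (auto simp: v_def minus_divide_right[symmetric]) (metis minus_diff_eq minus_divide_right)
  ultimately show "(\<lambda>K. \<Sum>m<K. of_int \<sigma> * (z * exp u) powi (odd_of \<sigma> m)) \<longlonglongrightarrow> - 1 / (z * exp u - 1 / (z * exp u))"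
    unfolding w_def[symmetric] pw by (simp add: sum_distrib_left)
  have "norm (of_int \<sigma> * (\<Sum>m<K. v ^ (2 * m + 1))) = norm (\<Sum>m<K. v ^ (2 * m + 1))"
    using assms(2) by (auto simp: norm_mult)
  then show "norm (\<Sum>m<K. of_int \<sigma> * (z * exp u) powi (odd_of \<sigma> m)) \<le> exp (- a) / (1 - (exp (- a))\<^sup>2)"
    unfolding w_def[symmetric] pw sum_distrib_left[symmetric] using odd_geometric_sum(2)[OF n1 v(1), of K] v(2) by simp
qed

text \<open>The sign choices at the two leaves of a node shift the argument of the Gaussian by
  \<open>\<rho> i\<close>; in the exponential average such a shift becomes the factor
  \<open>exp (u * \<rho> i)\<close>.\<close>

definition expsum :: "'i set \<Rightarrow> ('i \<Rightarrow> complex) \<Rightarrow> ('i \<Rightarrow> real) \<Rightarrow> complex \<Rightarrow> complex"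
  where "expsum I c \<rho> u = (\<Sum>i\<in>I. c i * exp (u * of_real (\<rho> i)))"

text \<open>The closed form of the half-line series at \<open>z * exp u\<close>, times the leaf
  factor \<open>D\<close>. For \<open>z\<^sup>2 = 1\<close> its denominator vanishes at
  \<open>u = 0\<close>.\<close>

definition node_factor :: "complex \<Rightarrow> (complex \<Rightarrow> complex) \<Rightarrow> complex \<Rightarrow> complex"
  where "node_factor z D u = - D u / (z * exp u - 1 / (z * exp u))"

lemma expsum_bound: "norm (expsum I c \<rho> u) \<le> (\<Sum>i\<in>I. norm (c i) * exp (\<bar>Re u\<bar> * \<bar>\<rho> i\<bar>))"
  unfolding expsum_def
proof (rule sum_norm_le)
  fix i
  have "Re u * \<rho> i \<le> \<bar>Re u\<bar> * \<bar>\<rho> i\<bar>" by (metis abs_ge_self abs_mult)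
  then show "norm (c i * exp (u * of_real (\<rho> i))) \<le> norm (c i) * exp (\<bar>Re u\<bar> * \<bar>\<rho> i\<bar>)"
    by (simp add: norm_mult mult_left_mono)
qed

lemma exp_powi: "exp u powi n = exp (of_int n * u)" for u :: complex
  by (cases n rule: int_cases2) (simp_all add: power_int_minus exp_of_nat_mult exp_minus)

text \<open>Under the integral the finite sums over \<open>m\<close>, \<open>n\<close>,
  \<open>i\<close>, \<open>j\<close> split into one factor per node. Since
  \<open>Re u * \<sigma> = - s\<close>, both geometric sums are bounded uniformly in \<omega> and
  \<open>K\<close>, and a constant is an integrable majorant on a finite measure.\<close>

lemma quadrant_sum:
  fixes M :: "'a measure" and g :: "'a \<Rightarrow> complex" and X1 X2 :: "'a \<Rightarrow> real" and F :: "real \<Rightarrow> real \<Rightarrow> complex"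
    and c1 :: "'i \<Rightarrow> complex" and c2 :: "'j \<Rightarrow> complex" and \<rho>1 :: "'i \<Rightarrow> real" and \<rho>2 :: "'j \<Rightarrow> real"
    and z1 z2 :: complex and \<sigma>1 \<sigma>2 :: int
  assumes M: "finite_measure M"
    and meas: "g \<in> borel_measurable M" "X1 \<in> borel_measurable M" "X2 \<in> borel_measurable M"
    and g: "\<And>\<omega>. norm (g \<omega>) \<le> G"
    and rep: "\<And>x y. (LINT \<omega>|M. g \<omega> * exp (of_real x * (\<i> * X1 \<omega> - of_int \<sigma>1) + of_real y * (\<i> * X2 \<omega> - of_int \<sigma>2))) = F x y"
    and sg: "\<sigma>1 = 1 \<or> \<sigma>1 = - 1" "\<sigma>2 = 1 \<or> \<sigma>2 = - 1"
    and z: "norm z1 = 1" "norm z2 = 1" and s: "s > 0"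
    and fin: "finite I1" "finite I2"
  defines "D1 \<equiv> expsum I1 c1 \<rho>1" and "D2 \<equiv> expsum I2 c2 \<rho>2"
  defines "T \<equiv> \<lambda>m n. of_int \<sigma>1 * of_int \<sigma>2 * z1 powi odd_of \<sigma>1 m * z2 powi odd_of \<sigma>2 n *
       (\<Sum>i\<in>I1. \<Sum>j\<in>I2. c1 i * c2 j * F (s * (of_int (odd_of \<sigma>1 m) + \<rho>1 i)) (s * (of_int (odd_of \<sigma>2 n) + \<rho>2 j)))"
  shows "(\<lambda>K. \<Sum>m<K. \<Sum>n<K. T m n) \<longlonglongrightarrow>
      (LINT \<omega>|M. g \<omega> * node_factor z1 D1 (of_real s * (\<i> * X1 \<omega> - of_int \<sigma>1))
         * node_factor z2 D2 (of_real s * (\<i> * X2 \<omega> - of_int \<sigma>2)))"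
proof -
  interpret finite_measure M by fact
  define u1 u2 where "u1 = (\<lambda>\<omega>. of_real s * (\<i> * X1 \<omega> - of_int \<sigma>1))" and "u2 = (\<lambda>\<omega>. of_real s * (\<i> * X2 \<omega> - of_int \<sigma>2))"
  have [measurable]: "u1 \<in> borel_measurable M" "u2 \<in> borel_measurable M" "g \<in> borel_measurable M"
    unfolding u1_def u2_def using meas by measurable
  define S1 where "S1 = (\<lambda>K \<omega>. \<Sum>m<K. of_int \<sigma>1 * (z1 * exp (u1 \<omega>)) powi (odd_of \<sigma>1 m))"
  define S2 where "S2 = (\<lambda>K \<omega>. \<Sum>m<K. of_int \<sigma>2 * (z2 * exp (u2 \<omega>)) powi (odd_of \<sigma>2 m))"
  have ez: "(z * exp u) powi n = z powi n * exp (of_int n * u)" for z u :: complex and n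
    by (simp add: power_int_mult_distrib exp_powi)
  have [measurable]: "D1 \<in> borel_measurable borel" "D2 \<in> borel_measurable borel"
    unfolding D1_def D2_def expsum_def by measurable
  have [measurable]: "S1 K \<in> borel_measurable M" "S2 K \<in> borel_measurable M" for K
    unfolding S1_def S2_def ez by measurable
  have re: "Re (u1 \<omega>) * of_int \<sigma>1 = - s" "Re (u2 \<omega>) * of_int \<sigma>2 = - s" for \<omega>
    using sg by (auto simp: u1_def u2_def)
  define q where "q = exp (- s) / (1 - (exp (- s))\<^sup>2)"
  have S1lim: "(\<lambda>K. S1 K \<omega>) \<longlonglongrightarrow> - 1 / (z1 * exp (u1 \<omega>) - 1 / (z1 * exp (u1 \<omega>)))" and S1b: "norm (S1 K \<omega>) \<le> q" for \<omega> K
    unfolding S1_def q_def by (rule signed_geometric_sum[OF z(1) sg(1) re(1) s])+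
  have S2lim: "(\<lambda>K. S2 K \<omega>) \<longlonglongrightarrow> - 1 / (z2 * exp (u2 \<omega>) - 1 / (z2 * exp (u2 \<omega>)))" and S2b: "norm (S2 K \<omega>) \<le> q" for \<omega> K
    unfolding S2_def q_def by (rule signed_geometric_sum[OF z(2) sg(2) re(2) s])+
  have res: "\<bar>Re (u1 \<omega>)\<bar> = s" "\<bar>Re (u2 \<omega>)\<bar> = s" for \<omega>
    using sg s by (auto simp: u1_def u2_def)
  define b1 b2 where "b1 = (\<Sum>i\<in>I1. norm (c1 i) * exp (s * \<bar>\<rho>1 i\<bar>))" and "b2 = (\<Sum>i\<in>I2. norm (c2 i) * exp (s * \<bar>\<rho>2 i\<bar>))"
  have D1b: "norm (D1 (u1 \<omega>)) \<le> b1" and D2b: "norm (D2 (u2 \<omega>)) \<le> b2" for \<omega>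
    using expsum_bound[of I1 c1 \<rho>1 "u1 \<omega>"] expsum_bound[of I2 c2 \<rho>2 "u2 \<omega>"] unfolding res D1_def D2_def b1_def b2_def .
  have partial: "(\<Sum>m<K. \<Sum>n<K. T m n) = (LINT \<omega>|M. g \<omega> * (S1 K \<omega> * D1 (u1 \<omega>)) * (S2 K \<omega> * D2 (u2 \<omega>)))" for K
  proof -
    define t where "t = (\<lambda>m n i j \<omega>. of_int \<sigma>1 * of_int \<sigma>2 * z1 powi odd_of \<sigma>1 m * z2 powi odd_of \<sigma>2 n * c1 i * c2 j *
       (g \<omega> * exp (of_real (s * (of_int (odd_of \<sigma>1 m) + \<rho>1 i)) * (\<i> * X1 \<omega> - of_int \<sigma>1)
          + of_real (s * (of_int (odd_of \<sigma>2 n) + \<rho>2 j)) * (\<i> * X2 \<omega> - of_int \<sigma>2))))"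
    have int: "integrable M (\<lambda>\<omega>. g \<omega> * exp (of_real x * (\<i> * X1 \<omega> - of_int \<sigma>1) + of_real y * (\<i> * X2 \<omega> - of_int \<sigma>2)))" for x y
    proof (rule integrable_const_bound)
      show "AE \<omega> in M. norm (g \<omega> * exp (of_real x * (\<i> * X1 \<omega> - of_int \<sigma>1) + of_real y * (\<i> * X2 \<omega> - of_int \<sigma>2))) \<le> G * exp (- x * of_int \<sigma>1 - y * of_int \<sigma>2)"
        by (intro AE_I2) (simp add: norm_mult g mult_right_mono)
      show "(\<lambda>\<omega>. g \<omega> * exp (of_real x * (\<i> * X1 \<omega> - of_int \<sigma>1) + of_real y * (\<i> * X2 \<omega> - of_int \<sigma>2))) \<in> borel_measurable M"
        using meas by measurable
    qed
    have t_int: "integrable M (t m n i j)" for m n i j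
      unfolding t_def by (intro integrable_mult_right int)
    have ti: "(LINT \<omega>|M. t m n i j \<omega>) = of_int \<sigma>1 * of_int \<sigma>2 * z1 powi odd_of \<sigma>1 m * z2 powi odd_of \<sigma>2 n * c1 i * c2 j *
        F (s * (of_int (odd_of \<sigma>1 m) + \<rho>1 i)) (s * (of_int (odd_of \<sigma>2 n) + \<rho>2 j))" for m n i j
      unfolding t_def by (simp only: integral_mult_right_zero rep)
    have T: "T m n = (\<Sum>i\<in>I1. \<Sum>j\<in>I2. LINT \<omega>|M. t m n i j \<omega>)" for m n
      unfolding T_def ti sum_distrib_left by (simp only: mult.assoc)
    have "(\<Sum>m<K. \<Sum>n<K. T m n) = (LINT \<omega>|M. (\<Sum>m<K. \<Sum>n<K. \<Sum>i\<in>I1. \<Sum>j\<in>I2. t m n i j \<omega>))"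
      unfolding T by (simp add: Bochner_Integration.integral_sum t_int)
    also have "(\<lambda>\<omega>. \<Sum>m<K. \<Sum>n<K. \<Sum>i\<in>I1. \<Sum>j\<in>I2. t m n i j \<omega>) = (\<lambda>\<omega>. g \<omega> * (S1 K \<omega> * D1 (u1 \<omega>)) * (S2 K \<omega> * D2 (u2 \<omega>)))"
    proof
      fix \<omega>
      define e1 where "e1 = (\<lambda>m i. of_int \<sigma>1 * (z1 * exp (u1 \<omega>)) powi (odd_of \<sigma>1 m) * (c1 i * exp (u1 \<omega> * of_real (\<rho>1 i))))"
      define e2 where "e2 = (\<lambda>m i. of_int \<sigma>2 * (z2 * exp (u2 \<omega>)) powi (odd_of \<sigma>2 m) * (c2 i * exp (u2 \<omega> * of_real (\<rho>2 i))))"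
      have te: "t m n i j \<omega> = g \<omega> * e1 m i * e2 n j" for m n i j
      proof -
        have "exp (of_real (s * (of_int (odd_of \<sigma>1 m) + \<rho>1 i)) * (\<i> * X1 \<omega> - of_int \<sigma>1)
          + of_real (s * (of_int (odd_of \<sigma>2 n) + \<rho>2 j)) * (\<i> * X2 \<omega> - of_int \<sigma>2))
          = exp (of_int (odd_of \<sigma>1 m) * u1 \<omega>) * exp (u1 \<omega> * of_real (\<rho>1 i)) * (exp (of_int (odd_of \<sigma>2 n) * u2 \<omega>) * exp (u2 \<omega> * of_real (\<rho>2 j)))"
          unfolding exp_add[symmetric] u1_def u2_def by (rule arg_cong[of _ _ exp]) (simp add: algebra_simps)
        then show ?thesis unfolding t_def e1_def e2_def ez by (simp only: mult_ac)
      qed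
      have "S1 K \<omega> * D1 (u1 \<omega>) = (\<Sum>m<K. \<Sum>i\<in>I1. e1 m i)"
        unfolding S1_def D1_def expsum_def e1_def by (simp add: sum_product)
      moreover have "S2 K \<omega> * D2 (u2 \<omega>) = (\<Sum>n<K. \<Sum>j\<in>I2. e2 n j)"
        unfolding S2_def D2_def expsum_def e2_def by (simp add: sum_product)
      moreover have "(\<Sum>m<K. \<Sum>n<K. \<Sum>i\<in>I1. \<Sum>j\<in>I2. t m n i j \<omega>) = g \<omega> * (\<Sum>m<K. \<Sum>i\<in>I1. e1 m i) * (\<Sum>n<K. \<Sum>j\<in>I2. e2 n j)"
        unfolding te sum_distrib_left[symmetric] sum_distrib_right[symmetric] ..
      ultimately show "(\<Sum>m<K. \<Sum>n<K. \<Sum>i\<in>I1. \<Sum>j\<in>I2. t m n i j \<omega>) = g \<omega> * (S1 K \<omega> * D1 (u1 \<omega>)) * (S2 K \<omega> * D2 (u2 \<omega>))"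
        by simp
    qed
    finally show ?thesis .
  qed
  have nf: "node_factor z D u = - 1 / (z * exp u - 1 / (z * exp u)) * D u" for z D u
    by (simp add: node_factor_def)
  have u: "of_real s * (\<i> * X1 \<omega> - of_int \<sigma>1) = u1 \<omega>" "of_real s * (\<i> * X2 \<omega> - of_int \<sigma>2) = u2 \<omega>" for \<omega>
    by (simp_all add: u1_def u2_def)
  show ?thesis
    unfolding partial u nf
  proof (rule integral_dominated_convergence[where w = "\<lambda>_. G * (q * b1) * (q * b2)"])
    show "(\<lambda>\<omega>. g \<omega> * (- 1 / (z1 * exp (u1 \<omega>) - 1 / (z1 * exp (u1 \<omega>))) * D1 (u1 \<omega>)) * (- 1 / (z2 * exp (u2 \<omega>) - 1 / (z2 * exp (u2 \<omega>))) * D2 (u2 \<omega>)))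
      \<in> borel_measurable M" by measurable
    show "AE \<omega> in M. (\<lambda>K. g \<omega> * (S1 K \<omega> * D1 (u1 \<omega>)) * (S2 K \<omega> * D2 (u2 \<omega>))) \<longlonglongrightarrow>
      g \<omega> * (- 1 / (z1 * exp (u1 \<omega>) - 1 / (z1 * exp (u1 \<omega>))) * D1 (u1 \<omega>)) * (- 1 / (z2 * exp (u2 \<omega>) - 1 / (z2 * exp (u2 \<omega>))) * D2 (u2 \<omega>))"
      by (intro AE_I2 tendsto_mult tendsto_const S1lim S2lim)
    show "AE \<omega> in M. norm (g \<omega> * (S1 K \<omega> * D1 (u1 \<omega>)) * (S2 K \<omega> * D2 (u2 \<omega>))) \<le> G * (q * b1) * (q * b2)" for K
    proof (rule AE_I2)
      fix \<omega>
      have "0 \<le> G" using g[of \<omega>] norm_ge_zero order_trans by blast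
      moreover have "0 \<le> q" using S1b[of 0 \<omega>] by (simp add: S1_def)
      moreover have "0 \<le> b1" "0 \<le> b2" by (auto simp: b1_def b2_def intro!: sum_nonneg)
      ultimately show "norm (g \<omega> * (S1 K \<omega> * D1 (u1 \<omega>)) * (S2 K \<omega> * D2 (u2 \<omega>))) \<le> G * (q * b1) * (q * b2)"
        unfolding norm_mult by (intro mult_mono g S1b S2b D1b D2b mult_nonneg_nonneg) auto
    qed
  qed (auto simp: mult.assoc)
qed

text \<open>Near 0 the existence of the limit gives boundedness. For \<open>norm u \<ge> d\<close>
  the denominator is at least \<open>\<bar>Re u\<bar>\<close> in norm and 1 is at most
  \<open>norm u / d\<close>. The ratio \<open>norm u / \<bar>Re u\<bar>\<close> does not change when
  \<open>u\<close> is scaled, which makes the bound uniform in \<open>s\<close>.\<close>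

lemma node_factor_bound:
  fixes z h :: complex
  assumes "norm z = 1" "finite I" and lim: "(node_factor z (expsum I c \<rho>) \<longlongrightarrow> h) (at 0)"
  shows "\<exists>K\<ge>0. \<forall>u. 0 < \<bar>Re u\<bar> \<longrightarrow> \<bar>Re u\<bar> \<le> 1 \<longrightarrow> norm (node_factor z (expsum I c \<rho>) u) \<le> K * (1 + norm u / \<bar>Re u\<bar>)"
proof -
  define b where "b = (\<Sum>i\<in>I. norm (c i) * exp \<bar>\<rho> i\<bar>)"
  have b0: "b \<ge> 0" unfolding b_def by (intro sum_nonneg) auto
  have "eventually (\<lambda>u. dist (node_factor z (expsum I c \<rho>) u) h < 1) (at 0)"
    using lim by (rule tendstoD) simp
  then obtain d where d: "d > 0" "\<And>u. u \<noteq> 0 \<Longrightarrow> norm u < d \<Longrightarrow> dist (node_factor z (expsum I c \<rho>) u) h < 1"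
    unfolding eventually_at by auto
  show ?thesis
  proof (intro exI[of _ "norm h + 1 + b / d"] conjI allI impI)
    show "0 \<le> norm h + 1 + b / d" using b0 d by (intro add_nonneg_nonneg divide_nonneg_pos) auto
  next
    fix u :: complex assume u: "0 < \<bar>Re u\<bar>" "\<bar>Re u\<bar> \<le> 1"
    define x where "x = norm u / \<bar>Re u\<bar>"
    have x: "x \<ge> 0" by (simp add: x_def)
    have bd: "b / d \<ge> 0" using b0 d by (intro divide_nonneg_pos) auto
    show "norm (node_factor z (expsum I c \<rho>) u) \<le> (norm h + 1 + b / d) * (1 + x)"
    proof (cases "norm u < d")
      case True
      have "norm (node_factor z (expsum I c \<rho>) u) \<le> norm h + dist (node_factor z (expsum I c \<rho>) u) h"
        unfolding dist_norm by (metis norm_triangle_sub)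
      also have "\<dots> \<le> norm h + 1" using d(2)[of u] True u by fastforce
      also have "\<dots> \<le> (norm h + 1) * (1 + x)" using x mult_left_mono[of 1 "1 + x" "norm h + 1"] by simp
      also have "\<dots> \<le> (norm h + 1 + b / d) * (1 + x)" using x bd by (intro mult_right_mono) auto
      finally show ?thesis .
    next
      case False
      define w where "w = z * exp u"
      have "norm w = exp (Re u)" by (simp add: w_def norm_mult assms(1))
      then have "norm (w - 1 / w) \<ge> \<bar>exp (Re u) - exp (- Re u)\<bar>"
        using norm_triangle_ineq3[of w "1 / w"] by (simp add: norm_divide exp_minus inverse_eq_divide)
      moreover have "\<bar>exp r - exp (- r)\<bar> \<ge> \<bar>r\<bar>" for r :: real
      proof (cases "r \<ge> 0")
        case True
        then have "1 + r \<le> exp r" "exp (- r) \<le> 1" using exp_ge_add_one_self by auto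
        then show ?thesis using True by linarith
      next
        case False
        then have "1 - r \<le> exp (- r)" "exp r \<le> 1" using exp_ge_add_one_self[of "- r"] by auto
        then show ?thesis using False by linarith
      qed
      ultimately have den: "norm (w - 1 / w) \<ge> \<bar>Re u\<bar>" using order_trans by blast
      have "norm (expsum I c \<rho> u) \<le> (\<Sum>i\<in>I. norm (c i) * exp (\<bar>Re u\<bar> * \<bar>\<rho> i\<bar>))" by (rule expsum_bound)
      also have "\<dots> \<le> b" unfolding b_def using u
        by (intro sum_mono mult_left_mono) (auto simp: mult_left_le_one_le)
      finally have num: "norm (expsum I c \<rho> u) \<le> b" .
      have "norm (node_factor z (expsum I c \<rho>) u) = norm (expsum I c \<rho> u) / norm (w - 1 / w)"
        unfolding node_factor_def w_def norm_divide by simp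
      also have "\<dots> \<le> b / \<bar>Re u\<bar>" using u num den b0 by (intro frac_le) auto
      also have "\<dots> \<le> b / d * x" using False u d b0 unfolding x_def by (simp add: field_simps mult_left_mono)
      also have "\<dots> \<le> (norm h + 1 + b / d) * (1 + x)" using x bd by (intro mult_mono) auto
      finally show ?thesis .
    qed
  qed
qed

text \<open>For \<open>u = s * k\<close> with \<open>\<bar>Re k\<bar> = 1\<close>, the ratio in
  \<open>node_factor_bound\<close> is \<open>norm k\<close>, at most
  \<open>1 + \<bar>X\<bar>\<close>. The product of the two bounds is integrable, and for each
  \<omega> the arguments tend to 0 through nonzero values.\<close>

lemma node_factor_limit:
  fixes M :: "'a measure" and g :: "'a \<Rightarrow> complex" and X1 X2 :: "'a \<Rightarrow> real"
    and c1 :: "'i \<Rightarrow> complex" and c2 :: "'j \<Rightarrow> complex" and \<rho>1 :: "'i \<Rightarrow> real" and \<rho>2 :: "'j \<Rightarrow> real"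
    and z1 z2 :: complex and \<sigma>1 \<sigma>2 :: int
  assumes meas: "g \<in> borel_measurable M" "X1 \<in> borel_measurable M" "X2 \<in> borel_measurable M"
    and g: "\<And>\<omega>. norm (g \<omega>) \<le> G"
    and int: "integrable M (\<lambda>\<omega>. (1 + \<bar>X1 \<omega>\<bar>) * (1 + \<bar>X2 \<omega>\<bar>))"
    and sg: "\<sigma>1 = 1 \<or> \<sigma>1 = - 1" "\<sigma>2 = 1 \<or> \<sigma>2 = - 1"
    and z: "norm z1 = 1" "norm z2 = 1"
    and fin: "finite I1" "finite I2"
    and lim: "(node_factor z1 (expsum I1 c1 \<rho>1) \<longlongrightarrow> h1) (at 0)" "(node_factor z2 (expsum I2 c2 \<rho>2) \<longlongrightarrow> h2) (at 0)"
  shows "((\<lambda>s. LINT \<omega>|M. g \<omega> * node_factor z1 (expsum I1 c1 \<rho>1) (of_real s * (\<i> * X1 \<omega> - of_int \<sigma>1))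
         * node_factor z2 (expsum I2 c2 \<rho>2) (of_real s * (\<i> * X2 \<omega> - of_int \<sigma>2))) \<longlongrightarrow> h1 * h2 * (LINT \<omega>|M. g \<omega>)) (at_right 0)"
proof (rule tendsto_at_right_sequentially[of _ 1])
  fix S :: "nat \<Rightarrow> real" assume S: "\<And>n. 0 < S n" "\<And>n. S n < 1" "S \<longlonglongrightarrow> 0"
  define n1 n2 where "n1 = node_factor z1 (expsum I1 c1 \<rho>1)" and "n2 = node_factor z2 (expsum I2 c2 \<rho>2)"
  define k1 k2 where "k1 = (\<lambda>\<omega>. \<i> * X1 \<omega> - of_int \<sigma>1)" and "k2 = (\<lambda>\<omega>. \<i> * X2 \<omega> - of_int \<sigma>2)"
  obtain K1 K2 where K: "K1 \<ge> 0" "\<And>u. 0 < \<bar>Re u\<bar> \<Longrightarrow> \<bar>Re u\<bar> \<le> 1 \<Longrightarrow> norm (n1 u) \<le> K1 * (1 + norm u / \<bar>Re u\<bar>)"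
    "K2 \<ge> 0" "\<And>u. 0 < \<bar>Re u\<bar> \<Longrightarrow> \<bar>Re u\<bar> \<le> 1 \<Longrightarrow> norm (n2 u) \<le> K2 * (1 + norm u / \<bar>Re u\<bar>)"
    using node_factor_bound[OF z(1) fin(1) lim(1)] node_factor_bound[OF z(2) fin(2) lim(2)]
    unfolding n1_def n2_def by blast
  have [measurable]: "g \<in> borel_measurable M" "k1 \<in> borel_measurable M" "k2 \<in> borel_measurable M"
    "n1 \<in> borel_measurable borel" "n2 \<in> borel_measurable borel"
    unfolding k1_def k2_def n1_def n2_def node_factor_def expsum_def using meas by measurable
  have re: "\<bar>Re (k1 \<omega>)\<bar> = 1" "\<bar>Re (k2 \<omega>)\<bar> = 1" for \<omega> using sg by (auto simp: k1_def k2_def)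
  have kb: "norm (k1 \<omega>) \<le> 1 + \<bar>X1 \<omega>\<bar>" "norm (k2 \<omega>) \<le> 1 + \<bar>X2 \<omega>\<bar>" for \<omega>
    using norm_triangle_ineq4[of "\<i> * X1 \<omega>" "of_int \<sigma>1"] norm_triangle_ineq4[of "\<i> * X2 \<omega>" "of_int \<sigma>2"] sg
    by (auto simp: k1_def k2_def norm_mult)
  have bnd: "norm (n (of_real (S m) * k)) \<le> 2 * K * (1 + x)"
    if "\<And>u. 0 < \<bar>Re u\<bar> \<Longrightarrow> \<bar>Re u\<bar> \<le> 1 \<Longrightarrow> norm (n u) \<le> K * (1 + norm u / \<bar>Re u\<bar>)"
      "\<bar>Re k\<bar> = 1" "norm k \<le> 1 + x" "K \<ge> 0" "x \<ge> 0" for n :: "complex \<Rightarrow> complex" and K k x m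
  proof -
    have ab: "\<bar>Re (of_real (S m) * k)\<bar> = S m" using that(2) S(1)[of m] by (simp add: abs_mult)
    have "norm (n (of_real (S m) * k)) \<le> K * (1 + norm (of_real (S m) * k) / \<bar>Re (of_real (S m) * k)\<bar>)"
      using S(1,2)[of m] by (intro that(1)) (auto simp only: ab)
    also have "\<dots> = K * (1 + norm k)" unfolding ab using S(1)[of m] by (simp add: norm_mult)
    also have "\<dots> \<le> K * (2 * (1 + x))" using that by (intro mult_left_mono) auto
    finally show ?thesis by (simp add: algebra_simps)
  qed
  have tends: "(\<lambda>m. n (of_real (S m) * k)) \<longlonglongrightarrow> h" if "(n \<longlongrightarrow> h) (at 0)" "\<bar>Re k\<bar> = 1" for n :: "complex \<Rightarrow> complex" and h k
  proof (rule filterlim_compose[OF that(1)])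
    have "k \<noteq> 0" using that(2) by auto
    moreover have "(\<lambda>m. of_real (S m) * k) \<longlonglongrightarrow> of_real 0 * k" by (intro tendsto_intros S)
    ultimately show "filterlim (\<lambda>m. of_real (S m) * k) (at 0) sequentially"
      unfolding filterlim_at using S(1) by (auto intro!: always_eventually simp: less_imp_neq[symmetric])
  qed
  have "(\<lambda>m. LINT \<omega>|M. g \<omega> * n1 (of_real (S m) * k1 \<omega>) * n2 (of_real (S m) * k2 \<omega>)) \<longlonglongrightarrow> (LINT \<omega>|M. g \<omega> * h1 * h2)"
  proof (rule integral_dominated_convergence[where w = "\<lambda>\<omega>. (G * (2 * K1) * (2 * K2)) * ((1 + \<bar>X1 \<omega>\<bar>) * (1 + \<bar>X2 \<omega>\<bar>))"])
    show "integrable M (\<lambda>\<omega>. (G * (2 * K1) * (2 * K2)) * ((1 + \<bar>X1 \<omega>\<bar>) * (1 + \<bar>X2 \<omega>\<bar>)))"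
      by (intro integrable_mult_right int)
    show "AE \<omega> in M. (\<lambda>m. g \<omega> * n1 (of_real (S m) * k1 \<omega>) * n2 (of_real (S m) * k2 \<omega>)) \<longlonglongrightarrow> g \<omega> * h1 * h2"
      by (intro AE_I2 tendsto_mult tendsto_const tends re) (use lim in \<open>simp_all add: n1_def n2_def\<close>)
    show "AE \<omega> in M. norm (g \<omega> * n1 (of_real (S m) * k1 \<omega>) * n2 (of_real (S m) * k2 \<omega>)) \<le> G * (2 * K1) * (2 * K2) * ((1 + \<bar>X1 \<omega>\<bar>) * (1 + \<bar>X2 \<omega>\<bar>))" for m
    proof (rule AE_I2)
      fix \<omega>
      have "0 \<le> G" using g[of \<omega>] norm_ge_zero order_trans by blast
      then have "norm (g \<omega>) * norm (n1 (of_real (S m) * k1 \<omega>)) * norm (n2 (of_real (S m) * k2 \<omega>))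
         \<le> G * (2 * K1 * (1 + \<bar>X1 \<omega>\<bar>)) * (2 * K2 * (1 + \<bar>X2 \<omega>\<bar>))"
        using K by (intro mult_mono g bnd re kb mult_nonneg_nonneg K(2,4)) auto
      then show "norm (g \<omega> * n1 (of_real (S m) * k1 \<omega>) * n2 (of_real (S m) * k2 \<omega>)) \<le> G * (2 * K1) * (2 * K2) * ((1 + \<bar>X1 \<omega>\<bar>) * (1 + \<bar>X2 \<omega>\<bar>))"
        unfolding norm_mult by (simp only: mult_ac)
    qed
  qed measurable
  also have "(LINT \<omega>|M. g \<omega> * h1 * h2) = h1 * h2 * (LINT \<omega>|M. g \<omega>)"
    by (simp add: mult.commute)
  finally show "(\<lambda>m. LINT \<omega>|M. g \<omega> * node_factor z1 (expsum I1 c1 \<rho>1) (of_real (S m) * (\<i> * X1 \<omega> - of_int \<sigma>1))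
         * node_factor z2 (expsum I2 c2 \<rho>2) (of_real (S m) * (\<i> * X2 \<omega> - of_int \<sigma>2))) \<longlonglongrightarrow> h1 * h2 * (LINT \<omega>|M. g \<omega>)"
    unfolding n1_def n2_def k1_def k2_def .
qed simp

section \<open>Gaussians as averages of exponentials\<close>

definition gauss2 :: "real \<Rightarrow> real \<Rightarrow> real \<Rightarrow> real \<Rightarrow> real \<Rightarrow> complex"
  where "gauss2 A B C x y = of_real (exp (- (A * x\<^sup>2 + 2 * B * x * y + C * y\<^sup>2) / 2))"

text \<open>The characteristic function of the normal distribution, with the contour shifted so that the
  exponentials in \<open>x\<close> and \<open>y\<close> acquire the real parts \<open>- \<sigma>1\<close> and \<open>- \<sigma>2\<close>. The geometric series over the quadrant
  with signs \<open>\<sigma>1\<close>, \<open>\<sigma>2\<close> then converge absolutely.\<close>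

lemma gauss2_representation:
  fixes A B C :: real and \<sigma>1 \<sigma>2 :: int
  assumes "A > 0" "A * C - B\<^sup>2 > 0"
  shows "\<exists>(M :: (real \<times> real) measure) (g :: real \<times> real \<Rightarrow> complex) X1 X2 G.
    finite_measure M \<and> g \<in> borel_measurable M \<and> X1 \<in> borel_measurable M \<and> X2 \<in> borel_measurable M \<and>
    (\<forall>\<omega>. norm (g \<omega>) \<le> G) \<and> integrable M (\<lambda>\<omega>. (1 + \<bar>X1 \<omega>\<bar>) * (1 + \<bar>X2 \<omega>\<bar> :: real)) \<and>
    (\<forall>x y. (LINT \<omega>|M. g \<omega> * exp (of_real x * (\<i> * of_real (X1 \<omega>) - of_int \<sigma>1) + of_real y * (\<i> * of_real (X2 \<omega>) - of_int \<sigma>2))) = gauss2 A B C x y)"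
proof -
  let ?N = std_normal_distribution
  interpret N: real_distribution ?N by (rule real_dist_normal_dist)
  interpret NN: pair_prob_space ?N ?N ..
  \<comment> \<open>Cholesky factors: the form equals
    \<open>(a * x + b * y)\<^sup>2 + (d * y)\<^sup>2\<close>, so two independent standard normal
    variables suffice.\<close>
  define a where "a = sqrt A"
  define b where "b = B / a"
  define d where "d = sqrt ((A * C - B\<^sup>2) / A)"
  have pos: "a > 0" "d > 0" using assms by (auto simp: a_def d_def)
  have a2: "a * a = A" and ab: "a * b = B" using assms(1) pos by (auto simp: a_def b_def)
  have C: "b * b + d * d = C"
  proof -
    have "d * d = (A * C - B\<^sup>2) / A" using assms by (simp add: d_def)
    moreover have "b * b = B\<^sup>2 / A" using a2 by (simp add: b_def power2_eq_square)
    ultimately have "A * (b * b + d * d) = A * C" using assms(1) by (simp add: field_simps)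
    then show ?thesis using assms(1) by simp
  qed
  \<comment> \<open>The shift solves the transposed Cholesky system, so that
    \<open>\<alpha> * \<eta>1 + \<beta> * \<eta>2\<close> below equals
    \<open>x * \<sigma>1 + y * \<sigma>2\<close>; the constant \<open>E\<close> compensates its
    square.\<close>
  define \<eta>1 where "\<eta>1 = of_int \<sigma>1 / a"
  define \<eta>2 where "\<eta>2 = (of_int \<sigma>2 - b * \<eta>1) / d"
  have e1: "a * \<eta>1 = of_int \<sigma>1" and e2: "b * \<eta>1 + d * \<eta>2 = of_int \<sigma>2"
    using pos by (simp_all add: \<eta>1_def \<eta>2_def)
  define E where "E = (\<eta>1\<^sup>2 + \<eta>2\<^sup>2) / 2"
  define g where "g = (\<lambda>\<omega>. exp (- \<i> * of_real (fst \<omega> * \<eta>1 + snd \<omega> * \<eta>2) + of_real E))"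
  define X1 where "X1 = (\<lambda>\<omega>::real\<times>real. a * fst \<omega>)"
  define X2 where "X2 = (\<lambda>\<omega>. b * fst \<omega> + d * snd \<omega>)"
  have meas [measurable]: "g \<in> borel_measurable (?N \<Otimes>\<^sub>M ?N)" "X1 \<in> borel_measurable (?N \<Otimes>\<^sub>M ?N)" "X2 \<in> borel_measurable (?N \<Otimes>\<^sub>M ?N)"
    unfolding g_def X1_def X2_def by measurable
  have gb: "norm (g \<omega>) \<le> exp E" for \<omega> by (simp add: g_def)
  have int: "integrable (?N \<Otimes>\<^sub>M ?N) (\<lambda>\<omega>. (1 + \<bar>X1 \<omega>\<bar>) * (1 + \<bar>X2 \<omega>\<bar>))"
  proof (rule Bochner_Integration.integrable_bound)
    \<comment> \<open>\<open>X1\<close> and \<open>X2\<close> both involve the first coordinate, so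
      its second moment is needed.\<close>
    have 1: "integrable ?N (\<lambda>x. 1 + x\<^sup>2)"
      by (intro Bochner_Integration.integrable_add integrable_std_normal_distribution_moment) simp
    show "integrable (?N \<Otimes>\<^sub>M ?N) (\<lambda>\<omega>. (4 * (1 + a) * (1 + \<bar>b\<bar> + d)) * ((1 + (fst \<omega>)\<^sup>2) * (1 + (snd \<omega>)\<^sup>2)))"
    proof (intro integrable_mult_right NN.Fubini_integrable)
      show "integrable ?N (\<lambda>x. LINT y|?N. norm ((1 + (fst (x, y))\<^sup>2) * (1 + (snd (x, y))\<^sup>2)))"
        using 1 by (simp add: abs_mult add_nonneg_nonneg)
      show "AE x in ?N. integrable ?N (\<lambda>y. (1 + (fst (x, y))\<^sup>2) * (1 + (snd (x, y))\<^sup>2))"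
        using 1 by simp
    qed measurable
    show "AE \<omega> in ?N \<Otimes>\<^sub>M ?N. norm ((1 + \<bar>X1 \<omega>\<bar>) * (1 + \<bar>X2 \<omega>\<bar>)) \<le> norm ((4 * (1 + a) * (1 + \<bar>b\<bar> + d)) * ((1 + (fst \<omega>)\<^sup>2) * (1 + (snd \<omega>)\<^sup>2)))"
    proof (rule AE_I2)
      fix \<omega> :: "real \<times> real"
      obtain x y where \<omega>: "\<omega> = (x, y)" by (cases \<omega>)
      have sq: "(1 + \<bar>t\<bar>) * (1 + \<bar>t\<bar>) \<le> 2 * (1 + t\<^sup>2)" for t :: real
      proof -
        have "0 \<le> (1 - \<bar>t\<bar>) * (1 - \<bar>t\<bar>)" by simp
        then show ?thesis by (simp add: algebra_simps power2_eq_square)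
      qed
      have sq1: "1 + \<bar>t\<bar> \<le> 2 * (1 + t\<^sup>2)" for t :: real
      proof -
        have "1 + \<bar>t\<bar> \<le> (1 + \<bar>t\<bar>) * (1 + \<bar>t\<bar>)" using mult_left_mono[of 1 "1 + \<bar>t\<bar>" "1 + \<bar>t\<bar>"] by simp
        then show ?thesis using sq[of t] by linarith
      qed
      have 1: "1 + \<bar>X1 \<omega>\<bar> \<le> (1 + a) * (1 + \<bar>x\<bar>)"
        using pos by (simp add: X1_def \<omega> abs_mult algebra_simps)
      have "\<bar>X2 \<omega>\<bar> \<le> \<bar>b\<bar> * \<bar>x\<bar> + d * \<bar>y\<bar>"
        using pos abs_triangle_ineq[of "b * x" "d * y"] by (simp add: X2_def \<omega> abs_mult)
      also have "\<dots> \<le> \<bar>b\<bar> * ((1 + \<bar>x\<bar>) * (1 + \<bar>y\<bar>)) + d * ((1 + \<bar>x\<bar>) * (1 + \<bar>y\<bar>))"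
        using pos by (intro add_mono mult_left_mono) (auto simp: algebra_simps)
      finally have "1 + \<bar>X2 \<omega>\<bar> \<le> (1 + \<bar>x\<bar>) * (1 + \<bar>y\<bar>) + (\<bar>b\<bar> * ((1 + \<bar>x\<bar>) * (1 + \<bar>y\<bar>)) + d * ((1 + \<bar>x\<bar>) * (1 + \<bar>y\<bar>)))"
        using mult_mono[of 1 "1 + \<bar>x\<bar>" 1 "1 + \<bar>y\<bar>"] by simp
      also have "\<dots> = (1 + \<bar>b\<bar> + d) * ((1 + \<bar>x\<bar>) * (1 + \<bar>y\<bar>))" by (simp only: distrib_right mult_1 add.assoc)
      finally have 2: "1 + \<bar>X2 \<omega>\<bar> \<le> (1 + \<bar>b\<bar> + d) * ((1 + \<bar>x\<bar>) * (1 + \<bar>y\<bar>))" .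
      have "(1 + \<bar>X1 \<omega>\<bar>) * (1 + \<bar>X2 \<omega>\<bar>) \<le> (1 + a) * (1 + \<bar>x\<bar>) * ((1 + \<bar>b\<bar> + d) * ((1 + \<bar>x\<bar>) * (1 + \<bar>y\<bar>)))"
        using pos by (intro mult_mono 1 2) auto
      also have "\<dots> = (1 + a) * (1 + \<bar>b\<bar> + d) * (((1 + \<bar>x\<bar>) * (1 + \<bar>x\<bar>)) * (1 + \<bar>y\<bar>))" by (simp only: mult_ac)
      also have "\<dots> \<le> (1 + a) * (1 + \<bar>b\<bar> + d) * ((2 * (1 + x\<^sup>2)) * (2 * (1 + y\<^sup>2)))"
        using pos by (intro mult_left_mono mult_mono sq sq1) auto
      also have "\<dots> = (4 * (1 + a) * (1 + \<bar>b\<bar> + d)) * ((1 + x\<^sup>2) * (1 + y\<^sup>2))" by (simp add: algebra_simps)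
      finally show "norm ((1 + \<bar>X1 \<omega>\<bar>) * (1 + \<bar>X2 \<omega>\<bar>)) \<le> norm ((4 * (1 + a) * (1 + \<bar>b\<bar> + d)) * ((1 + (fst \<omega>)\<^sup>2) * (1 + (snd \<omega>)\<^sup>2)))"
        by (simp add: \<omega>)
    qed
  qed measurable
  have rep: "(LINT \<omega>|(?N \<Otimes>\<^sub>M ?N). g \<omega> * exp (of_real x * (\<i> * of_real (X1 \<omega>) - of_int \<sigma>1) + of_real y * (\<i> * of_real (X2 \<omega>) - of_int \<sigma>2))) = gauss2 A B C x y" for x y
  proof -
    define \<alpha> where "\<alpha> = a * x + b * y"
    define \<beta> where "\<beta> = d * y"
    define k where "k = E - x * of_int \<sigma>1 - y * of_int \<sigma>2"
    have split: "g (u, v) * exp (of_real x * (\<i> * of_real (X1 (u, v)) - of_int \<sigma>1) + of_real y * (\<i> * of_real (X2 (u, v)) - of_int \<sigma>2))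
      = of_real (exp k) * (iexp ((\<alpha> - \<eta>1) * u) * iexp ((\<beta> - \<eta>2) * v))" for u v
      unfolding g_def exp_add[symmetric] exp_of_real[symmetric] X1_def X2_def k_def \<alpha>_def \<beta>_def
      by (rule arg_cong[of _ _ exp]) (simp add: algebra_simps)
    have "(LINT \<omega>|(?N \<Otimes>\<^sub>M ?N). g \<omega> * exp (of_real x * (\<i> * of_real (X1 \<omega>) - of_int \<sigma>1) + of_real y * (\<i> * of_real (X2 \<omega>) - of_int \<sigma>2)))
      = (LINT u|?N. (LINT v|?N. g (u, v) * exp (of_real x * (\<i> * of_real (X1 (u, v)) - of_int \<sigma>1) + of_real y * (\<i> * of_real (X2 (u, v)) - of_int \<sigma>2))))"
    proof (rule NN.integral_fst'[symmetric], rule NN.P.integrable_const_bound[where B = "exp E * exp (- x * of_int \<sigma>1 - y * of_int \<sigma>2)"])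
      show "AE \<omega> in ?N \<Otimes>\<^sub>M ?N. norm (g \<omega> * exp (of_real x * (\<i> * of_real (X1 \<omega>) - of_int \<sigma>1) + of_real y * (\<i> * of_real (X2 \<omega>) - of_int \<sigma>2))) \<le> exp E * exp (- x * of_int \<sigma>1 - y * of_int \<sigma>2)"
        by (intro AE_I2) (simp add: norm_mult gb mult_right_mono)
    qed measurable
    also have "\<dots> = of_real (exp k) * (char ?N (\<alpha> - \<eta>1) * char ?N (\<beta> - \<eta>2))"
      unfolding split char_def by (simp add: mult.assoc)
    also have "\<dots> = of_real (exp k * (exp (- (\<alpha> - \<eta>1)\<^sup>2 / 2) * exp (- (\<beta> - \<eta>2)\<^sup>2 / 2)))"
      unfolding char_std_normal_distribution by simp
    also have "exp k * (exp (- (\<alpha> - \<eta>1)\<^sup>2 / 2) * exp (- (\<beta> - \<eta>2)\<^sup>2 / 2)) = exp (- (A * x\<^sup>2 + 2 * B * x * y + C * y\<^sup>2) / 2)"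
    proof -
      have "\<alpha> * \<eta>1 + \<beta> * \<eta>2 = x * (a * \<eta>1) + y * (b * \<eta>1 + d * \<eta>2)" by (simp add: \<alpha>_def \<beta>_def algebra_simps)
      then have l: "\<alpha> * \<eta>1 + \<beta> * \<eta>2 = x * of_int \<sigma>1 + y * of_int \<sigma>2" unfolding e1 e2 .
      have q: "\<alpha>\<^sup>2 + \<beta>\<^sup>2 = A * x\<^sup>2 + 2 * B * x * y + C * y\<^sup>2"
        unfolding \<alpha>_def \<beta>_def a2[symmetric] ab[symmetric] C[symmetric] by (simp add: power2_eq_square algebra_simps)
      have "k + (- (\<alpha> - \<eta>1)\<^sup>2 / 2 + - (\<beta> - \<eta>2)\<^sup>2 / 2) = - (\<alpha>\<^sup>2 + \<beta>\<^sup>2) / 2 + (\<alpha> * \<eta>1 + \<beta> * \<eta>2 - x * of_int \<sigma>1 - y * of_int \<sigma>2)"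
        unfolding k_def E_def by (simp add: power2_eq_square field_simps)
      also have "\<dots> = - (A * x\<^sup>2 + 2 * B * x * y + C * y\<^sup>2) / 2" unfolding l q by simp
      finally show ?thesis unfolding exp_add[symmetric] by (rule arg_cong)
    qed
    finally show ?thesis unfolding gauss2_def .
  qed
  show ?thesis
    by (rule exI[of _ "?N \<Otimes>\<^sub>M ?N"], rule exI[of _ g], rule exI[of _ X1], rule exI[of _ X2], rule exI[of _ "exp E"])
       (intro conjI allI meas gb int rep NN.P.finite_measure_axioms)
qed

section \<open>Assembling the four quadrants\<close>

definition odd_pairs :: "(int \<times> int) set"
  where "odd_pairs = {(l1, l2). odd l1 \<and> odd l2}"

definition odd_box :: "nat \<Rightarrow> (int \<times> int) set"
  where "odd_box K = (\<lambda>((\<sigma>1, m), (\<sigma>2, n)). (odd_of \<sigma>1 m, odd_of \<sigma>2 n)) ` (({1, - 1} \<times> {..<K}) \<times> ({1, - 1} \<times> {..<K}))"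

lemma odd_of_inject:
  assumes "odd_of \<sigma> m = odd_of \<sigma>' m'" "\<sigma> \<in> {1, - 1}" "\<sigma>' \<in> {1, - 1}"
  shows "\<sigma> = \<sigma>' \<and> m = m'"
  using assms by (auto simp: odd_of_def)

lemma sum_odd_box:
  "(\<Sum>l\<in>odd_box K. f l) = (\<Sum>\<sigma>1\<in>{1, - 1}. \<Sum>\<sigma>2\<in>{1, - 1}. \<Sum>m<K. \<Sum>n<K. f (odd_of \<sigma>1 m, odd_of \<sigma>2 n))"
  for f :: "int \<times> int \<Rightarrow> complex"
proof -
  have "inj_on (\<lambda>((\<sigma>1, m), (\<sigma>2, n)). (odd_of \<sigma>1 m, odd_of \<sigma>2 n)) (({1, - 1} \<times> {..<K}) \<times> ({1, - 1} \<times> {..<K}))"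
  proof (rule inj_onI, goal_cases)
    case (1 p q)
    obtain \<sigma>1 m \<sigma>2 n where p: "p = ((\<sigma>1, m), (\<sigma>2, n))" by (cases p) auto
    obtain \<tau>1 m' \<tau>2 n' where q: "q = ((\<tau>1, m'), (\<tau>2, n'))" by (cases q) auto
    show ?case
      using odd_of_inject[of \<sigma>1 m \<tau>1 m'] odd_of_inject[of \<sigma>2 n \<tau>2 n'] 1 unfolding p q by simp
  qed
  then have "(\<Sum>l\<in>odd_box K. f l) = (\<Sum>((\<sigma>1, m), (\<sigma>2, n))\<in>({1, - 1} \<times> {..<K}) \<times> ({1, - 1} \<times> {..<K}). f (odd_of \<sigma>1 m, odd_of \<sigma>2 n))"
    unfolding odd_box_def by (subst sum.reindex) (simp_all add: case_prod_unfold)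
  also have "\<dots> = (\<Sum>p\<in>{1, - 1} \<times> {..<K}. \<Sum>q\<in>{1, - 1} \<times> {..<K}. f (odd_of (fst p) (snd p), odd_of (fst q) (snd q)))"
    by (simp only: sum.cartesian_product case_prod_unfold)
  also have "\<dots> = (\<Sum>\<sigma>1\<in>{1, - 1}. \<Sum>m<K. \<Sum>q\<in>{1, - 1} \<times> {..<K}. f (odd_of \<sigma>1 m, odd_of (fst q) (snd q)))"
    by (simp only: sum.cartesian_product[where A = "{1, - 1}" and B = "{..<K}"] case_prod_unfold)
  also have "\<dots> = (\<Sum>\<sigma>1\<in>{1, - 1}. \<Sum>m<K. \<Sum>\<sigma>2\<in>{1, - 1}. \<Sum>n<K. f (odd_of \<sigma>1 m, odd_of \<sigma>2 n))"
    by (intro sum.cong refl) (simp only: sum.cartesian_product[where A = "{1, - 1}" and B = "{..<K}"] case_prod_unfold)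
  also have "\<dots> = (\<Sum>\<sigma>1\<in>{1, - 1}. \<Sum>\<sigma>2\<in>{1, - 1}. \<Sum>m<K. \<Sum>n<K. f (odd_of \<sigma>1 m, odd_of \<sigma>2 n))"
    by (intro sum.cong refl sum.swap)
  finally show ?thesis .
qed

lemma odd_int_cases:
  assumes "odd (l :: int)" "\<bar>l\<bar> \<le> int K"
  shows "\<exists>\<sigma>\<in>{1, - 1}. \<exists>m<Suc K. l = odd_of \<sigma> m"
proof (cases "l \<ge> 0")
  case True
  then have "l = odd_of 1 (nat (l div 2))"
    using odd_two_times_div_two_succ[OF assms(1)] by (simp add: odd_of_def pos_imp_zdiv_nonneg_iff)
  moreover have "nat (l div 2) < Suc K" using assms(2) True by linarith
  ultimately show ?thesis by blast
next
  case False
  then have "l = odd_of (- 1) (nat ((- l) div 2))"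
    using odd_two_times_div_two_succ[of "- l"] assms(1) pos_imp_zdiv_nonneg_iff[of 2 "- l"] by (simp add: odd_of_def)
  moreover have "nat ((- l) div 2) < Suc K" using assms(2) False by linarith
  ultimately show ?thesis by blast
qed

text \<open>Every finite set of odd pairs lies in a box, so an unordered sum is also the limit along
  boxes, where it separates into quadrants.\<close>

lemma odd_box_exhausts: "filterlim odd_box (finite_subsets_at_top odd_pairs) sequentially"
  unfolding filterlim_finite_subsets_at_top
proof (intro allI impI)
  fix X :: "(int \<times> int) set" assume X: "finite X \<and> X \<subseteq> odd_pairs"
  define B where "B = (\<Sum>(l1, l2)\<in>X. nat \<bar>l1\<bar> + nat \<bar>l2\<bar>)"
  have B: "\<bar>l1\<bar> \<le> int B" "\<bar>l2\<bar> \<le> int B" if "(l1, l2) \<in> X" for l1 l2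
  proof -
    have "nat \<bar>l1\<bar> + nat \<bar>l2\<bar> \<le> B"
      using member_le_sum[of "(l1, l2)" X "\<lambda>(l1, l2). nat \<bar>l1\<bar> + nat \<bar>l2\<bar>"] that X unfolding B_def by simp
    then show "\<bar>l1\<bar> \<le> int B" "\<bar>l2\<bar> \<le> int B" by linarith+
  qed
  show "eventually (\<lambda>K. finite (odd_box K) \<and> X \<subseteq> odd_box K \<and> odd_box K \<subseteq> odd_pairs) sequentially"
    using eventually_ge_at_top[of "Suc B"]
  proof eventually_elim
    case (elim K)
    have "X \<subseteq> odd_box K"
    proof
      fix l assume "l \<in> X"
      then obtain l1 l2 where l: "l = (l1, l2)" "(l1, l2) \<in> X" by (cases l) auto
      then have "odd l1" "odd l2" using X by (auto simp: odd_pairs_def)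
      then obtain \<sigma>1 m \<sigma>2 n where "\<sigma>1 \<in> {1, - 1}" "m < Suc B" "l1 = odd_of \<sigma>1 m" "\<sigma>2 \<in> {1, - 1}" "n < Suc B" "l2 = odd_of \<sigma>2 n"
        using odd_int_cases[OF _ B(1)[OF l(2)]] odd_int_cases[OF _ B(2)[OF l(2)]] by blast
      then show "l \<in> odd_box K" unfolding odd_box_def l using elim
        by (intro image_eqI[where x = "((\<sigma>1, m), (\<sigma>2, n))"]) auto
    qed
    then show ?case by (auto simp: odd_box_def odd_pairs_def odd_of_def)
  qed
qed

lemma sgn_odd_of: "\<sigma> \<in> {1, - 1} \<Longrightarrow> sgn (odd_of \<sigma> m) = \<sigma>"
  by (auto simp: odd_of_def)

text \<open>The measure and the density \<open>g\<close> depend on the signs but not on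
  \<open>s\<close>. The total integral of \<open>g\<close> is the represented Gaussian at the
  origin, hence 1, so each quadrant tends to \<open>h1 * h2\<close>.\<close>

theorem odd_lattice_limit:
  fixes c1 :: "'i \<Rightarrow> complex" and c2 :: "'j \<Rightarrow> complex" and \<rho>1 :: "'i \<Rightarrow> real" and \<rho>2 :: "'j \<Rightarrow> real"
    and z1 z2 :: complex and A B C :: real
  assumes ABC: "A > 0" "A * C - B\<^sup>2 > 0"
    and z: "norm z1 = 1" "norm z2 = 1"
    and fin: "finite I1" "finite I2"
    and lim: "(node_factor z1 (expsum I1 c1 \<rho>1) \<longlongrightarrow> h1) (at 0)" "(node_factor z2 (expsum I2 c2 \<rho>2) \<longlongrightarrow> h2) (at 0)"
  defines "f \<equiv> \<lambda>s (l1, l2). of_int (sgn l1) * of_int (sgn l2) * z1 powi l1 * z2 powi l2 *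
      (\<Sum>i\<in>I1. \<Sum>j\<in>I2. c1 i * c2 j * gauss2 A B C (s * (of_int l1 + \<rho>1 i)) (s * (of_int l2 + \<rho>2 j)))"
  assumes summable: "\<And>s. s > 0 \<Longrightarrow> f s summable_on odd_pairs"
  shows "((\<lambda>s. infsum (f s) odd_pairs) \<longlongrightarrow> 4 * h1 * h2) (at_right 0)"
proof -
  have quad: "\<exists>Q. (\<forall>s>0. (\<lambda>K. \<Sum>m<K. \<Sum>n<K. f s (odd_of \<sigma>1 m, odd_of \<sigma>2 n)) \<longlonglongrightarrow> Q s) \<and> (Q \<longlongrightarrow> h1 * h2) (at_right 0)"
    if sg: "\<sigma>1 \<in> {1, - 1}" "\<sigma>2 \<in> {1, - 1}" for \<sigma>1 \<sigma>2
  proof -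
    obtain M :: "(real \<times> real) measure" and g X1 X2 G where M: "finite_measure M"
        and meas: "g \<in> borel_measurable M" "X1 \<in> borel_measurable M" "X2 \<in> borel_measurable M"
        and g: "\<And>\<omega>. norm (g \<omega>) \<le> G" and int: "integrable M (\<lambda>\<omega>. (1 + \<bar>X1 \<omega>\<bar>) * (1 + \<bar>X2 \<omega>\<bar> :: real))"
        and rep: "\<And>x y. (LINT \<omega>|M. g \<omega> * exp (of_real x * (\<i> * of_real (X1 \<omega>) - of_int \<sigma>1) + of_real y * (\<i> * of_real (X2 \<omega>) - of_int \<sigma>2))) = gauss2 A B C x y"
      using gauss2_representation[OF ABC, of \<sigma>1 \<sigma>2] by blast
    have sg': "\<sigma>1 = 1 \<or> \<sigma>1 = - 1" "\<sigma>2 = 1 \<or> \<sigma>2 = - 1" using sg by auto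
    define Q where "Q = (\<lambda>s. LINT \<omega>|M. g \<omega> * node_factor z1 (expsum I1 c1 \<rho>1) (of_real s * (\<i> * X1 \<omega> - of_int \<sigma>1))
         * node_factor z2 (expsum I2 c2 \<rho>2) (of_real s * (\<i> * X2 \<omega> - of_int \<sigma>2)))"
    have "(Q \<longlongrightarrow> h1 * h2 * (LINT \<omega>|M. g \<omega>)) (at_right 0)"
      unfolding Q_def by (rule node_factor_limit[OF meas g int sg' z fin lim])
    moreover have "(LINT \<omega>|M. g \<omega>) = 1" using rep[of 0 0] by (simp add: gauss2_def)
    moreover have "(\<lambda>K. \<Sum>m<K. \<Sum>n<K. f s (odd_of \<sigma>1 m, odd_of \<sigma>2 n)) \<longlonglongrightarrow> Q s" if "s > 0" for s
      using quadrant_sum[OF M meas g rep sg' z that fin, of c1 c2 \<rho>1 \<rho>2]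
      unfolding f_def Q_def by (simp add: sgn_odd_of[OF sg(1)] sgn_odd_of[OF sg(2)])
    ultimately show ?thesis by auto
  qed
  obtain Q where Q: "\<And>\<sigma>1 \<sigma>2 s. \<sigma>1 \<in> {1, - 1} \<Longrightarrow> \<sigma>2 \<in> {1, - 1} \<Longrightarrow> s > 0 \<Longrightarrow> (\<lambda>K. \<Sum>m<K. \<Sum>n<K. f s (odd_of \<sigma>1 m, odd_of \<sigma>2 n)) \<longlonglongrightarrow> Q \<sigma>1 \<sigma>2 s"
     "\<And>\<sigma>1 \<sigma>2. \<sigma>1 \<in> {1, - 1} \<Longrightarrow> \<sigma>2 \<in> {1, - 1} \<Longrightarrow> (Q \<sigma>1 \<sigma>2 \<longlongrightarrow> h1 * h2) (at_right 0)"
  proof -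
    define P where "P = (\<lambda>\<sigma>1 \<sigma>2 Q. (\<forall>s>0. (\<lambda>K. \<Sum>m<K. \<Sum>n<K. f s (odd_of \<sigma>1 m, odd_of \<sigma>2 n)) \<longlonglongrightarrow> Q s) \<and> (Q \<longlongrightarrow> h1 * h2) (at_right 0))"
    have "P \<sigma>1 \<sigma>2 (SOME Q. P \<sigma>1 \<sigma>2 Q)" if "\<sigma>1 \<in> {1, - 1}" "\<sigma>2 \<in> {1, - 1}" for \<sigma>1 \<sigma>2
    proof -
      have "\<exists>Q. P \<sigma>1 \<sigma>2 Q" unfolding P_def by (rule quad[OF that])
      then show ?thesis by (rule someI_ex[of "P \<sigma>1 \<sigma>2"])
    qed
    then show ?thesis using that[of "\<lambda>\<sigma>1 \<sigma>2. SOME Q. P \<sigma>1 \<sigma>2 Q"] unfolding P_def by blast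
  qed
  have inf: "infsum (f s) odd_pairs = (\<Sum>\<sigma>1\<in>{1, - 1}. \<Sum>\<sigma>2\<in>{1, - 1}. Q \<sigma>1 \<sigma>2 s)" if "s > 0" for s
  proof -
    have "(f s has_sum infsum (f s) odd_pairs) odd_pairs" using summable[OF that] by (rule has_sum_infsum)
    then have "(\<lambda>K. sum (f s) (odd_box K)) \<longlonglongrightarrow> infsum (f s) odd_pairs"
      unfolding has_sum_def by (rule filterlim_compose[OF _ odd_box_exhausts])
    moreover have "(\<lambda>K. sum (f s) (odd_box K)) \<longlonglongrightarrow> (\<Sum>\<sigma>1\<in>{1, - 1}. \<Sum>\<sigma>2\<in>{1, - 1}. Q \<sigma>1 \<sigma>2 s)"
      unfolding sum_odd_box by (intro tendsto_sum Q that)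
    ultimately show ?thesis by (rule LIMSEQ_unique)
  qed
  have "((\<lambda>s. \<Sum>\<sigma>1\<in>{1, - 1}. \<Sum>\<sigma>2\<in>{1, - 1}. Q \<sigma>1 \<sigma>2 s) \<longlongrightarrow> (\<Sum>\<sigma>1\<in>{1, - 1::int}. \<Sum>\<sigma>2\<in>{1, - 1::int}. h1 * h2)) (at_right 0)"
    by (intro tendsto_sum Q)
  then have "((\<lambda>s. infsum (f s) odd_pairs) \<longlongrightarrow> (\<Sum>\<sigma>1\<in>{1, - 1::int}. \<Sum>\<sigma>2\<in>{1, - 1::int}. h1 * h2)) (at_right 0)"
    by (rule Lim_transform_eventually) (use inf in \<open>auto intro!: eventually_at_rightI[of 0 1]\<close>)
  then show ?thesis by (simp add: mult.assoc)
qed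

section \<open>The linking matrix and its inverse\<close>

lemma linking_matrix_mult:
  "(linking_matrix w *v x) $ 1 = of_int (w $ 1) * x $ 1 + x $ 2 + x $ 3 + x $ 4"
  "(linking_matrix w *v x) $ 2 = x $ 1 + of_int (w $ 2) * x $ 2 + x $ 5 + x $ 6"
  "(linking_matrix w *v x) $ 3 = x $ 1 + of_int (w $ 3) * x $ 3"
  "(linking_matrix w *v x) $ 4 = x $ 1 + of_int (w $ 4) * x $ 4"
  "(linking_matrix w *v x) $ 5 = x $ 2 + of_int (w $ 5) * x $ 5"
  "(linking_matrix w *v x) $ 6 = x $ 2 + of_int (w $ 6) * x $ 6"
  by (simp_all add: matrix_vector_mult_def sum_6 linking_matrix_def H_edges_def doubleton_eq_iff)

lemma vec_eq_6: "x = y \<longleftrightarrow> x $ 1 = y $ 1 \<and> x $ 2 = y $ 2 \<and> x $ 3 = y $ 3 \<and> x $ 4 = y $ 4 \<and> x $ 5 = y $ 5 \<and> x $ 6 = y $ 6"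
  for x y :: "'a ^ 6"
  unfolding vec_eq_iff all_6 ..

lemma inner_6: "x \<bullet> y = x $ 1 * y $ 1 + x $ 2 * y $ 2 + x $ 3 * y $ 3 + x $ 4 * y $ 4 + x $ 5 * y $ 5 + x $ 6 * y $ 6"
  for x y :: "real ^ 6"
  by (simp add: inner_vec_def sum_6)

text \<open>The test vector is supported on a node and its leaves and makes the leaf entries of W x
  vanish; the form there equals the product of the two leaf weights times the pivot.\<close>

lemma negative_definite_node_pivots:
  fixes w :: "int ^ 6"
  assumes "negative_definite (linking_matrix w)" "\<And>v. w $ v < 0"
  shows "w $ 1 * (w $ 3 * w $ 4) - w $ 3 - w $ 4 < 0" "w $ 2 * (w $ 5 * w $ 6) - w $ 5 - w $ 6 < 0"
proof -
  have M: "w $ 3 * w $ 4 > 0" "w $ 5 * w $ 6 > 0" using assms(2) by (simp_all add: mult_neg_neg)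
  define x :: "real ^ 6" where "x = vector [of_int (w $ 3 * w $ 4), 0, - of_int (w $ 4), - of_int (w $ 3), 0, 0]"
  have "x \<noteq> 0" using assms(2)[of 3] assms(2)[of 4] by (auto simp: vec_eq_6 x_def vector_6)
  then have "x \<bullet> (linking_matrix w *v x) < 0" using assms(1) by (simp add: negative_definite_def)
  moreover have "x \<bullet> (linking_matrix w *v x) = of_int ((w $ 3 * w $ 4) * (w $ 1 * (w $ 3 * w $ 4) - w $ 3 - w $ 4))"
    unfolding inner_6 linking_matrix_mult unfolding x_def vector_6 by (simp add: algebra_simps)
  ultimately have "(w $ 3 * w $ 4) * (w $ 1 * (w $ 3 * w $ 4) - w $ 3 - w $ 4) < 0" by linarith
  then show "w $ 1 * (w $ 3 * w $ 4) - w $ 3 - w $ 4 < 0" using M(1) by (metis less_imp_le mult_nonneg_nonneg not_less)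
  define x' :: "real ^ 6" where "x' = vector [0, of_int (w $ 5 * w $ 6), 0, 0, - of_int (w $ 6), - of_int (w $ 5)]"
  have "x' \<noteq> 0" using assms(2)[of 5] assms(2)[of 6] by (auto simp: vec_eq_6 x'_def vector_6)
  then have "x' \<bullet> (linking_matrix w *v x') < 0" using assms(1) by (simp add: negative_definite_def)
  moreover have "x' \<bullet> (linking_matrix w *v x') = of_int ((w $ 5 * w $ 6) * (w $ 2 * (w $ 5 * w $ 6) - w $ 5 - w $ 6))"
    unfolding inner_6 linking_matrix_mult unfolding x'_def vector_6 by (simp add: algebra_simps)
  ultimately have "(w $ 5 * w $ 6) * (w $ 2 * (w $ 5 * w $ 6) - w $ 5 - w $ 6) < 0" by linarith
  then show "w $ 2 * (w $ 5 * w $ 6) - w $ 5 - w $ 6 < 0" using M(2) by (metis less_imp_le mult_nonneg_nonneg not_less)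
qed

section \<open>The determinant\<close>

definition rows6 :: "'a list list \<Rightarrow> 'a::zero ^ 6 ^ 6"
  where "rows6 rs = vector (map vector rs)"

lemma rows6_nth:
  "rows6 [r1, r2, r3, r4, r5, r6] $ 1 = vector r1" "rows6 [r1, r2, r3, r4, r5, r6] $ 2 = vector r2"
  "rows6 [r1, r2, r3, r4, r5, r6] $ 3 = vector r3" "rows6 [r1, r2, r3, r4, r5, r6] $ 4 = vector r4"
  "rows6 [r1, r2, r3, r4, r5, r6] $ 5 = vector r5" "rows6 [r1, r2, r3, r4, r5, r6] $ 6 = vector r6"
  by (simp_all add: rows6_def vector_6)

lemma linking_matrix_rows:
  "linking_matrix w = rows6
    [[of_int (w $ 1), 1, 1, 1, 0, 0], [1, of_int (w $ 2), 0, 0, 1, 1], [1, 0, of_int (w $ 3), 0, 0, 0],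
     [1, 0, 0, of_int (w $ 4), 0, 0], [0, 1, 0, 0, of_int (w $ 5), 0], [0, 1, 0, 0, 0, of_int (w $ 6)]]"
  unfolding vec_eq_6 rows6_nth vector_6 by (simp add: linking_matrix_def H_edges_def doubleton_eq_iff)

text \<open>As 6 = 0 in the numeral type, the index 6 is the smallest: triangularity refers to the
  order 6, 1, 2, 3, 4, 5.\<close>

lemma det_lower_6:
  fixes A :: "real ^ 6 ^ 6"
  assumes "A $ 6 $ 1 = 0" "A $ 6 $ 2 = 0" "A $ 6 $ 3 = 0" "A $ 6 $ 4 = 0" "A $ 6 $ 5 = 0" "A $ 1 $ 2 = 0" "A $ 1 $ 3 = 0" "A $ 1 $ 4 = 0" "A $ 1 $ 5 = 0" "A $ 2 $ 3 = 0" "A $ 2 $ 4 = 0" "A $ 2 $ 5 = 0" "A $ 3 $ 4 = 0" "A $ 3 $ 5 = 0" "A $ 4 $ 5 = 0"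
  shows "det A = A $ 1 $ 1 * A $ 2 $ 2 * A $ 3 $ 3 * A $ 4 $ 4 * A $ 5 $ 5 * A $ 6 $ 6"
proof (subst det_lowerdiagonal)
  have "\<forall>i j. i < j \<longrightarrow> A $ i $ j = 0"
    unfolding all_6 by (simp add: assms less_bit0_def bit0.Rep_numeral bit0.Rep_1)
  then show "A $ i $ j = 0" if "i < j" for i j using that by blast
qed (simp add: prod_6)

lemma det_upper_6:
  fixes A :: "real ^ 6 ^ 6"
  assumes "A $ 1 $ 6 = 0" "A $ 2 $ 6 = 0" "A $ 3 $ 6 = 0" "A $ 4 $ 6 = 0" "A $ 5 $ 6 = 0" "A $ 2 $ 1 = 0" "A $ 3 $ 1 = 0" "A $ 4 $ 1 = 0" "A $ 5 $ 1 = 0" "A $ 3 $ 2 = 0" "A $ 4 $ 2 = 0" "A $ 5 $ 2 = 0" "A $ 4 $ 3 = 0" "A $ 5 $ 3 = 0" "A $ 5 $ 4 = 0"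
  shows "det A = A $ 1 $ 1 * A $ 2 $ 2 * A $ 3 $ 3 * A $ 4 $ 4 * A $ 5 $ 5 * A $ 6 $ 6"
proof (subst det_upperdiagonal)
  have "\<forall>i j. i > j \<longrightarrow> A $ i $ j = 0"
    unfolding all_6 by (simp add: assms less_bit0_def bit0.Rep_numeral bit0.Rep_1)
  then show "A $ i $ j = 0" if "i > j" for i j using that by blast
qed (simp add: prod_6)

text \<open>Unipotent factors reduce the matrix to a lower triangular \<open>T\<close> in the index
  order 6, 1, ..., 5. Since 6 comes first, its edge to node 2 is cleared separately, by
  \<open>K\<close> from the right and \<open>L2\<close> from the left.\<close>

lemma det_linking_matrix:
  fixes w :: "int ^ 6"
  assumes nz: "w $ 3 \<noteq> 0" "w $ 4 \<noteq> 0" "w $ 5 \<noteq> 0" "w $ 6 \<noteq> 0" "w $ 2 * (w $ 5 * w $ 6) - w $ 5 - w $ 6 \<noteq> 0"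
  shows "det (linking_matrix w) = of_int ((w $ 1 * (w $ 3 * w $ 4) - w $ 3 - w $ 4) * (w $ 2 * (w $ 5 * w $ 6) - w $ 5 - w $ 6)
      - (w $ 3 * w $ 4) * (w $ 5 * w $ 6))"
proof -
  define a1 a2 a3 a4 a5 a6 where a: "a1 = real_of_int (w $ 1)" "a2 = real_of_int (w $ 2)" "a3 = real_of_int (w $ 3)"
    "a4 = real_of_int (w $ 4)" "a5 = real_of_int (w $ 5)" "a6 = real_of_int (w $ 6)"
  \<comment> \<open>The pivot left at node 2 once its leaves are eliminated; times
    \<open>a5 * a6\<close> it is the determinant of the subtree {2, 5, 6}.\<close>
  define s where "s = a2 - 1 / a5 - 1 / a6"
  have "s * (a5 * a6) = of_int (w $ 2 * (w $ 5 * w $ 6) - w $ 5 - w $ 6)"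
    using nz by (simp add: s_def a field_simps)
  then have s: "s \<noteq> 0" using nz(5) by (metis mult_zero_left of_int_eq_0_iff)
  have anz: "a3 \<noteq> 0" "a4 \<noteq> 0" "a5 \<noteq> 0" "a6 \<noteq> 0" using nz by (simp_all add: a)
  define L1 where "L1 = rows6 [[1, - 1 / s, - 1 / a3, - 1 / a4, 1 / (s * a5), 0], [0, 1, 0, 0, - 1 / a5, 0], [0, 0, 1, 0, 0, 0], [0, 0, 0, 1, 0, 0], [0, 0, 0, 0, 1, 0], [0, 0, 0, 0, 0, 1::real]]"
  define L2 where "L2 = rows6 [[1, 0, 0, 0, 0, 0], [0, 1, 0, 0, 0, - 1 / a6], [0, 0, 1, 0, 0, 0], [0, 0, 0, 1, 0, 0], [0, 0, 0, 0, 1, 0], [0, 0, 0, 0, 0, 1::real]]"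
  define K where "K = rows6 [[1, 0, 0, 0, 0, 0], [0, 1, 0, 0, 0, 0], [0, 0, 1, 0, 0, 0], [0, 0, 0, 1, 0, 0], [0, 0, 0, 0, 1, 0], [0, - 1 / a6, 0, 0, 0, 1::real]]"
  define T where "T = rows6 [[a1 - 1 / a3 - 1 / a4 - 1 / s, 0, 0, 0, 0, 0], [1, s, 0, 0, 0, 0], [1, 0, a3, 0, 0, 0], [1, 0, 0, a4, 0, 0], [0, 1, 0, 0, a5, 0], [0, 0, 0, 0, 0, a6]]"
  have a2: "a2 = s + 1 / a5 + 1 / a6" by (simp add: s_def)
  have 1: "linking_matrix w ** K = rows6
    [[a1, 1, 1, 1, 0, 0], [1, s + 1 / a5, 0, 0, 1, 1], [1, 0, a3, 0, 0, 0], [1, 0, 0, a4, 0, 0], [0, 1, 0, 0, a5, 0], [0, 0, 0, 0, 0, a6]]"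
    unfolding linking_matrix_rows a[symmetric] K_def vec_eq_6
    using anz by (simp add: matrix_matrix_mult_def sum_6 rows6_nth vector_6 a2)
  have 2: "L2 ** (linking_matrix w ** K) = rows6
    [[a1, 1, 1, 1, 0, 0], [1, s + 1 / a5, 0, 0, 1, 0], [1, 0, a3, 0, 0, 0], [1, 0, 0, a4, 0, 0], [0, 1, 0, 0, a5, 0], [0, 0, 0, 0, 0, a6]]"
    unfolding 1 L2_def vec_eq_6
    using anz by (simp add: matrix_matrix_mult_def sum_6 rows6_nth vector_6)
  have 3: "1 - (s + 1 / a5) / s + 1 / (s * a5) = 0"
    using anz s by (simp add: add_divide_distrib)
  have prod: "L1 ** (L2 ** (linking_matrix w ** K)) = T"
    unfolding 2 L1_def T_def vec_eq_6
    using anz s 3 by (simp add: matrix_matrix_mult_def sum_6 rows6_nth vector_6)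
  have "det L1 = 1"
    by (subst det_upper_6) (simp_all add: L1_def rows6_nth vector_6)
  moreover have "det L2 = 1"
    by (subst det_lower_6) (simp_all add: L2_def rows6_nth vector_6)
  moreover have "det K = 1"
    by (subst det_upper_6) (simp_all add: K_def rows6_nth vector_6)
  moreover have "det T = (a1 - 1 / a3 - 1 / a4 - 1 / s) * s * a3 * a4 * a5 * a6"
    by (subst det_lower_6) (simp_all add: T_def rows6_nth vector_6)
  ultimately have "det (linking_matrix w) = (a1 - 1 / a3 - 1 / a4 - 1 / s) * s * a3 * a4 * a5 * a6"
    using arg_cong[OF prod, of det] by (simp add: det_mul)
  also have "\<dots> = ((a1 - 1 / a3 - 1 / a4) * (a3 * a4)) * (s * (a5 * a6)) - a3 * a4 * (a5 * a6)"
    using s by (simp add: algebra_simps)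
  also have "(a1 - 1 / a3 - 1 / a4) * (a3 * a4) = a1 * (a3 * a4) - a3 - a4"
    using anz by (simp add: field_simps)
  also have "s * (a5 * a6) = a2 * (a5 * a6) - a5 - a6"
    using anz by (simp add: s_def field_simps)
  finally show ?thesis by (simp add: a)
qed

lemma linking_matrix_inverse:
  assumes "det (linking_matrix w) = 1" "linking_matrix w *v y = x"
  shows "matrix_inv (linking_matrix w) *v x = y"
proof -
  have "invertible (linking_matrix w)" using assms(1) by (simp add: invertible_det_nz)
  then have "matrix_inv (linking_matrix w) ** linking_matrix w = mat 1"
    unfolding invertible_def matrix_inv_def by (rule someI2_ex) simp
  then show ?thesis unfolding assms(2)[symmetric] by (simp add: matrix_vector_mul_assoc)
qed

text \<open>The form attains its maximum on the unit sphere, and this maximum is negative;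
  homogeneity does the rest.\<close>

lemma negative_definite_bound:
  fixes A :: "real ^ 'n ^ 'n"
  assumes "negative_definite A"
  shows "\<exists>c>0. \<forall>x. x \<bullet> (A *v x) \<le> - c * (norm x)\<^sup>2"
proof -
  have cont: "continuous_on S (\<lambda>x. x \<bullet> (A *v x))" for S
    by (intro continuous_intros linear_continuous_on matrix_vector_mul_bounded_linear)
  have "sphere (0 :: real ^ 'n) 1 \<noteq> {}" by simp
  then obtain x0 where x0: "x0 \<in> sphere (0 :: real ^ 'n) 1" "\<And>x. x \<in> sphere 0 1 \<Longrightarrow> x \<bullet> (A *v x) \<le> x0 \<bullet> (A *v x0)"
    using continuous_attains_sup[OF compact_sphere _ cont] by blast
  show ?thesis
  proof (intro exI[of _ "- (x0 \<bullet> (A *v x0))"] conjI allI)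
    have "x0 \<noteq> 0" using x0(1) by auto
    then show "- (x0 \<bullet> (A *v x0)) > 0" using assms by (simp add: negative_definite_def)
    fix x :: "real ^ 'n"
    show "x \<bullet> (A *v x) \<le> - (- (x0 \<bullet> (A *v x0))) * (norm x)\<^sup>2"
    proof (cases "x = 0")
      case False
      define u where "u = (1 / norm x) *\<^sub>R x"
      have xu: "x = norm x *\<^sub>R u" using False by (simp add: u_def)
      have "u \<in> sphere 0 1" using False by (simp add: u_def)
      then have "u \<bullet> (A *v u) \<le> x0 \<bullet> (A *v x0)" by (rule x0(2))
      moreover have "x \<bullet> (A *v x) = (norm x)\<^sup>2 * (u \<bullet> (A *v u))"
        by (subst (1 2) xu) (simp add: matrix_vector_mult_scaleR power2_eq_square)
      ultimately show ?thesis by (simp add: mult.commute mult_right_mono)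
    qed simp
  qed
qed

section \<open>The integral inverse and its quadratic form\<close>

context H_form
begin

definition "pp = w1 * (w3 * w4) - w3 - w4"
definition "rr = w2 * (w5 * w6) - w5 - w6"

lemma pp_rr: "pp = - P" "rr = - R" "pp * rr = M * N + 1"
  using unimod by (simp_all add: pp_def rr_def P_def R_def M_def N_def)

text \<open>The inverse of the linking matrix, by eliminating the leaves and solving the remaining
  two-by-two system; the divisions by \<open>w3\<close>, ..., \<open>w6\<close> are exact because the determinant is 1.\<close>

definition "side1 l1 l3 l4 = M * l1 - w4 * l3 - w3 * l4"
definition "side2 l2 l5 l6 = N * l2 - w6 * l5 - w5 * l6"
definition "inv1 l1 l2 l3 l4 l5 l6 = rr * side1 l1 l3 l4 - M * side2 l2 l5 l6"
definition "inv2 l1 l2 l3 l4 l5 l6 = pp * side2 l2 l5 l6 - N * side1 l1 l3 l4"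
definition "inv3 l1 l2 l3 l4 l5 l6 = - rr * w4 * l1 - (w4 * N - rr * (w1 * w4 - 1)) * l3 + rr * l4 + w4 * side2 l2 l5 l6"
definition "inv4 l1 l2 l3 l4 l5 l6 = - rr * w3 * l1 - (w3 * N - rr * (w1 * w3 - 1)) * l4 + rr * l3 + w3 * side2 l2 l5 l6"
definition "inv5 l1 l2 l3 l4 l5 l6 = - pp * w6 * l2 - (w6 * M - pp * (w2 * w6 - 1)) * l5 + pp * l6 + w6 * side1 l1 l3 l4"
definition "inv6 l1 l2 l3 l4 l5 l6 = - pp * w5 * l2 - (w5 * M - pp * (w2 * w5 - 1)) * l6 + pp * l5 + w5 * side1 l1 l3 l4"

lemma inverse_leaf_eqs:
  "l3 = w3 * inv3 l1 l2 l3 l4 l5 l6 + inv1 l1 l2 l3 l4 l5 l6"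
  "l4 = w4 * inv4 l1 l2 l3 l4 l5 l6 + inv1 l1 l2 l3 l4 l5 l6"
  "l5 = w5 * inv5 l1 l2 l3 l4 l5 l6 + inv2 l1 l2 l3 l4 l5 l6"
  "l6 = w6 * inv6 l1 l2 l3 l4 l5 l6 + inv2 l1 l2 l3 l4 l5 l6"
proof -
  \<comment> \<open>The relation \<open>pp * rr - M * N = 1\<close> in the four shapes that arise
    when the leaf equations are expanded.\<close>
  have a: "(rr * (w3 * (w1 * w4 - 1) - w4) - M * N) * x = x" and b: "(rr * (w4 * (w1 * w3 - 1) - w3) - M * N) * x = x"
    and c: "(pp * (w5 * (w2 * w6 - 1) - w6) - M * N) * x = x" and d: "(pp * (w6 * (w2 * w5 - 1) - w5) - M * N) * x = x" for x
    using pp_rr(3) by (simp_all add: pp_def rr_def algebra_simps)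
  show "l3 = w3 * inv3 l1 l2 l3 l4 l5 l6 + inv1 l1 l2 l3 l4 l5 l6"
    using a[of l3] unfolding inv3_def inv1_def side1_def M_def by (simp add: algebra_simps)
  show "l4 = w4 * inv4 l1 l2 l3 l4 l5 l6 + inv1 l1 l2 l3 l4 l5 l6"
    using b[of l4] unfolding inv4_def inv1_def side1_def M_def by (simp add: algebra_simps)
  show "l5 = w5 * inv5 l1 l2 l3 l4 l5 l6 + inv2 l1 l2 l3 l4 l5 l6"
    using c[of l5] unfolding inv5_def inv2_def side2_def N_def by (simp add: algebra_simps)
  show "l6 = w6 * inv6 l1 l2 l3 l4 l5 l6 + inv2 l1 l2 l3 l4 l5 l6"
    using d[of l6] unfolding inv6_def inv2_def side2_def N_def by (simp add: algebra_simps)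
qed

text \<open>Multiplied by \<open>M\<close>, the equation at node 1 contains \<open>w3 * y3\<close>
  and \<open>w4 * y4\<close>, which the leaf equations eliminate; with \<open>N\<close> the same
  happens at node 2. There remains a system in \<open>y1\<close>, \<open>y2\<close> of determinant
  \<open>pp * rr - M * N = 1\<close>.\<close>

lemma inverse_node_eqs:
  "l1 = w1 * inv1 l1 l2 l3 l4 l5 l6 + inv2 l1 l2 l3 l4 l5 l6 + inv3 l1 l2 l3 l4 l5 l6 + inv4 l1 l2 l3 l4 l5 l6"
  "l2 = w2 * inv2 l1 l2 l3 l4 l5 l6 + inv1 l1 l2 l3 l4 l5 l6 + inv5 l1 l2 l3 l4 l5 l6 + inv6 l1 l2 l3 l4 l5 l6"
proof -
  define y1 y2 y3 y4 y5 y6 where y: "y1 = inv1 l1 l2 l3 l4 l5 l6" "y2 = inv2 l1 l2 l3 l4 l5 l6" "y3 = inv3 l1 l2 l3 l4 l5 l6"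
    "y4 = inv4 l1 l2 l3 l4 l5 l6" "y5 = inv5 l1 l2 l3 l4 l5 l6" "y6 = inv6 l1 l2 l3 l4 l5 l6"
  note leaf = inverse_leaf_eqs[where ?l1.0 = l1 and ?l2.0 = l2 and ?l3.0 = l3 and ?l4.0 = l4 and ?l5.0 = l5 and ?l6.0 = l6, folded y]
  have "M * (w1 * y1 + y2 + y3 + y4) = w1 * M * y1 + M * y2 + w4 * (w3 * y3) + w3 * (w4 * y4)"
    by (simp add: M_def algebra_simps)
  also have "w3 * y3 = l3 - y1" using leaf(1) by simp
  also have "w4 * y4 = l4 - y1" using leaf(2) by simp
  also have "w1 * M * y1 + M * y2 + w4 * (l3 - y1) + w3 * (l4 - y1) = pp * y1 + M * y2 + w4 * l3 + w3 * l4"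
    by (simp add: pp_def M_def algebra_simps)
  also have "pp * y1 + M * y2 = (pp * rr - M * N) * side1 l1 l3 l4"
    unfolding y inv1_def inv2_def by (simp add: algebra_simps)
  also have "\<dots> + w4 * l3 + w3 * l4 = M * l1" by (simp add: pp_rr(3) side1_def)
  finally have "M * (w1 * y1 + y2 + y3 + y4) = M * l1" .
  then show "l1 = w1 * inv1 l1 l2 l3 l4 l5 l6 + inv2 l1 l2 l3 l4 l5 l6 + inv3 l1 l2 l3 l4 l5 l6 + inv4 l1 l2 l3 l4 l5 l6"
    using MNPR_pos(1) unfolding y by simp
  have "N * (w2 * y2 + y1 + y5 + y6) = w2 * N * y2 + N * y1 + w6 * (w5 * y5) + w5 * (w6 * y6)"
    by (simp add: N_def algebra_simps)
  also have "w5 * y5 = l5 - y2" using leaf(3) by simp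
  also have "w6 * y6 = l6 - y2" using leaf(4) by simp
  also have "w2 * N * y2 + N * y1 + w6 * (l5 - y2) + w5 * (l6 - y2) = rr * y2 + N * y1 + w6 * l5 + w5 * l6"
    by (simp add: rr_def N_def algebra_simps)
  also have "rr * y2 + N * y1 = (pp * rr - M * N) * side2 l2 l5 l6"
    unfolding y inv1_def inv2_def by (simp add: algebra_simps)
  also have "\<dots> + w6 * l5 + w5 * l6 = N * l2" by (simp add: pp_rr(3) side2_def)
  finally have "N * (w2 * y2 + y1 + y5 + y6) = N * l2" .
  then show "l2 = w2 * inv2 l1 l2 l3 l4 l5 l6 + inv1 l1 l2 l3 l4 l5 l6 + inv5 l1 l2 l3 l4 l5 l6 + inv6 l1 l2 l3 l4 l5 l6"
    using MNPR_pos(2) unfolding y by simp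
qed

definition dual_form :: "int \<Rightarrow> int \<Rightarrow> int \<Rightarrow> int \<Rightarrow> int \<Rightarrow> int \<Rightarrow> int"
  where "dual_form l1 l2 l3 l4 l5 l6 = l1 * inv1 l1 l2 l3 l4 l5 l6 + l2 * inv2 l1 l2 l3 l4 l5 l6 + l3 * inv3 l1 l2 l3 l4 l5 l6
    + l4 * inv4 l1 l2 l3 l4 l5 l6 + l5 * inv5 l1 l2 l3 l4 l5 l6 + l6 * inv6 l1 l2 l3 l4 l5 l6"

lemma e1_dual_form:
  assumes "c > 0" "even c"
  shows "e1 (- of_int (dual_form l1 l2 l3 l4 l5 l6) / (2 * of_int c)) = gauss_sum c l1 l2 l3 l4 l5 l6 / (\<i> * of_int c ^ 3)"
proof -
  have "gauss_sum c l1 l2 l3 l4 l5 l6 = e1 (- of_int (dual_form l1 l2 l3 l4 l5 l6) / (2 * of_int c)) * gauss_sum c 0 0 0 0 0 0"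
    unfolding dual_form_def by (rule gauss_sum_shift[OF assms inverse_node_eqs inverse_leaf_eqs])
  then show ?thesis using assms unfolding gauss_sum_0[OF assms] by simp
qed

text \<open>Eliminating the leaves leaves the inverse of the Schur complement, a negative form in
  the shifted node entries \<open>m1\<close> and \<open>m2\<close>. Each leaf adds
  \<open>l\<^sup>2 / w\<close> for its own entry and weight, a constant because
  \<open>l\<^sup>2 = 1\<close>.\<close>

lemma dual_form_squares:
  fixes l1 l2 l3 l4 l5 l6 :: int
  assumes "l3\<^sup>2 = 1" "l4\<^sup>2 = 1" "l5\<^sup>2 = 1" "l6\<^sup>2 = 1"
  defines "m1 \<equiv> real_of_int l1 + (- of_int l3 / of_int w3 - of_int l4 / of_int w4)"
    and "m2 \<equiv> real_of_int l2 + (- of_int l5 / of_int w5 - of_int l6 / of_int w6)"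
  shows "real_of_int (dual_form l1 l2 l3 l4 l5 l6) = - (of_int (R * M) * m1\<^sup>2 + 2 * of_int (M * N) * m1 * m2 + of_int (P * N) * m2\<^sup>2)
    + (1 / of_int w3 + 1 / of_int w4 + 1 / of_int w5 + 1 / of_int w6)"
proof -
  define y1 y2 y3 y4 y5 y6 where y: "y1 = inv1 l1 l2 l3 l4 l5 l6" "y2 = inv2 l1 l2 l3 l4 l5 l6" "y3 = inv3 l1 l2 l3 l4 l5 l6"
    "y4 = inv4 l1 l2 l3 l4 l5 l6" "y5 = inv5 l1 l2 l3 l4 l5 l6" "y6 = inv6 l1 l2 l3 l4 l5 l6"
  have nz: "real_of_int w3 \<noteq> 0" "real_of_int w4 \<noteq> 0" "real_of_int w5 \<noteq> 0" "real_of_int w6 \<noteq> 0" using leaf_neg by auto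
  note leaf = inverse_leaf_eqs[where ?l1.0 = l1 and ?l2.0 = l2 and ?l3.0 = l3 and ?l4.0 = l4 and ?l5.0 = l5 and ?l6.0 = l6, folded y]
  have div: "real_of_int b = (of_int a - of_int y) / of_int w" if "a = w * b + y" "real_of_int w \<noteq> 0" for a b w y :: int
    using that by (simp add: field_simps)
  have sq: "real_of_int l3 * of_int l3 = 1" "real_of_int l4 * of_int l4 = 1" "real_of_int l5 * of_int l5 = 1" "real_of_int l6 * of_int l6 = 1"
    using assms(1-4) by (simp_all only: of_int_mult[symmetric] power2_eq_square of_int_1)
  have tm: "real_of_int l * ((of_int l - x) / w) = 1 / w - x * (of_int l / w)" if "real_of_int l * of_int l = 1" for l :: int and x w :: real
    using that by (simp add: right_diff_distrib diff_divide_distrib)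
  have "real_of_int (dual_form l1 l2 l3 l4 l5 l6) = of_int l1 * of_int y1 + of_int l2 * of_int y2
     + of_int l3 * ((of_int l3 - of_int y1) / of_int w3) + of_int l4 * ((of_int l4 - of_int y1) / of_int w4)
     + of_int l5 * ((of_int l5 - of_int y2) / of_int w5) + of_int l6 * ((of_int l6 - of_int y2) / of_int w6)"
    unfolding dual_form_def y[symmetric] div[OF leaf(1) nz(1), symmetric] div[OF leaf(2) nz(2), symmetric] div[OF leaf(3) nz(3), symmetric] div[OF leaf(4) nz(4), symmetric] by simp
  also have "\<dots> = m1 * of_int y1 + m2 * of_int y2 + (1 / of_int w3 + 1 / of_int w4 + 1 / of_int w5 + 1 / of_int w6)"
    unfolding tm[OF sq(1)] tm[OF sq(2)] tm[OF sq(3)] tm[OF sq(4)] m1_def m2_def by (simp add: algebra_simps)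
  also have "real_of_int y1 = - of_int (R * M) * m1 - of_int (M * N) * m2"
  proof -
    have "real_of_int (side1 l1 l3 l4) = of_int M * m1" "real_of_int (side2 l2 l5 l6) = of_int N * m2"
      using nz by (simp_all add: side1_def side2_def m1_def m2_def M_def N_def field_simps)
    then show ?thesis unfolding y inv1_def pp_rr(2) by simp
  qed
  also have "real_of_int y2 = - of_int (P * N) * m2 - of_int (M * N) * m1"
  proof -
    have "real_of_int (side1 l1 l3 l4) = of_int M * m1" "real_of_int (side2 l2 l5 l6) = of_int N * m2"
      using nz by (simp_all add: side1_def side2_def m1_def m2_def M_def N_def field_simps)
    then show ?thesis unfolding y inv2_def pp_rr(1) by simp
  qed
  finally show ?thesis by (simp add: algebra_simps power2_eq_square)
qed

end

section \<open>The radial limit of the homological block\<close>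

locale H_block = H_form "w $ 1" "w $ 2" "w $ 3" "w $ 4" "w $ 5" "w $ 6" for w :: "int ^ 6" +
  fixes k :: nat
  assumes det_1: "det (linking_matrix w) = 1"
    and neg_def: "negative_definite (linking_matrix w)"
    and k_pos: "k > 0"
begin

lemma linking_matrix_inverse_int:
  fixes l :: "int ^ 6"
  defines "x \<equiv> (\<chi> v. of_int (l $ v)) :: real ^ 6"
  shows "x \<bullet> (matrix_inv (linking_matrix w) *v x) = of_int (dual_form (l $ 1) (l $ 2) (l $ 3) (l $ 4) (l $ 5) (l $ 6))"
proof -
  define y1 y2 y3 y4 y5 y6 where y: "y1 = inv1 (l $ 1) (l $ 2) (l $ 3) (l $ 4) (l $ 5) (l $ 6)" "y2 = inv2 (l $ 1) (l $ 2) (l $ 3) (l $ 4) (l $ 5) (l $ 6)"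
    "y3 = inv3 (l $ 1) (l $ 2) (l $ 3) (l $ 4) (l $ 5) (l $ 6)" "y4 = inv4 (l $ 1) (l $ 2) (l $ 3) (l $ 4) (l $ 5) (l $ 6)"
    "y5 = inv5 (l $ 1) (l $ 2) (l $ 3) (l $ 4) (l $ 5) (l $ 6)" "y6 = inv6 (l $ 1) (l $ 2) (l $ 3) (l $ 4) (l $ 5) (l $ 6)"
  define z :: "real ^ 6" where "z = vector [of_int y1, of_int y2, of_int y3, of_int y4, of_int y5, of_int y6]"
  have l: "l $ 1 = w $ 1 * y1 + y2 + y3 + y4" "l $ 2 = w $ 2 * y2 + y1 + y5 + y6" "l $ 3 = w $ 3 * y3 + y1"
    "l $ 4 = w $ 4 * y4 + y1" "l $ 5 = w $ 5 * y5 + y2" "l $ 6 = w $ 6 * y6 + y2"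
    unfolding y by (rule inverse_node_eqs inverse_leaf_eqs)+
  have "linking_matrix w *v z = x"
    unfolding vec_eq_6 linking_matrix_mult x_def vec_lambda_beta l unfolding z_def vector_6 by simp
  then have "matrix_inv (linking_matrix w) *v x = z" by (rule linking_matrix_inverse[OF det_1])
  then show ?thesis
    unfolding inner_6 dual_form_def y[symmetric] by (simp add: x_def z_def vector_6)
qed

lemma theta_coeff_explicit:
  "theta_coeff w (Complex a t) l = e1 (- of_int (dual_form (l $ 1) (l $ 2) (l $ 3) (l $ 4) (l $ 5) (l $ 6)) * a / 4)
     * of_real (exp (pi * t / 2 * of_int (dual_form (l $ 1) (l $ 2) (l $ 3) (l $ 4) (l $ 5) (l $ 6))))"
proof -
  have "ee (- of_real q / 4 * Complex a t) = e1 (- q * a / 4) * of_real (exp (pi * t / 2 * q))" for q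
    unfolding ee_def e1_def cis_conv_exp exp_of_real[symmetric] exp_add[symmetric] Complex_eq
    by (rule arg_cong[of _ _ exp]) (simp add: field_simps)
  then show ?thesis unfolding theta_coeff_def linking_matrix_inverse_int .
qed

text \<open>For x = W y the dual form at x is the form of W at y, at most
  \<open>- c * (norm y)\<^sup>2\<close>, while \<open>norm x \<le> K * norm y\<close>. The 36 is the
  square of the 6 in \<open>size1 l \<le> 6 * norm x\<close>.\<close>

lemma rapid_theta_coeff:
  assumes "t > 0"
  shows "rapid (theta_coeff w (Complex a t))"
proof -
  obtain c where c: "c > 0" "\<And>x. x \<bullet> (linking_matrix w *v x) \<le> - c * (norm x)\<^sup>2"
    using negative_definite_bound[OF neg_def] by blast
  obtain K where K: "K > 0" "\<And>x. norm (linking_matrix w *v x) \<le> norm x * K"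
    using bounded_linear.pos_bounded[OF matrix_vector_mul_bounded_linear[of "linking_matrix w"]] by blast
  define d where "d = pi * t / 2 * (c / (36 * K\<^sup>2))"
  have d: "d > 0" using assms c K by (simp add: d_def)
  show ?thesis
  proof (rule rapid_gaussian[OF d])
    fix l :: "int ^ 6"
    define x where "x = ((\<chi> v. of_int (l $ v)) :: real ^ 6)"
    define y where "y = matrix_inv (linking_matrix w) *v x"
    have Wy: "linking_matrix w *v y = x"
    proof -
      have "invertible (linking_matrix w)" using det_1 by (simp add: invertible_det_nz)
      then have "linking_matrix w ** matrix_inv (linking_matrix w) = mat 1"
        unfolding invertible_def matrix_inv_def by (rule someI2_ex) simp
      then show ?thesis by (simp add: y_def matrix_vector_mul_assoc)
    qed
    define q where "q = x \<bullet> (matrix_inv (linking_matrix w) *v x)"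
    have "real (size1 l) = (\<Sum>v\<in>UNIV. \<bar>x $ v\<bar>)"
      unfolding size1_def x_def by (simp add: sum_nonneg)
    also have "\<dots> \<le> (\<Sum>v\<in>(UNIV :: 6 set). norm x)" by (intro sum_mono component_le_norm_cart)
    finally have s1: "real (size1 l) \<le> 6 * norm x" by simp
    also have "\<dots> \<le> 6 * (norm y * K)" using K(2)[of y] unfolding Wy by simp
    finally have "(real (size1 l))\<^sup>2 \<le> (6 * (norm y * K))\<^sup>2" by (intro power_mono) auto
    then have "(real (size1 l))\<^sup>2 / (36 * K\<^sup>2) \<le> (norm y)\<^sup>2" using K(1) by (simp add: divide_simps power_mult_distrib mult_ac)
    then have "c * ((real (size1 l))\<^sup>2 / (36 * K\<^sup>2)) \<le> c * (norm y)\<^sup>2" using c(1) by (intro mult_left_mono) auto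
    moreover have "q \<le> - c * (norm y)\<^sup>2"
      using c(2)[of y] unfolding Wy by (simp add: q_def y_def inner_commute)
    ultimately have "q \<le> - (c * ((real (size1 l))\<^sup>2 / (36 * K\<^sup>2)))" by linarith
    then have "pi * t / 2 * q \<le> pi * t / 2 * - (c * ((real (size1 l))\<^sup>2 / (36 * K\<^sup>2)))"
      using assms by (intro mult_left_mono) auto
    then have "exp (pi * t / 2 * q) \<le> exp (- d * (real (size1 l))\<^sup>2)"
      unfolding exp_le_cancel_iff d_def by (simp add: mult_ac)
    moreover have "norm (theta_coeff w (Complex a t) l) = exp (pi * t / 2 * q)"
      unfolding theta_coeff_explicit q_def x_def linking_matrix_inverse_int norm_mult by simp
    ultimately show "norm (theta_coeff w (Complex a t) l) \<le> exp (- d * (real (size1 l))\<^sup>2)" by simp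
  qed
qed

end

section \<open>Separating nodes and leaves\<close>

definition signs :: "(int \<times> int) set"
  where "signs = {1, - 1} \<times> {1, - 1}"

text \<open>The nesting groups the nodes, the leaves of node 1 and the leaves of node 2, matching an
  infinite sum over node pairs with two finite sums over \<open>signs\<close> inside.\<close>

definition vec_of :: "(int \<times> int) \<times> (int \<times> int) \<times> (int \<times> int) \<Rightarrow> int ^ 6"
  where "vec_of = (\<lambda>((a, b), (c, d), (e, f)). vector [a, b, c, d, e, f])"

lemma vec_of_nth:
  "vec_of ((a, b), (c, d), (e, f)) $ 1 = a" "vec_of ((a, b), (c, d), (e, f)) $ 2 = b" "vec_of ((a, b), (c, d), (e, f)) $ 3 = c"
  "vec_of ((a, b), (c, d), (e, f)) $ 4 = d" "vec_of ((a, b), (c, d), (e, f)) $ 5 = e" "vec_of ((a, b), (c, d), (e, f)) $ 6 = f"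
  by (simp_all add: vec_of_def vector_6)

lemma vec_of_surj: "vec_of ((l $ 1, l $ 2), (l $ 3, l $ 4), (l $ 5, l $ 6)) = l"
  unfolding vec_eq_6 vec_of_nth by simp

lemma inj_vec_of: "inj vec_of"
proof (rule injI)
  fix x y assume eq: "vec_of x = vec_of y"
  obtain a b c d e f where x: "x = ((a, b), (c, d), (e, f))" by (metis prod.exhaust)
  obtain a' b' c' d' e' f' where y: "y = ((a', b'), (c', d'), (e', f'))" by (metis prod.exhaust)
  show "x = y" using eq unfolding vec_eq_6 x y vec_of_nth by simp
qed

lemma infsum_odd_vecs_leaves:
  fixes g :: "int ^ 6 \<Rightarrow> complex"
  assumes summable: "g summable_on odd_vecs"
    and zero: "\<And>l. g l \<noteq> 0 \<Longrightarrow> (l $ 3, l $ 4) \<in> signs \<and> (l $ 5, l $ 6) \<in> signs"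
  shows "infsum g odd_vecs = (\<Sum>\<^sub>\<infinity>p\<in>odd_pairs. \<Sum>i\<in>signs. \<Sum>j\<in>signs. g (vec_of (p, i, j)))"
proof -
  have fin: "finite signs" by (simp add: signs_def)
  have sub: "vec_of ` (odd_pairs \<times> (signs \<times> signs)) \<subseteq> odd_vecs"
    by (auto simp: odd_pairs_def signs_def odd_vecs_def all_6 vec_of_nth)
  have "infsum g odd_vecs = infsum g (vec_of ` (odd_pairs \<times> (signs \<times> signs)))"
  proof (rule infsum_cong_neutral)
    fix l assume l: "l \<in> odd_vecs - vec_of ` (odd_pairs \<times> (signs \<times> signs))"
    show "g l = 0"
    proof (rule ccontr)
      assume "g l \<noteq> 0"
      then have "(l $ 3, l $ 4) \<in> signs \<and> (l $ 5, l $ 6) \<in> signs" by (rule zero)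
      moreover have "(l $ 1, l $ 2) \<in> odd_pairs" using l by (auto simp: odd_vecs_def odd_pairs_def)
      ultimately have "vec_of ((l $ 1, l $ 2), (l $ 3, l $ 4), (l $ 5, l $ 6)) \<in> vec_of ` (odd_pairs \<times> (signs \<times> signs))"
        by (intro imageI) auto
      then show False using l unfolding vec_of_surj by simp
    qed
  qed (use sub in auto)
  also have "\<dots> = infsum (g \<circ> vec_of) (odd_pairs \<times> (signs \<times> signs))"
    by (rule infsum_reindex) (rule inj_on_subset[OF inj_vec_of], simp)
  also have "\<dots> = (\<Sum>\<^sub>\<infinity>p\<in>odd_pairs. \<Sum>\<^sub>\<infinity>ij\<in>signs \<times> signs. g (vec_of (p, ij)))"
  proof -
    have "g summable_on (vec_of ` (odd_pairs \<times> (signs \<times> signs)))"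
      by (rule summable_on_subset_banach[OF summable sub])
    then have "(g \<circ> vec_of) summable_on (odd_pairs \<times> (signs \<times> signs))"
      by (subst summable_on_reindex[symmetric]) (auto intro: inj_on_subset[OF inj_vec_of])
    then have "(\<lambda>(p, ij). g (vec_of (p, ij))) summable_on (Sigma odd_pairs (\<lambda>_. signs \<times> signs))"
      by (simp add: o_def case_prod_unfold)
    from infsum_Sigma'_banach[OF this] show ?thesis by (simp add: o_def case_prod_unfold)
  qed
  also have "\<dots> = (\<Sum>\<^sub>\<infinity>p\<in>odd_pairs. \<Sum>i\<in>signs. \<Sum>j\<in>signs. g (vec_of (p, i, j)))"
    using fin by (simp add: sum.cartesian_product case_prod_unfold)
  finally show ?thesis .
qed

lemma summable_on_vec_of:
  fixes g :: "int ^ 6 \<Rightarrow> complex"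
  assumes "g summable_on odd_vecs" "i \<in> signs" "j \<in> signs"
  shows "(\<lambda>p. g (vec_of (p, i, j))) summable_on odd_pairs"
proof -
  have inj: "inj_on (\<lambda>p. vec_of (p, i, j)) odd_pairs"
    by (rule inj_onI) (auto dest: injD[OF inj_vec_of])
  have "(\<lambda>p. vec_of (p, i, j)) ` odd_pairs \<subseteq> odd_vecs"
    using assms(2,3) by (auto simp: odd_pairs_def signs_def odd_vecs_def all_6 vec_of_nth)
  then have "g summable_on (\<lambda>p. vec_of (p, i, j)) ` odd_pairs" by (rule summable_on_subset_banach[OF assms(1)])
  then show ?thesis unfolding summable_on_reindex[OF inj] by (simp add: o_def)
qed

section \<open>Node factors near u = 0\<close>

lemma exp_difference_quotient:
  fixes b :: complex
  shows "((\<lambda>u. (exp (b * u) - exp (- (b * u))) / u) \<longlongrightarrow> 2 * b) (at 0)"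
proof -
  have "((\<lambda>u. exp (b * u) - exp (- (b * u))) has_field_derivative 2 * b) (at 0)"
    by (auto intro!: derivative_eq_intros)
  then show ?thesis by (simp add: has_field_derivative_iff)
qed

lemma node_factor_tendsto_regular:
  fixes z :: complex
  assumes "norm z = 1" "z\<^sup>2 \<noteq> 1"
  shows "(node_factor z (expsum I c \<rho>) \<longlongrightarrow> - (\<Sum>i\<in>I. c i) / (z - 1 / z)) (at 0)"
proof -
  have "z \<noteq> 0" using assms(1) by auto
  moreover have "z - 1 / z \<noteq> 0" using assms(2) \<open>z \<noteq> 0\<close> by (simp add: field_simps power2_eq_square)
  ultimately have "isCont (node_factor z (expsum I c \<rho>)) 0"
    unfolding node_factor_def expsum_def by (intro continuous_intros) auto
  then have "(node_factor z (expsum I c \<rho>) \<longlongrightarrow> node_factor z (expsum I c \<rho>) 0) (at 0)" by (simp add: isCont_def)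
  then show ?thesis by (simp add: node_factor_def expsum_def)
qed

text \<open>At \<open>z\<^sup>2 = 1\<close> the simple pole of the node factor meets the double zero of a product of two
  exponential differences.\<close>

lemma node_factor_tendsto_singular:
  fixes z K :: complex and b1 b2 :: real
  assumes "z\<^sup>2 = 1" "\<And>i j. (i, j) \<in> signs \<Longrightarrow> c (i, j) = K * of_int (i * j) \<and> \<rho> (i, j) = of_int i * b1 + of_int j * b2"
  shows "(node_factor z (expsum signs c \<rho>) \<longlongrightarrow> 0) (at 0)"
proof -
  have z: "z = 1 \<or> z = - 1" using assms(1) by (simp add: power2_eq_1_iff)
  define E where "E = (\<lambda>b u :: complex. exp (b * u) - exp (- (b * u)))"
  have ex: "expsum signs c \<rho> u = K * (E b1 u * E b2 u)" for u
  proof -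
    have "expsum signs c \<rho> u = (\<Sum>(i, j)\<in>signs. K * (of_int i * exp (of_int i * (b1 * u))) * (of_int j * exp (of_int j * (b2 * u))))"
      unfolding expsum_def
    proof (rule sum.cong)
      fix p assume p: "p \<in> signs"
      obtain i j where ij: "p = (i, j)" by (cases p)
      have "exp (u * of_real (\<rho> p)) = exp (of_int i * (b1 * u)) * exp (of_int j * (b2 * u))"
        unfolding exp_add[symmetric] using assms(2)[of i j] p ij by (intro arg_cong[of _ _ exp]) (simp add: algebra_simps)
      then show "c p * exp (u * of_real (\<rho> p)) = (case p of (i, j) \<Rightarrow> K * (of_int i * exp (of_int i * (b1 * u))) * (of_int j * exp (of_int j * (b2 * u))))"
        using assms(2)[of i j] p ij by (simp add: mult_ac)
    qed simp
    also have "\<dots> = K * (E b1 u * E b2 u)"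
      by (simp add: signs_def sum.cartesian_product[symmetric] E_def algebra_simps)
    finally show ?thesis .
  qed
  \<comment> \<open>Dividing by \<open>u\<close> above and below, one zero of the numerator cancels
    the pole; the other, \<open>E b1 u\<close>, forces the limit 0.\<close>
  have lim: "((\<lambda>u. - z * K * (E b1 u * ((E b2 u / u) / (E 1 u / u)))) \<longlongrightarrow> - z * K * (0 * ((2 * of_real b2) / (2 * 1)))) (at 0)"
  proof (intro tendsto_intros)
    have "isCont (E b1) 0" unfolding E_def by (intro continuous_intros)
    then show "(E b1 \<longlongrightarrow> 0) (at 0)" by (simp add: isCont_def E_def)
    show "((\<lambda>u. E b2 u / u) \<longlongrightarrow> 2 * of_real b2) (at 0)" "((\<lambda>u. E 1 u / u) \<longlongrightarrow> 2 * 1) (at 0)"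
      unfolding E_def by (rule exp_difference_quotient)+
  qed simp
  have "eventually (\<lambda>u::complex. u \<noteq> 0) (at 0)" by (simp add: eventually_at_filter)
  then have "eventually (\<lambda>u. - z * K * (E b1 u * ((E b2 u / u) / (E 1 u / u))) = node_factor z (expsum signs c \<rho>) u) (at 0)"
  proof eventually_elim
    case (elim u)
    have "z * exp u - 1 / (z * exp u) = z * E 1 u" using z by (auto simp: E_def exp_minus divide_inverse)
    then have "node_factor z (expsum signs c \<rho>) u = - (K * (E b1 u * E b2 u)) / (z * E 1 u)"
      unfolding node_factor_def ex by simp
    also have "\<dots> = - z * K * (E b1 u * (E b2 u / E 1 u))" using z by auto
    also have "E b2 u / E 1 u = (E b2 u / u) / (E 1 u / u)" using elim by simp
    finally show ?case by simp
  qed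
  from Lim_transform_eventually[OF lim this] show ?thesis by simp
qed

lemma has_sum_finite_sum:
  fixes f :: "'j \<Rightarrow> 'a \<Rightarrow> complex"
  assumes "\<And>j. j \<in> J \<Longrightarrow> (f j has_sum a j) A"
  shows "((\<lambda>x. \<Sum>j\<in>J. f j x) has_sum (\<Sum>j\<in>J. a j)) A"
  using assms by (induction J rule: infinite_finite_induct) (auto intro: has_sum_add)

lemma summable_on_finite_sum:
  fixes f :: "'j \<Rightarrow> 'a \<Rightarrow> complex"
  assumes "\<And>j. j \<in> J \<Longrightarrow> f j summable_on A"
  shows "(\<lambda>x. \<Sum>j\<in>J. f j x) summable_on A"
  using has_sum_finite_sum[of J f A "\<lambda>j. infsum (f j) A"] assms by (blast intro: has_sum_infsum has_sum_imp_summable)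

lemma leaf_sum_minus:
  assumes "c > 0" "even c"
  shows "leaf_sum c v (- u) = leaf_sum c v u"
proof -
  define f where "f = (\<lambda>x. e1 (of_int (v * x\<^sup>2) / (2 * of_int c) + of_int (u * x) / of_int c))"
  have "f (x + c) = f x" for x
    using e1_quadratic_periodic[of c v x 1 u] assms by (simp add: f_def)
  then have "(\<Sum>x=0..<c. f (- x)) = (\<Sum>x=0..<c. f x)" using assms(1) by (rule sum_int_neg)
  then show ?thesis unfolding leaf_sum_def f_def by simp
qed

lemma leaf_sum_add_mult:
  assumes "c > 0"
  shows "leaf_sum c v (u + c * j) = leaf_sum c v u"
  unfolding leaf_sum_def
proof (rule sum.cong)
  fix x
  show "e1 (of_int (v * x\<^sup>2) / (2 * of_int c) + of_int ((u + c * j) * x) / of_int c)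
      = e1 (of_int (v * x\<^sup>2) / (2 * of_int c) + of_int (u * x) / of_int c)"
    by (rule e1_eqI[where n = "j * x"]) (use assms in \<open>simp add: field_simps\<close>)
qed simp

section \<open>The block near the root of unity\<close>

context H_block
begin

text \<open>The modulus is 2k because q^(1/4) turns the dual form into
  \<open>dual_form / (4 * k)\<close>, which is \<open>dual_form / (2 * cc)\<close>; it is even, as
  the reciprocities require.\<close>

abbreviation "cc \<equiv> 2 * int k"

definition unit_root :: "int \<Rightarrow> complex"
  where "unit_root x = e1 (of_int x / of_int cc)"

definition branch :: "6 \<Rightarrow> int \<Rightarrow> complex"
  where "branch v x = leaf_sum cc (w $ v) x"

text \<open>For signs \<open>i\<close> and \<open>j\<close>, the factor \<open>i * j\<close> is
  \<open>leaf_coeff i * leaf_coeff j\<close>; the branches come from the leaf Gauss sums.\<close>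

definition node_coeff :: "6 \<Rightarrow> 6 \<Rightarrow> int \<Rightarrow> int \<times> int \<Rightarrow> complex"
  where "node_coeff a b x = (\<lambda>(i, j). of_int (i * j) * branch a (x + i) * branch b (x + j))"

definition node_shift :: "6 \<Rightarrow> 6 \<Rightarrow> int \<times> int \<Rightarrow> real"
  where "node_shift a b = (\<lambda>(i, j). - of_int i / of_int (w $ a) - of_int j / of_int (w $ b))"

definition node_limit :: "6 \<Rightarrow> 6 \<Rightarrow> int \<Rightarrow> complex"
  where "node_limit a b x = (if int k dvd x then 0
    else - ((branch a (x + 1) - branch a (x - 1)) * (branch b (x + 1) - branch b (x - 1))) / (unit_root x - 1 / unit_root x))"

lemma cc_pos: "cc > 0" "even cc" using k_pos by auto

lemma norm_unit_root: "norm (unit_root x) = 1" by (simp add: unit_root_def)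

lemma unit_root_square_eq_1_iff: "(unit_root x)\<^sup>2 = 1 \<longleftrightarrow> int k dvd x"
proof -
  have "(unit_root x)\<^sup>2 = e1 (of_int x / real k)"
    unfolding unit_root_def power2_eq_square e1_add[symmetric] using k_pos by (intro arg_cong[of _ _ e1]) (simp add: field_simps)
  also have "\<dots> = 1 \<longleftrightarrow> int k dvd x"
  proof
    assume "e1 (of_int x / real k) = 1"
    then obtain n where "of_int x / real k = of_int n" unfolding e1_eq_1_iff by (auto elim: Ints_cases)
    then have "real_of_int x = of_int (int k * n)" using k_pos by (simp add: field_simps)
    then show "int k dvd x" by (simp only: of_int_eq_iff) auto
  next
    assume "int k dvd x"
    then show "e1 (of_int x / real k) = 1" unfolding e1_eq_1_iff using k_pos by auto
  qed
  finally show ?thesis .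
qed

lemma unit_root_powi: "unit_root x powi n = e1 (of_int (x * n) / of_int cc)"
  unfolding unit_root_def e1_powi by (rule arg_cong[of _ _ e1]) simp

text \<open>The numbers \<open>- (x - 1)\<close> and \<open>x + 1\<close> agree modulo 2k, and the
  leaf sum is even and periodic. Hence the four coefficients at the node differ only in sign, which
  is what produces the double zero.\<close>

lemma branch_shift_eq:
  assumes "int k dvd x"
  shows "branch v (x - 1) = branch v (x + 1)"
proof -
  obtain m where x: "x = int k * m" using assms by auto
  have "branch v (x - 1) = branch v (- (x - 1))" unfolding branch_def using leaf_sum_minus[OF cc_pos, of _ "x - 1"] by simp
  also have "- (x - 1) = (x + 1) + cc * (- m)" by (simp add: x)
  also have "branch v \<dots> = branch v (x + 1)" unfolding branch_def by (rule leaf_sum_add_mult[OF cc_pos(1)])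
  finally show ?thesis .
qed

lemma node_factor_tendsto:
  "(node_factor (unit_root x) (expsum signs (node_coeff a b x) (node_shift a b)) \<longlongrightarrow> node_limit a b x) (at 0)"
proof (cases "int k dvd x")
  case True
  have "(node_factor (unit_root x) (expsum signs (node_coeff a b x) (node_shift a b)) \<longlongrightarrow> 0) (at 0)"
  proof (rule node_factor_tendsto_singular[where K = "branch a (x + 1) * branch b (x + 1)" and ?b1.0 = "- 1 / of_int (w $ a)" and ?b2.0 = "- 1 / of_int (w $ b)"])
    show "(unit_root x)\<^sup>2 = 1" using True unit_root_square_eq_1_iff by simp
    fix i j assume "(i, j) \<in> signs"
    then have "i = 1 \<or> i = - 1" "j = 1 \<or> j = - 1" by (auto simp: signs_def)
    then have "branch a (x + i) = branch a (x + 1)" "branch b (x + j) = branch b (x + 1)"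
      using branch_shift_eq[OF True] by auto
    then show "node_coeff a b x (i, j) = branch a (x + 1) * branch b (x + 1) * of_int (i * j) \<and>
       node_shift a b (i, j) = of_int i * (- 1 / of_int (w $ a)) + of_int j * (- 1 / of_int (w $ b))"
      by (simp add: node_coeff_def node_shift_def)
  qed
  then show ?thesis using True by (simp add: node_limit_def)
next
  case False
  have "(\<Sum>p\<in>signs. node_coeff a b x p) = (branch a (x + 1) - branch a (x - 1)) * (branch b (x + 1) - branch b (x - 1))"
    by (simp add: signs_def node_coeff_def sum.cartesian_product[symmetric] algebra_simps)
  then show ?thesis
    using node_factor_tendsto_regular[OF norm_unit_root, of x signs "node_coeff a b x" "node_shift a b"] unit_root_square_eq_1_iff[of x] False
    by (simp add: node_limit_def)
qed

definition "qA = real_of_int (R * M)"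
definition "qB = real_of_int (M * N)"
definition "qC = real_of_int (P * N)"

lemma qform_pos: "qA > 0" "qA * qC - qB\<^sup>2 > 0"
proof -
  show "qA > 0" using MNPR_pos by (simp add: qA_def)
  have "qA * qC - qB\<^sup>2 = of_int (M * N * (P * R - M * N))"
    by (simp add: qA_def qB_def qC_def power2_eq_square algebra_simps)
  also have "\<dots> > 0" unfolding PR using MNPR_pos by simp
  finally show "qA * qC - qB\<^sup>2 > 0" .
qed

definition "leaf_const = 1 / real_of_int (w $ 3) + 1 / of_int (w $ 4) + 1 / of_int (w $ 5) + 1 / of_int (w $ 6)"

text \<open>The real part 1/k of \<tau> yields the Gauss sum quotient, the imaginary part
  \<open>t\<close> the Gaussian at scale \<open>sqrt (pi * t)\<close>. The contribution of the
  leaves alone is the factor with \<open>leaf_const\<close>, which tends to 1.\<close>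

lemma theta_coeff_leaves:
  assumes t: "t > 0" and ij: "(e3, e4) \<in> signs" "(e5, e6) \<in> signs"
  shows "theta_coeff w (Complex (1 / real k) t) (vec_of ((l1, l2), (e3, e4), (e5, e6)))
    = gauss_sum cc l1 l2 e3 e4 e5 e6 / (\<i> * of_int cc ^ 3) * (of_real (exp (pi * t / 2 * leaf_const))
      * gauss2 qA qB qC (sqrt (pi * t) * (of_int l1 + node_shift 3 4 (e3, e4))) (sqrt (pi * t) * (of_int l2 + node_shift 5 6 (e5, e6))))"
proof -
  define q where "q = dual_form l1 l2 e3 e4 e5 e6"
  define m1 where "m1 = real_of_int l1 + (- of_int e3 / of_int (w $ 3) - of_int e4 / of_int (w $ 4))"
  define m2 where "m2 = real_of_int l2 + (- of_int e5 / of_int (w $ 5) - of_int e6 / of_int (w $ 6))"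
  have "e3\<^sup>2 = 1" "e4\<^sup>2 = 1" "e5\<^sup>2 = 1" "e6\<^sup>2 = 1" using ij by (auto simp: signs_def)
  then have q: "real_of_int q = - (qA * m1\<^sup>2 + 2 * qB * m1 * m2 + qC * m2\<^sup>2) + leaf_const"
    unfolding q_def m1_def m2_def qA_def qB_def qC_def leaf_const_def by (rule dual_form_squares)
  have "theta_coeff w (Complex (1 / real k) t) (vec_of ((l1, l2), (e3, e4), (e5, e6)))
    = e1 (- of_int q * (1 / real k) / 4) * of_real (exp (pi * t / 2 * of_int q))"
    unfolding theta_coeff_explicit vec_of_nth q_def ..
  also have "- of_int q * (1 / real k) / 4 = - of_int q / (2 * of_int cc)" by simp
  also have "e1 \<dots> = gauss_sum cc l1 l2 e3 e4 e5 e6 / (\<i> * of_int cc ^ 3)"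
    unfolding q_def by (rule e1_dual_form[OF cc_pos])
  also have "exp (pi * t / 2 * of_int q) = exp (pi * t / 2 * leaf_const) * exp (- (qA * (sqrt (pi * t) * m1)\<^sup>2
      + 2 * qB * (sqrt (pi * t) * m1) * (sqrt (pi * t) * m2) + qC * (sqrt (pi * t) * m2)\<^sup>2) / 2)"
  proof -
    define r where "r = sqrt (pi * t)"
    have r: "pi * t = r * r" using t by (simp add: r_def)
    show ?thesis unfolding exp_add[symmetric] q r_def[symmetric] unfolding r
      by (rule arg_cong[of _ _ exp]) (simp add: power2_eq_square field_simps)
  qed
  finally show ?thesis
    unfolding gauss2_def m1_def m2_def node_shift_def by simp
qed

definition lattice_term :: "int \<Rightarrow> int \<Rightarrow> real \<Rightarrow> int \<times> int \<Rightarrow> complex"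
  where "lattice_term x1 x2 = (\<lambda>s (l1, l2). of_int (sgn l1) * of_int (sgn l2) * unit_root x1 powi l1 * unit_root x2 powi l2 *
      (\<Sum>i\<in>signs. \<Sum>j\<in>signs. node_coeff 3 4 x1 i * node_coeff 5 6 x2 j
        * gauss2 qA qB qC (s * (of_int l1 + node_shift 3 4 i)) (s * (of_int l2 + node_shift 5 6 j))))"

text \<open>Inherited from the theta coefficients: the Gauss sum quotient has modulus 1, so their
  absolute values are these Gaussians up to a constant factor.\<close>

lemma gauss2_summable:
  assumes s: "s > 0" and ij: "i \<in> signs" "j \<in> signs"
  shows "(\<lambda>(l1, l2). gauss2 qA qB qC (s * (of_int l1 + node_shift 3 4 i)) (s * (of_int l2 + node_shift 5 6 j))) summable_on odd_pairs"
proof -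
  define t where "t = s\<^sup>2 / pi"
  have t: "t > 0" "sqrt (pi * t) = s" using s by (simp_all add: t_def)
  obtain e3 e4 e5 e6 where e: "i = (e3, e4)" "j = (e5, e6)" by (metis prod.exhaust)
  define g where "g = (\<lambda>l. complex_of_real (norm (theta_coeff w (Complex (1 / real k) t) l)))"
  have "rapid g" using rapid_theta_coeff[OF t(1)] unfolding rapid_def g_def by simp
  then have "(\<lambda>p. g (vec_of (p, i, j))) summable_on odd_pairs" by (intro summable_on_vec_of rapid_summable ij)
  then have "(\<lambda>p. g (vec_of (p, i, j)) * of_real (exp (- (pi * t / 2 * leaf_const)))) summable_on odd_pairs"
    by (rule summable_on_cmult_left)
  moreover have "g (vec_of ((l1, l2), i, j)) * of_real (exp (- (pi * t / 2 * leaf_const)))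
      = gauss2 qA qB qC (s * (of_int l1 + node_shift 3 4 i)) (s * (of_int l2 + node_shift 5 6 j))" for l1 l2
  proof -
    have "norm (gauss_sum cc l1 l2 e3 e4 e5 e6 / (\<i> * of_int cc ^ 3)) = 1"
      unfolding e1_dual_form[OF cc_pos, symmetric] by simp
    then have "norm (theta_coeff w (Complex (1 / real k) t) (vec_of ((l1, l2), i, j)))
      = exp (pi * t / 2 * leaf_const) * norm (gauss2 qA qB qC (s * (of_int l1 + node_shift 3 4 i)) (s * (of_int l2 + node_shift 5 6 j)))"
      unfolding e theta_coeff_leaves[OF t(1) ij[unfolded e]] norm_mult t(2) by (simp only: mult_1 norm_of_real abs_exp_cancel)
    moreover have "complex_of_real (norm (gauss2 qA qB qC x y)) = gauss2 qA qB qC x y" for x y by (simp add: gauss2_def)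
    ultimately show ?thesis unfolding g_def by (simp add: exp_minus field_simps)
  qed
  then have "(\<lambda>p. g (vec_of (p, i, j)) * of_real (exp (- (pi * t / 2 * leaf_const))))
     = (\<lambda>(l1, l2). gauss2 qA qB qC (s * (of_int l1 + node_shift 3 4 i)) (s * (of_int l2 + node_shift 5 6 j)))"
    by (auto simp: fun_eq_iff)
  ultimately show ?thesis by (simp only:)
qed

lemma lattice_term_summable:
  assumes s: "s > 0"
  shows "lattice_term x1 x2 s summable_on odd_pairs"
proof -
  have "(\<lambda>p. \<Sum>i\<in>signs. \<Sum>j\<in>signs. (of_int (sgn (fst p)) * of_int (sgn (snd p)) * unit_root x1 powi fst p * unit_root x2 powi snd p * node_coeff 3 4 x1 i * node_coeff 5 6 x2 j)
      * (case p of (l1, l2) \<Rightarrow> gauss2 qA qB qC (s * (of_int l1 + node_shift 3 4 i)) (s * (of_int l2 + node_shift 5 6 j)))) summable_on odd_pairs"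
  proof (intro summable_on_finite_sum)
    fix i j assume ij: "i \<in> signs" "j \<in> signs"
    define G where "G = (\<lambda>p. case p of (l1, l2) \<Rightarrow> gauss2 qA qB qC (s * (of_int l1 + node_shift 3 4 i)) (s * (of_int l2 + node_shift 5 6 j)))"
    have "G summable_on odd_pairs" unfolding G_def by (rule gauss2_summable[OF s ij])
    then have "(\<lambda>p. norm (G p)) summable_on odd_pairs" by (simp add: summable_on_iff_abs_summable_on_complex)
    then have "(\<lambda>p. norm (node_coeff 3 4 x1 i * node_coeff 5 6 x2 j) * norm (G p)) summable_on odd_pairs"
      by (rule summable_on_cmult_right)
    then have "(\<lambda>p. norm (of_int (sgn (fst p)) * of_int (sgn (snd p)) * unit_root x1 powi fst p * unit_root x2 powi snd p * node_coeff 3 4 x1 i * node_coeff 5 6 x2 j * G p)) summable_on odd_pairs"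
    proof (rule summable_on_comparison_test)
      fix p :: "int \<times> int"
      have 1: "norm (of_int (sgn (n::int)) :: complex) \<le> 1" for n by (simp add: sgn_if)
      have "norm (of_int (sgn (fst p)) * of_int (sgn (snd p)) * unit_root x1 powi fst p * unit_root x2 powi snd p :: complex) \<le> 1 * 1 * 1 * 1"
        unfolding norm_mult norm_power_int norm_unit_root by (intro mult_mono 1) auto
      then have "norm (of_int (sgn (fst p)) * of_int (sgn (snd p)) * unit_root x1 powi fst p * unit_root x2 powi snd p) * norm (node_coeff 3 4 x1 i * node_coeff 5 6 x2 j * G p)
         \<le> 1 * norm (node_coeff 3 4 x1 i * node_coeff 5 6 x2 j * G p)" by (intro mult_right_mono) auto
      then show "norm (of_int (sgn (fst p)) * of_int (sgn (snd p)) * unit_root x1 powi fst p * unit_root x2 powi snd p * node_coeff 3 4 x1 i * node_coeff 5 6 x2 j * G p)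
        \<le> norm (node_coeff 3 4 x1 i * node_coeff 5 6 x2 j) * norm (G p)"
        by (simp add: norm_mult mult.assoc)
    qed simp
    then show "(\<lambda>p. (of_int (sgn (fst p)) * of_int (sgn (snd p)) * unit_root x1 powi fst p * unit_root x2 powi snd p * node_coeff 3 4 x1 i * node_coeff 5 6 x2 j)
      * (case p of (l1, l2) \<Rightarrow> gauss2 qA qB qC (s * (of_int l1 + node_shift 3 4 i)) (s * (of_int l2 + node_shift 5 6 j)))) summable_on odd_pairs"
      unfolding G_def by (rule abs_summable_summable)
  qed
  then show ?thesis
    unfolding lattice_term_def by (simp add: case_prod_unfold sum_distrib_left mult.assoc)
qed

lemma lattice_term_limit:
  "((\<lambda>s. infsum (lattice_term x1 x2 s) odd_pairs) \<longlongrightarrow> 4 * node_limit 3 4 x1 * node_limit 5 6 x2) (at_right 0)"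
  unfolding lattice_term_def
proof (rule odd_lattice_limit[OF qform_pos norm_unit_root norm_unit_root])
  show "finite signs" "finite signs" by (simp_all add: signs_def)
qed (use lattice_term_summable[unfolded lattice_term_def] in \<open>auto intro: node_factor_tendsto\<close>)

definition kernel :: "int \<Rightarrow> int \<Rightarrow> complex"
  where "kernel x1 x2 = e1 (of_int (w $ 1 * x1\<^sup>2 + w $ 2 * x2\<^sup>2 + 2 * x1 * x2) / (2 * of_int cc))"

text \<open>Inserting the Gauss sums and exchanging the finite sums over \<open>x1\<close>,
  \<open>x2\<close> with the series gives, for each pair of residues, a false theta series twisted
  by pure characters of \<open>l1\<close> and \<open>l2\<close>.\<close>

lemma block_lattice_sum:
  assumes t: "t > 0"
  shows "homological_block w (Complex (1 / real k) t) = ee (of_int (- 18 - (\<Sum>v\<in>UNIV. w $ v)) / 4 * Complex (1 / real k) t)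
    * (of_real (exp (pi * t / 2 * leaf_const)) / (4 * \<i> * of_int cc ^ 3)
    * (\<Sum>x1=0..<cc. \<Sum>x2=0..<cc. kernel x1 x2 * infsum (lattice_term x1 x2 (sqrt (pi * t))) odd_pairs))"
proof -
  define \<tau> where "\<tau> = Complex (1 / real k) t"
  define s where "s = sqrt (pi * t)"
  have s: "s > 0" using t by (simp add: s_def)
  \<comment> \<open>The 4 comes from the two factors sgn / 2, the remaining denominator from
    \<open>gauss_sum_0\<close>.\<close>
  define \<kappa> where "\<kappa> = complex_of_real (exp (pi * t / 2 * leaf_const)) / (4 * \<i> * of_int cc ^ 3)"
  define g where "g = (\<lambda>l :: int ^ 6. theta_coeff w \<tau> l * leaf_coeff (l $ 6) * leaf_coeff (l $ 5) * leaf_coeff (l $ 4) * leaf_coeff (l $ 3)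
       * (of_int (sgn (l $ 2)) / 2) * (of_int (sgn (l $ 1)) / 2))"
  have rapid: "rapid (theta_coeff w \<tau>)" unfolding \<tau>_def by (rule rapid_theta_coeff[OF t])
  have lb: "norm (leaf_coeff n) \<le> 1" for n by (simp add: leaf_coeff_def)
  have sb: "norm (of_int (sgn n) / 2 :: complex) \<le> 1" for n by (simp add: sgn_if norm_divide)
  have "rapid g" unfolding g_def
    by (intro rapid_bounded_mult[where B = 1, OF _ lb] rapid_bounded_mult[where B = 1, OF _ sb] rapid)
  then have gs: "g summable_on odd_vecs" by (rule rapid_summable)
  have gterm: "(\<Sum>i\<in>signs. \<Sum>j\<in>signs. g (vec_of (p, i, j))) = \<kappa> * (\<Sum>x1=0..<cc. \<Sum>x2=0..<cc. kernel x1 x2 * lattice_term x1 x2 s p)" for p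
  proof -
    obtain l1 l2 where p: "p = (l1, l2)" by (cases p)
    define sg where "sg = complex_of_int (sgn l1) * of_int (sgn l2)"
    define G where "G = (\<lambda>i j. gauss2 qA qB qC (s * (of_int l1 + node_shift 3 4 i)) (s * (of_int l2 + node_shift 5 6 j)))"
    have one: "g (vec_of (p, i, j)) = (\<Sum>x1=0..<cc. \<Sum>x2=0..<cc. \<kappa> * (kernel x1 x2 * (sg * unit_root x1 powi l1 * unit_root x2 powi l2 * (node_coeff 3 4 x1 i * node_coeff 5 6 x2 j * G i j))))"
      if ij: "i \<in> signs" "j \<in> signs" for i j
    proof -
      obtain e3 e4 e5 e6 where e: "i = (e3, e4)" "j = (e5, e6)" by (metis prod.exhaust)
      have lc: "leaf_coeff e = - of_int e" if "e \<in> {1, - 1}" for e using that by (auto simp: leaf_coeff_def)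
      have es: "e3 \<in> {1, - 1}" "e4 \<in> {1, - 1}" "e5 \<in> {1, - 1}" "e6 \<in> {1, - 1}" using ij unfolding e signs_def by auto
      have "g (vec_of (p, i, j)) = gauss_sum cc l1 l2 e3 e4 e5 e6 * (\<kappa> * sg * (of_int e3 * of_int e4 * of_int e5 * of_int e6) * G i j)"
        unfolding g_def \<tau>_def p e theta_coeff_leaves[OF t ij[unfolded e]] vec_of_nth lc[OF es(1)] lc[OF es(2)] lc[OF es(3)] lc[OF es(4)]
        unfolding \<kappa>_def sg_def G_def s_def e by simp
      also have "\<dots> = (\<Sum>x1=0..<cc. \<Sum>x2=0..<cc. \<kappa> * (kernel x1 x2 * (sg * unit_root x1 powi l1 * unit_root x2 powi l2 * (node_coeff 3 4 x1 i * node_coeff 5 6 x2 j * G i j))))"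
        unfolding gauss_sum_def sum_distrib_right
      proof (intro sum.cong refl)
        fix x1 x2
        have ek: "e1 (of_int (w $ 1 * x1\<^sup>2 + w $ 2 * x2\<^sup>2 + 2 * x1 * x2) / (2 * of_int cc) + of_int (x1 * l1 + x2 * l2) / of_int cc)
           = kernel x1 x2 * (unit_root x1 powi l1 * unit_root x2 powi l2)"
          unfolding kernel_def unit_root_powi e1_add[symmetric] by (rule arg_cong[of _ _ e1]) (simp add: add_divide_distrib)
        show "e1 (of_int (w $ 1 * x1\<^sup>2 + w $ 2 * x2\<^sup>2 + 2 * x1 * x2) / (2 * of_int cc) + of_int (x1 * l1 + x2 * l2) / of_int cc)
           * (leaf_sum cc (w $ 3) (x1 + e3) * leaf_sum cc (w $ 4) (x1 + e4) * leaf_sum cc (w $ 5) (x2 + e5) * leaf_sum cc (w $ 6) (x2 + e6))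
           * (\<kappa> * sg * (of_int e3 * of_int e4 * of_int e5 * of_int e6) * G i j)
         = \<kappa> * (kernel x1 x2 * (sg * unit_root x1 powi l1 * unit_root x2 powi l2 * (node_coeff 3 4 x1 i * node_coeff 5 6 x2 j * G i j)))"
          unfolding ek unfolding e node_coeff_def branch_def prod.case of_int_mult by (simp only: mult_ac)
      qed
      finally show ?thesis .
    qed
    have "(\<Sum>i\<in>signs. \<Sum>j\<in>signs. g (vec_of (p, i, j))) = (\<Sum>i\<in>signs. \<Sum>j\<in>signs. \<Sum>x1=0..<cc. \<Sum>x2=0..<cc.
        \<kappa> * (kernel x1 x2 * (sg * unit_root x1 powi l1 * unit_root x2 powi l2 * (node_coeff 3 4 x1 i * node_coeff 5 6 x2 j * G i j))))"
      by (intro sum.cong refl one)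
    also have "\<dots> = (\<Sum>x1=0..<cc. \<Sum>x2=0..<cc. \<Sum>i\<in>signs. \<Sum>j\<in>signs.
        \<kappa> * (kernel x1 x2 * (sg * unit_root x1 powi l1 * unit_root x2 powi l2 * (node_coeff 3 4 x1 i * node_coeff 5 6 x2 j * G i j))))"
      by (simp only: sum.swap[of _ signs "{0..<cc}"])
    also have "\<dots> = \<kappa> * (\<Sum>x1=0..<cc. \<Sum>x2=0..<cc. kernel x1 x2 * lattice_term x1 x2 s p)"
      unfolding lattice_term_def p prod.case sg_def[symmetric] G_def sum_distrib_left ..
    finally show ?thesis .
  qed
  have "infsum g odd_vecs = (\<Sum>\<^sub>\<infinity>p\<in>odd_pairs. \<Sum>i\<in>signs. \<Sum>j\<in>signs. g (vec_of (p, i, j)))"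
  proof (rule infsum_odd_vecs_leaves[OF gs])
    fix l assume "g l \<noteq> 0"
    then show "(l $ 3, l $ 4) \<in> signs \<and> (l $ 5, l $ 6) \<in> signs"
      unfolding g_def leaf_coeff_def signs_def by (auto split: if_splits)
  qed
  also have "\<dots> = \<kappa> * (\<Sum>\<^sub>\<infinity>p\<in>odd_pairs. \<Sum>x1=0..<cc. \<Sum>x2=0..<cc. kernel x1 x2 * lattice_term x1 x2 s p)"
    unfolding gterm by (rule infsum_cmult_right')
  also have "(\<Sum>\<^sub>\<infinity>p\<in>odd_pairs. \<Sum>x1=0..<cc. \<Sum>x2=0..<cc. kernel x1 x2 * lattice_term x1 x2 s p)
     = (\<Sum>x1=0..<cc. \<Sum>x2=0..<cc. kernel x1 x2 * infsum (lattice_term x1 x2 s) odd_pairs)"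
  proof (rule infsumI, intro has_sum_finite_sum has_sum_cmult_right)
    show "(lattice_term x1 x2 s has_sum infsum (lattice_term x1 x2 s) odd_pairs) odd_pairs" for x1 x2
      using lattice_term_summable[OF s] by (rule has_sum_infsum)
  qed
  finally show ?thesis
    using homological_block_series[OF rapid] unfolding \<tau>_def[symmetric] g_def \<kappa>_def s_def by simp
qed

theorem homological_block_limit:
  "((\<lambda>t. homological_block w (Complex (1 / real k) t)) \<longlongrightarrow>
     e1 (of_int (- 18 - (\<Sum>v\<in>UNIV. w $ v)) / (4 * real k)) * (1 / (\<i> * of_int cc ^ 3)
     * (\<Sum>x1=0..<cc. \<Sum>x2=0..<cc. kernel x1 x2 * (node_limit 3 4 x1 * node_limit 5 6 x2)))) (at_right 0)"
proof -
  have sq: "filterlim (\<lambda>t. sqrt (pi * t)) (at_right 0) (at_right 0)"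
  proof -
    have "((\<lambda>t. sqrt (pi * t)) \<longlongrightarrow> sqrt (pi * 0)) (at_right 0)" by (intro tendsto_intros)
    then show ?thesis
      unfolding filterlim_at by (auto intro!: eventually_at_rightI[of 0 1])
  qed
  define \<alpha> where "\<alpha> = (of_int (- 18 - (\<Sum>v\<in>UNIV. w $ v)) / 4 :: complex)"
  have cplx: "((\<lambda>t. Complex (1 / real k) t) \<longlongrightarrow> Complex (1 / real k) 0) (at_right 0)"
    unfolding tendsto_complex_iff by (auto intro!: tendsto_intros)
  have "((\<lambda>t. ee (\<alpha> * Complex (1 / real k) t) * (of_real (exp (pi * t / 2 * leaf_const)) / (4 * \<i> * of_int cc ^ 3)
    * (\<Sum>x1=0..<cc. \<Sum>x2=0..<cc. kernel x1 x2 * infsum (lattice_term x1 x2 (sqrt (pi * t))) odd_pairs))) \<longlongrightarrow>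
    ee (\<alpha> * Complex (1 / real k) 0) * (of_real (exp (pi * 0 / 2 * leaf_const)) / (4 * \<i> * of_int cc ^ 3)
    * (\<Sum>x1=0..<cc. \<Sum>x2=0..<cc. kernel x1 x2 * (4 * node_limit 3 4 x1 * node_limit 5 6 x2)))) (at_right 0)"
    unfolding ee_def
    by (intro tendsto_mult tendsto_divide tendsto_exp tendsto_of_real tendsto_sum tendsto_const cplx tendsto_ident_at
        filterlim_compose[OF lattice_term_limit sq]) (use k_pos in auto)
  then have "((\<lambda>t. homological_block w (Complex (1 / real k) t)) \<longlongrightarrow>
    ee (\<alpha> * Complex (1 / real k) 0) * (of_real (exp (pi * 0 / 2 * leaf_const)) / (4 * \<i> * of_int cc ^ 3)
    * (\<Sum>x1=0..<cc. \<Sum>x2=0..<cc. kernel x1 x2 * (4 * node_limit 3 4 x1 * node_limit 5 6 x2)))) (at_right 0)"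
    by (rule Lim_transform_eventually) (auto intro!: eventually_at_rightI[of 0 1] simp: block_lattice_sum \<alpha>_def)
  also have "ee (\<alpha> * Complex (1 / real k) 0) = e1 (of_int (- 18 - (\<Sum>v\<in>UNIV. w $ v)) / (4 * real k))"
  proof -
    have "\<alpha> * Complex (1 / real k) 0 = of_real (of_int (- 18 - (\<Sum>v\<in>UNIV. w $ v)) / (4 * real k))"
      unfolding \<alpha>_def Complex_eq by simp
    then show ?thesis by (simp only: ee_of_real)
  qed
  also have "of_real (exp (pi * 0 / 2 * leaf_const)) / (4 * \<i> * of_int cc ^ 3)
    * (\<Sum>x1=0..<cc. \<Sum>x2=0..<cc. kernel x1 x2 * (4 * node_limit 3 4 x1 * node_limit 5 6 x2))
    = 1 / (\<i> * of_int cc ^ 3) * (\<Sum>x1=0..<cc. \<Sum>x2=0..<cc. kernel x1 x2 * (node_limit 3 4 x1 * node_limit 5 6 x2))"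
  proof -
    have "(\<Sum>x1=0..<cc. \<Sum>x2=0..<cc. kernel x1 x2 * (4 * node_limit 3 4 x1 * node_limit 5 6 x2))
      = 4 * (\<Sum>x1=0..<cc. \<Sum>x2=0..<cc. kernel x1 x2 * (node_limit 3 4 x1 * node_limit 5 6 x2))"
      unfolding sum_distrib_left by (simp only: mult_ac)
    then show ?thesis by simp
  qed
  finally show ?thesis .
qed

end

section \<open>The Witten--Reshetikhin--Turaev side\<close>

lemma H_degree_values: "H_degree 1 = 3" "H_degree 2 = 3" "H_degree 3 = 1" "H_degree 4 = 1" "H_degree 5 = 1" "H_degree 6 = 1"
proof -
  have "{e \<in> H_edges. 1 \<in> e} = {{1, 2}, {1, 3}, {1, 4}}" "{e \<in> H_edges. 2 \<in> e} = {{1, 2}, {2, 5}, {2, 6}}"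
    "{e \<in> H_edges. 3 \<in> e} = {{1, 3}}" "{e \<in> H_edges. 4 \<in> e} = {{1, 4}}" "{e \<in> H_edges. 5 \<in> e} = {{2, 5}}" "{e \<in> H_edges. 6 \<in> e} = {{2, 6}}"
    by (auto simp: H_edges_def)
  then show "H_degree 1 = 3" "H_degree 2 = 3" "H_degree 3 = 1" "H_degree 4 = 1" "H_degree 5 = 1" "H_degree 6 = 1"
    by (simp_all add: H_degree_def doubleton_eq_iff)
qed

lemma prod_H_edges: "(\<Prod>e\<in>H_edges. f e) = f {1, 2} * f {1, 3} * f {1, 4} * f {2, 5} * f {2, 6}"
  for f :: "6 set \<Rightarrow> complex"
  by (simp add: H_edges_def doubleton_eq_iff mult.assoc)

lemma edge_product_rearrange:
  fixes f1 :: complex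
  shows "f1 * (1 / r1) * (f2 * (1 / r2)) * (f3 * r3) * (f4 * r4) * (f5 * r5) * (f6 * r6)
      * (e12 * e13 * e14 * e25 * e26)
    = (f1 / r1 * (f2 / r2)) * e12 * ((f3 * r3 * e13) * (f4 * r4 * e14) * (f5 * r5 * e25) * (f6 * r6 * e26))"
  by (simp only: divide_inverse mult_1_left mult_ac)

lemma prefactor_rearrange:
  fixes A B D S T Z :: complex
  assumes "T = B * S" "A * B = D"
  shows "- \<i> * D / (16 * of_nat k ^ 3 * Z) * S = 1 / (2 * Z) * (A * (1 / (\<i> * of_int (2 * int k) ^ 3) * T))"
proof -
  define n where "n = inverse (of_nat k ^ 3 :: complex)"
  define z where "z = inverse Z"
  \<comment> \<open>At \<open>k = 0\<close> both sides are 0 by the convention for division by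
    zero.\<close>
  have inv: "1 / (\<i> * of_int (2 * int k) ^ 3) = - \<i> * n / 8"
    by (cases "k = 0") (simp_all add: n_def power_mult_distrib field_simps)
  have "- \<i> * D / (16 * of_nat k ^ 3 * Z) * S = - \<i> * D * n * z * S / 16"
    by (simp only: n_def z_def divide_inverse inverse_mult_distrib mult_ac)
  also have "\<dots> = z / 2 * (A * (- \<i> * n / 8 * T))"
    unfolding assms(1) assms(2)[symmetric] by (simp add: mult_ac)
  also have "z / 2 = 1 / (2 * Z)" by (simp only: z_def divide_inverse inverse_mult_distrib mult_1_left mult.commute)
  finally show ?thesis unfolding inv .
qed

lemma sum_Times: "(\<Sum>p\<in>A \<times> B. f p) = (\<Sum>x\<in>A. \<Sum>y\<in>B. f (x, y))"
  using sum.cartesian_product[of "\<lambda>x y. f (x, y)" B A] by simp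

lemma sum_vec_of:
  fixes f :: "int ^ 6 \<Rightarrow> complex"
  shows "(\<Sum>l | \<forall>v. l $ v \<in> S. f l) = (\<Sum>x1\<in>S. \<Sum>x2\<in>S. \<Sum>x3\<in>S. \<Sum>x4\<in>S. \<Sum>x5\<in>S. \<Sum>x6\<in>S. f (vec_of ((x1, x2), (x3, x4), (x5, x6))))"
proof -
  have "{l. \<forall>v. l $ v \<in> S} = vec_of ` ((S \<times> S) \<times> (S \<times> S) \<times> (S \<times> S))"
  proof (rule set_eqI, rule iffI)
    fix l :: "int ^ 6" assume "l \<in> {l. \<forall>v. l $ v \<in> S}"
    then have "vec_of ((l $ 1, l $ 2), (l $ 3, l $ 4), (l $ 5, l $ 6)) \<in> vec_of ` ((S \<times> S) \<times> (S \<times> S) \<times> (S \<times> S))"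
      by (intro imageI) auto
    then show "l \<in> vec_of ` ((S \<times> S) \<times> (S \<times> S) \<times> (S \<times> S))" unfolding vec_of_surj .
  qed (auto simp: all_6 vec_of_nth)
  then have "(\<Sum>l | \<forall>v. l $ v \<in> S. f l) = (\<Sum>p\<in>(S \<times> S) \<times> (S \<times> S) \<times> (S \<times> S). f (vec_of p))"
    using sum.reindex[of vec_of "(S \<times> S) \<times> (S \<times> S) \<times> (S \<times> S)" f] inj_on_subset[OF inj_vec_of] by simp
  also have "\<dots> = (\<Sum>x1\<in>S. \<Sum>x2\<in>S. \<Sum>x3\<in>S. \<Sum>x4\<in>S. \<Sum>x5\<in>S. \<Sum>x6\<in>S. f (vec_of ((x1, x2), (x3, x4), (x5, x6))))"
    by (simp only: sum_Times)
  finally show ?thesis .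
qed

section \<open>Residue sums of the invariant\<close>

context H_block
begin

lemma unit_root_minus: "unit_root (- x) = 1 / unit_root x"
  by (simp add: unit_root_def e1_minus inverse_eq_divide)

lemma unit_root_nonzero [simp]: "unit_root x \<noteq> 0"
  by (simp add: unit_root_def)

lemma unit_root_mult: "unit_root x * unit_root y = unit_root (x + y)"
  unfolding unit_root_def e1_add[symmetric] by (simp add: add_divide_distrib)

lemma unit_root_periodic: "unit_root (x + cc * j) = unit_root x"
  unfolding unit_root_def by (rule e1_eqI[where n = j]) (use k_pos in \<open>simp add: field_simps\<close>)

definition framing :: "6 \<Rightarrow> int \<Rightarrow> complex"
  where "framing v x = e1 (of_int (w $ v * (x\<^sup>2 - 1)) / (4 * real k))"

definition edge :: "int \<Rightarrow> int \<Rightarrow> complex"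
  where "edge x y = (unit_root (x * y) - unit_root (- (x * y))) / 2"

definition root_diff :: "int \<Rightarrow> complex"
  where "root_diff x = unit_root x - 1 / unit_root x"

lemma framing_periodic: "framing v (x + cc * j) = framing v x"
  unfolding framing_def
  by (rule e1_eqI[where n = "w $ v * (x * j + int k * j\<^sup>2)"]) (use k_pos in \<open>simp add: field_simps power2_eq_square\<close>)

lemma framing_minus: "framing v (- x) = framing v x"
  by (simp add: framing_def)

lemma root_diff_minus: "root_diff (- x) = - root_diff x"
  by (simp add: root_diff_def unit_root_minus)

lemma root_diff_periodic: "root_diff (x + cc * j) = root_diff x"
  by (simp only: root_diff_def unit_root_periodic)

lemma root_diff_eq_0: "int k dvd x \<Longrightarrow> root_diff x = 0"
  using unit_root_square_eq_1_iff[of x] by (simp add: root_diff_def field_simps power2_eq_square)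

lemma branch_minus: "branch v (- x) = branch v x"
  unfolding branch_def by (rule leaf_sum_minus[OF cc_pos])

lemma branch_periodic: "branch v (x + cc * j) = branch v x"
  unfolding branch_def by (rule leaf_sum_add_mult[OF cc_pos(1)])

text \<open>The value of a WRT leaf sum when the adjacent node carries \<open>y\<close>. The two
  Gauss sums come from the two exponentials in \<open>root_diff\<close>, the constant from the -1 in
  \<open>x\<^sup>2 - 1\<close>.\<close>

definition leaf_diff :: "6 \<Rightarrow> int \<Rightarrow> complex"
  where "leaf_diff v y = e1 (- of_int (w $ v) / (4 * real k)) * (branch v (y + 1) - branch v (y - 1))"

lemma leaf_diff_minus: "leaf_diff v (- y) = - leaf_diff v y"
proof -
  have "- y + 1 = - (y - 1)" "- y - 1 = - (y + 1)" by simp_all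
  then have "branch v (- y + 1) = branch v (y - 1)" "branch v (- y - 1) = branch v (y + 1)"
    by (simp_all only: branch_minus)
  then show ?thesis unfolding leaf_diff_def by (simp only: right_diff_distrib minus_diff_eq)
qed

lemma leaf_diff_periodic: "leaf_diff v (y + cc * j) = leaf_diff v y"
  using branch_periodic[of v "y + 1" j] branch_periodic[of v "y - 1" j] by (simp add: leaf_diff_def algebra_simps)

definition "units = {x \<in> {0..<cc}. \<not> int k dvd x}"

lemma sum_units: "(\<Sum>x\<in>units. f x) = (\<Sum>x=0..<cc. if int k dvd x then 0 else f x)" for f :: "int \<Rightarrow> complex"
  unfolding units_def by (rule sum.mono_neutral_cong_left) auto

text \<open>An odd periodic weight antisymmetrises the character for free.\<close>

lemma odd_sum_edge:
  assumes "\<And>x. f (x + cc) = f x" "\<And>x. f (- x) = - f x"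
  shows "(\<Sum>x=0..<cc. f x * edge x y) = (\<Sum>x=0..<cc. f x * unit_root (x * y))"
proof -
  define g where "g = (\<lambda>x. f x * unit_root (- (x * y)))"
  have "g (x + cc) = g x" for x
    using unit_root_periodic[of "- (x * y)" "- y"] assms(1) by (simp add: g_def algebra_simps)
  then have "(\<Sum>x=0..<cc. g (- x)) = (\<Sum>x=0..<cc. g x)" using cc_pos(1) by (rule sum_int_neg)
  then have eq: "(\<Sum>x=0..<cc. f x * unit_root (- (x * y))) = - (\<Sum>x=0..<cc. f x * unit_root (x * y))"
    by (simp add: g_def assms(2) sum_negf)
  have "(\<Sum>x=0..<cc. f x * edge x y) = ((\<Sum>x=0..<cc. f x * unit_root (x * y)) - (\<Sum>x=0..<cc. f x * unit_root (- (x * y)))) / 2"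
    unfolding edge_def sum_subtractf[symmetric] sum_divide_distrib by (simp add: algebra_simps)
  then show ?thesis unfolding eq by simp
qed

text \<open>At multiples of \<open>k\<close> the factor \<open>root_diff\<close> vanishes, so the
  sum extends to all residues. The weight is odd, so \<open>edge\<close> may be replaced by a
  character, on which \<open>root_diff\<close> acts by shifting \<open>y\<close> by 1 and
  -1.\<close>

lemma leaf_unit_sum: "(\<Sum>x\<in>units. framing v x * root_diff x * edge y x) = leaf_diff v y"
proof -
  define f where "f = (\<lambda>x. framing v x * root_diff x)"
  have f: "f (x + cc) = f x" "f (- x) = - f x" for x
    using framing_periodic[of v x 1] root_diff_periodic[of x 1] by (simp_all add: f_def framing_minus root_diff_minus)
  have "(\<Sum>x\<in>units. framing v x * root_diff x * edge y x) = (\<Sum>x=0..<cc. f x * edge x y)"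
    unfolding sum_units f_def by (intro sum.cong refl) (simp add: root_diff_eq_0 edge_def mult.commute)
  also have "\<dots> = (\<Sum>x=0..<cc. f x * unit_root (x * y))"
    by (rule odd_sum_edge[OF f])
  also have "\<dots> = (\<Sum>x=0..<cc. e1 (- of_int (w $ v) / (4 * real k)) *
      (e1 (of_int (w $ v * x\<^sup>2) / (2 * of_int cc) + of_int ((y + 1) * x) / of_int cc) - e1 (of_int (w $ v * x\<^sup>2) / (2 * of_int cc) + of_int ((y - 1) * x) / of_int cc)))"
  proof (intro sum.cong refl)
    fix x
    have fr: "framing v x = e1 (- of_int (w $ v) / (4 * real k)) * e1 (of_int (w $ v * x\<^sup>2) / (2 * of_int cc))"
      unfolding framing_def e1_add[symmetric] using k_pos by (intro arg_cong[of _ _ e1]) (simp add: field_simps)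
    have "root_diff x * unit_root (x * y) = unit_root ((y + 1) * x) - unit_root ((y - 1) * x)"
      unfolding root_diff_def unit_root_minus[symmetric] by (simp only: left_diff_distrib unit_root_mult) (simp add: algebra_simps)
    then show "f x * unit_root (x * y) = e1 (- of_int (w $ v) / (4 * real k)) *
      (e1 (of_int (w $ v * x\<^sup>2) / (2 * of_int cc) + of_int ((y + 1) * x) / of_int cc) - e1 (of_int (w $ v * x\<^sup>2) / (2 * of_int cc) + of_int ((y - 1) * x) / of_int cc))"
      unfolding f_def fr e1_add unit_root_def[symmetric] by (simp only: mult.assoc right_diff_distrib)
  qed
  also have "\<dots> = leaf_diff v y"
    unfolding leaf_diff_def branch_def leaf_sum_def by (simp only: sum_distrib_left sum_subtractf right_diff_distrib)
  finally show ?thesis .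
qed

lemma zeta_half: "zeta k (of_int x / 2) = unit_root x" "zeta k (- of_int x / 2) = unit_root (- x)"
  by (simp_all add: zeta_e1 unit_root_def mult.commute)

lemma wrt_summand_vec_of:
  "wrt_summand k w (vec_of ((x1, x2), (x3, x4), (x5, x6))) =
    (framing 1 x1 / root_diff x1 * (framing 2 x2 / root_diff x2)) * edge x1 x2 *
    ((framing 3 x3 * root_diff x3 * edge x1 x3) * (framing 4 x4 * root_diff x4 * edge x1 x4)
     * (framing 5 x5 * root_diff x5 * edge x2 x5) * (framing 6 x6 * root_diff x6 * edge x2 x6))"
proof -
  have fr: "zeta k (of_int (w $ v * (x\<^sup>2 - 1)) / 4) = framing v x" for v x
    by (simp add: zeta_e1 framing_def mult.commute)
  have pe: "(\<Prod>v\<in>{1, 2}. vec_of ((x1, x2), (x3, x4), (x5, x6)) $ v) = x1 * x2" "(\<Prod>v\<in>{1, 3}. vec_of ((x1, x2), (x3, x4), (x5, x6)) $ v) = x1 * x3"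
    "(\<Prod>v\<in>{1, 4}. vec_of ((x1, x2), (x3, x4), (x5, x6)) $ v) = x1 * x4" "(\<Prod>v\<in>{2, 5}. vec_of ((x1, x2), (x3, x4), (x5, x6)) $ v) = x2 * x5"
    "(\<Prod>v\<in>{2, 6}. vec_of ((x1, x2), (x3, x4), (x5, x6)) $ v) = x2 * x6"
    by (simp_all add: vec_of_nth)
  have deg: "(1 / a) powi (int 3 - 2) = 1 / a" "(1 / a) powi (int 1 - 2) = a" for a :: complex
    by (simp_all add: power_int_minus)
  show ?thesis
    unfolding wrt_summand_def prod_6 prod_H_edges H_degree_values pe vec_of_nth fr zeta_half edge_def[symmetric]
    unfolding unit_root_minus root_diff_def[symmetric] deg
    by (rule edge_product_rearrange)
qed

text \<open>Set to 0 at multiples of \<open>k\<close>, where \<open>root_diff\<close> vanishes, so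
  that it is an odd periodic function on all residues and \<open>odd_sum_edge\<close>
  applies.\<close>

definition node_weight :: "6 \<Rightarrow> 6 \<Rightarrow> 6 \<Rightarrow> int \<Rightarrow> complex"
  where "node_weight v a b x = (if int k dvd x then 0 else framing v x / root_diff x * leaf_diff a x * leaf_diff b x)"

lemma node_weight_periodic: "node_weight v a b (x + cc) = node_weight v a b x"
proof -
  have "int k dvd x + cc \<longleftrightarrow> int k dvd x" by (simp add: dvd_add_left_iff)
  then show ?thesis
    using framing_periodic[of v x 1] root_diff_periodic[of x 1] leaf_diff_periodic[of _ x 1] by (simp add: node_weight_def)
qed

lemma node_weight_minus: "node_weight v a b (- x) = - node_weight v a b x"
  by (simp add: node_weight_def framing_minus root_diff_minus leaf_diff_minus)

text \<open>Once the four leaf sums are done, oddness of the weight in \<open>x1\<close> turns the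
  remaining \<open>edge\<close> between the nodes into a character.\<close>

lemma wrt_sum:
  "(\<Sum>l | \<forall>v. l $ v \<in> {0..<2 * int k} \<and> \<not> int k dvd l $ v. wrt_summand k w l)
    = (\<Sum>x1=0..<cc. \<Sum>x2=0..<cc. node_weight 1 3 4 x1 * node_weight 2 5 6 x2 * unit_root (x1 * x2))"
proof -
  define a where "a = (\<lambda>x1 x2. (framing 1 x1 / root_diff x1 * (framing 2 x2 / root_diff x2)) * edge x1 x2)"
  define L where "L = (\<lambda>v y x. framing v x * root_diff x * edge y x)"
  have "(\<Sum>l | \<forall>v. l $ v \<in> {0..<2 * int k} \<and> \<not> int k dvd l $ v. wrt_summand k w l) = (\<Sum>l | \<forall>v. l $ v \<in> units. wrt_summand k w l)"
    unfolding units_def by (intro sum.cong) auto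
  also have "\<dots> = (\<Sum>x1\<in>units. \<Sum>x2\<in>units. \<Sum>x3\<in>units. \<Sum>x4\<in>units. \<Sum>x5\<in>units. \<Sum>x6\<in>units.
      a x1 x2 * (L 3 x1 x3 * L 4 x1 x4 * L 5 x2 x5 * L 6 x2 x6))"
    unfolding sum_vec_of wrt_summand_vec_of a_def L_def ..
  also have "\<dots> = (\<Sum>x1\<in>units. \<Sum>x2\<in>units. a x1 x2 * (sum (L 3 x1) units * sum (L 4 x1) units * sum (L 5 x2) units * sum (L 6 x2) units))"
    unfolding sum4_product unfolding sum_distrib_left ..
  also have "\<dots> = (\<Sum>x1\<in>units. \<Sum>x2\<in>units. a x1 x2 * (leaf_diff 3 x1 * leaf_diff 4 x1 * leaf_diff 5 x2 * leaf_diff 6 x2))"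
    unfolding L_def leaf_unit_sum ..
  also have "\<dots> = (\<Sum>x1=0..<cc. \<Sum>x2=0..<cc. node_weight 1 3 4 x1 * (node_weight 2 5 6 x2 * edge x1 x2))"
    unfolding sum_units
  proof (intro sum.cong refl)
    fix x1
    show "(if int k dvd x1 then 0 else \<Sum>x2=0..<cc. if int k dvd x2 then 0 else a x1 x2 * (leaf_diff 3 x1 * leaf_diff 4 x1 * leaf_diff 5 x2 * leaf_diff 6 x2))
      = (\<Sum>x2=0..<cc. node_weight 1 3 4 x1 * (node_weight 2 5 6 x2 * edge x1 x2))"
      by (auto intro!: sum.cong simp: node_weight_def a_def mult_ac)
  qed
  also have "\<dots> = (\<Sum>x2=0..<cc. \<Sum>x1=0..<cc. node_weight 2 5 6 x2 * (node_weight 1 3 4 x1 * edge x1 x2))"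
    by (subst sum.swap) (simp only: mult.left_commute)
  also have "\<dots> = (\<Sum>x2=0..<cc. node_weight 2 5 6 x2 * (\<Sum>x1=0..<cc. node_weight 1 3 4 x1 * unit_root (x1 * x2)))"
    unfolding sum_distrib_left[symmetric] odd_sum_edge[OF node_weight_periodic node_weight_minus] ..
  also have "\<dots> = (\<Sum>x1=0..<cc. \<Sum>x2=0..<cc. node_weight 1 3 4 x1 * node_weight 2 5 6 x2 * unit_root (x1 * x2))"
    unfolding sum_distrib_left by (subst sum.swap) (simp only: mult_ac)
  finally show ?thesis .
qed

text \<open>Each vertex \<open>v\<close> sheds the constant \<open>e1 (w $ v / (4 * k))\<close>, the
  leaves through \<open>leaf_diff\<close> and the nodes through \<open>framing\<close>. The minus
  signs of the two node limits cancel.\<close>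

lemma kernel_node_limit:
  "kernel x1 x2 * (node_limit 3 4 x1 * node_limit 5 6 x2) = e1 (of_int (\<Sum>v\<in>UNIV. w $ v) / (4 * real k))
     * (node_weight 1 3 4 x1 * node_weight 2 5 6 x2 * unit_root (x1 * x2))"
proof (cases "int k dvd x1 \<or> int k dvd x2")
  case True
  then show ?thesis by (auto simp: node_limit_def node_weight_def)
next
  case False
  define E where "E = (\<lambda>v. e1 (of_int (w $ v) / (4 * real k)))"
  have bd: "branch v (x + 1) - branch v (x - 1) = E v * leaf_diff v x" for v x
  proof -
    have "E v * e1 (- of_int (w $ v) / (4 * real k)) = 1" unfolding E_def e1_add[symmetric] by simp
    then show ?thesis by (simp add: leaf_diff_def mult.assoc[symmetric])
  qed
  have sumw: "e1 (of_int (\<Sum>v\<in>UNIV. w $ v) / (4 * real k)) = E 1 * E 2 * E 3 * E 4 * E 5 * E 6"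
    unfolding E_def e1_add[symmetric] sum_6 by (simp add: add_divide_distrib)
  have ker: "kernel x1 x2 = E 1 * E 2 * (framing 1 x1 * framing 2 x2 * unit_root (x1 * x2))"
    unfolding kernel_def E_def framing_def unit_root_def e1_add[symmetric] using k_pos
    by (intro arg_cong[of _ _ e1]) (simp add: field_simps)
  show ?thesis
    using False unfolding node_limit_def node_weight_def ker sumw bd root_diff_def[symmetric]
    by simp
qed

theorem wrt_eq_limit:
  "wrt_invariant k w = 1 / (2 * (zeta (2 * k) 1 - zeta (2 * k) (- 1))) *
    (e1 (of_int (- 18 - (\<Sum>v\<in>UNIV. w $ v)) / (4 * real k)) * (1 / (\<i> * of_int cc ^ 3)
     * (\<Sum>x1=0..<cc. \<Sum>x2=0..<cc. kernel x1 x2 * (node_limit 3 4 x1 * node_limit 5 6 x2))))"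
proof -
  define Z where "Z = zeta (2 * k) 1 - zeta (2 * k) (- 1)"
  define S where "S = (\<Sum>x1=0..<cc. \<Sum>x2=0..<cc. node_weight 1 3 4 x1 * node_weight 2 5 6 x2 * unit_root (x1 * x2))"
  define s where "s = (\<Sum>v\<in>UNIV. w $ v)"
  have "(\<Sum>x1=0..<cc. \<Sum>x2=0..<cc. kernel x1 x2 * (node_limit 3 4 x1 * node_limit 5 6 x2)) = e1 (of_int s / (4 * real k)) * S"
    unfolding kernel_node_limit S_def s_def sum_distrib_left ..
  moreover have "e1 (of_int (- 18 - s) / (4 * real k)) * e1 (of_int s / (4 * real k)) = zeta k (- 9 / 2)"
    unfolding e1_add[symmetric] zeta_e1 using k_pos by (intro arg_cong[of _ _ e1]) (simp add: field_simps)
  ultimately have "- \<i> * zeta k (- 9 / 2) / (16 * of_nat k ^ 3 * Z) * S = 1 / (2 * Z) * (e1 (of_int (- 18 - s) / (4 * real k)) * (1 / (\<i> * of_int cc ^ 3)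
      * (\<Sum>x1=0..<cc. \<Sum>x2=0..<cc. kernel x1 x2 * (node_limit 3 4 x1 * node_limit 5 6 x2))))"
    by (rule prefactor_rearrange)
  then show ?thesis
    unfolding wrt_invariant_def wrt_sum Z_def[symmetric] S_def[symmetric] s_def[symmetric] .
qed

end

text \<open>The limit is asserted to exist instead of being written with \<open>Lim\<close>, whose
  value says nothing about convergence.\<close>

theorem theorem1p1:
  fixes w :: "int ^ 6" and k :: nat
  assumes "\<And>v. w $ v < 0"
    and "negative_definite (linking_matrix w)"
    and "det (linking_matrix w) = 1"
    and "k \<ge> 2"
  shows "\<exists>L. ((\<lambda>t. homological_block w (Complex (1 / real k) t)) \<longlongrightarrow> L) (at_right 0)
    \<and> wrt_invariant k w = 1 / (2 * (zeta (2 * k) 1 - zeta (2 * k) (- 1))) * L"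
proof -
  note pivots = negative_definite_node_pivots[OF assms(2,1)]
  have nz: "w $ v \<noteq> 0" for v using assms(1)[of v] by simp
  \<comment> \<open>The determinant formula divides by the leaf weights and by the pivot at node 2,
    which are nonzero by negativity.\<close>
  have "real_of_int ((w $ 1 * (w $ 3 * w $ 4) - w $ 3 - w $ 4) * (w $ 2 * (w $ 5 * w $ 6) - w $ 5 - w $ 6)
      - (w $ 3 * w $ 4) * (w $ 5 * w $ 6)) = of_int 1"
    using det_linking_matrix[of w, OF nz nz nz nz] pivots(2) assms(3) by simp
  then have unimod: "(w $ 1 * (w $ 3 * w $ 4) - w $ 3 - w $ 4) * (w $ 2 * (w $ 5 * w $ 6) - w $ 5 - w $ 6)
      - (w $ 3 * w $ 4) * (w $ 5 * w $ 6) = 1"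
    by (simp only: of_int_eq_iff)
  have "k > 0" using assms(4) by simp
  interpret H_block w k
    by unfold_locales (fact assms pivots unimod \<open>k > 0\<close>)+
  show ?thesis using homological_block_limit wrt_eq_limit by blast
qed

end
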